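(* For a complex finite-dimensional simple Lie algebra $\mathfrak g$ of classical type $X\in\{A_n,B_n,C_n,D_n\}$ (of rank $n$), with a fixed Borel subalgebra $\mathfrak b$ and corresponding set of simple roots $\Pi$, let $P_X(j)$ be the number of $ad$-nilpotent ideals $\mathfrak i$ of $\mathfrak b$ such that $|\Pi\cap\Phi_{\mathfrak i}|=j$, i.e. which contain exactly $j$ root spaces attached to simple roots. Then for all $0\le j\le n$: \begin{align*} &P_{A_n}(j)=\frac{j+1}{n+1}\binom{2n-j}{n},\\ &P_{B_n}(j)=P_{C_n}(j)=\binom{2n-j-1}{n-1},\\ &P_{D_n}(j)=\begin{cases}\binom{2n-2}{n-2}+\binom{2n-3}{n-3} & \text{if } j=0,\\[2pt] \binom{2n-2-j}{n-2}+\binom{2n-3-j}{n-2} & \text{if } 1\le j\le n.\end{cases} \end{align*}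
   Context: Let $\mathfrak g$ be a complex finite-dimensional simple Lie algebra, $\mathfrak b$ a fixed Borel subalgebra, $\mathfrak n$ its nilradical, $\Delta$ the root system of $\mathfrak g$, and $\Delta^+$, $\Pi$ the positive system and simple system of $\Delta$ corresponding to $\mathfrak b$. The type of $\mathfrak g$ (Cartan–Killing) is denoted $X$; as usual the subscript $n$ in $A_n,B_n,C_n,D_n$ is the rank (with the standard ranges, e.g. $n\ge 4$ for $D_n$). For $\alpha\in\Delta$, $\mathfrak g_\alpha$ is the root space of $\alpha$. An $ad$-nilpotent ideal of $\mathfrak b$ is an ideal of $\mathfrak b$ contained in $\mathfrak n$; $\mathcal I(X)$ denotes the set of all of these. Every $\mathfrak i\in\mathcal I(X)$ has the form $\mathfrak i=\bigoplus_{\alpha\in\Phi_{\mathfrak i}}\mathfrak g_\alpha$ for a unique subset $\Phi_{\mathfrak i}\subseteq\Delta^+$, and the subsets $\Phi_{\mathfrak i}$ arising in this way are exactly the dual order ideals (upward closed subsets) of $\Delta^+$ with respect to the usual order: $\alpha<\beta$ if $\beta-\alpha$ is a (nonempty) sum of positive roots. Thus $P_X(j)=|\{\mathfrak i\in\mathcal I(X): |\Pi\cap\Phi_{\mathfrak i}|=j\}|$. Binomial coefficients $\binom{n}{m}$ are the usual ones, with $\binom{n}{m}=0$ if $m<0$ and $\binom{n}{m}=0$ if $0\le n<m$. *)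

theory Defs
  imports Complex_Main "HOL-Library.Function_Algebras"
begin

locale complex_lie_algebra = vector_space scale
  for scale :: "complex \<Rightarrow> 'g::ab_group_add \<Rightarrow> 'g" +
  fixes bracket :: "'g \<Rightarrow> 'g \<Rightarrow> 'g"
  assumes bracket_add_left: "bracket (x + y) z = bracket x z + bracket y z"
    and bracket_add_right: "bracket x (y + z) = bracket x y + bracket x z"
    and bracket_scale_left: "bracket (scale c x) y = scale c (bracket x y)"
    and bracket_scale_right: "bracket x (scale c y) = scale c (bracket x y)"
    and bracket_self: "bracket x x = 0"
    and jacobi: "bracket x (bracket y z) + bracket y (bracket z x) + bracket z (bracket x y) = 0"
begin

definition subalgebra :: "'g set \<Rightarrow> bool" where
  "subalgebra L \<longleftrightarrow> subspace L \<and> (\<forall>x\<in>L. \<forall>y\<in>L. bracket x y \<in> L)"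

definition ideal_of :: "'g set \<Rightarrow> 'g set \<Rightarrow> bool" where
  "ideal_of I L \<longleftrightarrow> subspace I \<and> I \<subseteq> L \<and> (\<forall>x\<in>L. \<forall>y\<in>I. bracket x y \<in> I)"

definition brackets :: "'g set \<Rightarrow> 'g set \<Rightarrow> 'g set" where
  "brackets U V = span {bracket x y | x y. x \<in> U \<and> y \<in> V}"

primrec derived_series :: "'g set \<Rightarrow> nat \<Rightarrow> 'g set" where
  "derived_series L 0 = L"
| "derived_series L (Suc k) = brackets (derived_series L k) (derived_series L k)"

definition solvable :: "'g set \<Rightarrow> bool" where
  "solvable L \<longleftrightarrow> (\<exists>k. derived_series L k = {0})"

primrec lower_central_series :: "'g set \<Rightarrow> nat \<Rightarrow> 'g set" where
  "lower_central_series L 0 = L"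
| "lower_central_series L (Suc k) = brackets L (lower_central_series L k)"

definition nilpotent :: "'g set \<Rightarrow> bool" where
  "nilpotent L \<longleftrightarrow> (\<exists>k. lower_central_series L k = {0})"

definition abelian :: "'g set \<Rightarrow> bool" where
  "abelian L \<longleftrightarrow> (\<forall>x\<in>L. \<forall>y\<in>L. bracket x y = 0)"

definition borel_subalgebra :: "'g set \<Rightarrow> bool" where
  "borel_subalgebra b \<longleftrightarrow> subalgebra b \<and> solvable b \<and>
     (\<forall>c. subalgebra c \<and> solvable c \<and> b \<subseteq> c \<longrightarrow> c = b)"

(* The sum of all nilpotent ideals of L; in finite dimension this sum is itself nilpotent,
   so it is the largest nilpotent ideal. *)
definition nilradical :: "'g set \<Rightarrow> 'g set" where
  "nilradical L = span (\<Union>{I. ideal_of I L \<and> nilpotent I})"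

(* Over the complex numbers a semisimple endomorphism is one whose eigenvectors span. *)
definition ad_semisimple :: "'g \<Rightarrow> bool" where
  "ad_semisimple x \<longleftrightarrow> span {v. \<exists>c. bracket x v = scale c v} = UNIV"

(* The usual definition for semisimple complex Lie algebras (e.g. Helgason, Chapter III):
   a maximal abelian subalgebra all of whose elements are ad-semisimple. *)
definition cartan_subalgebra :: "'g set \<Rightarrow> bool" where
  "cartan_subalgebra h \<longleftrightarrow> subalgebra h \<and> abelian h \<and>
     (\<forall>k. subalgebra k \<and> abelian k \<and> h \<subseteq> k \<longrightarrow> k = h) \<and>
     (\<forall>x\<in>h. ad_semisimple x)"

(* A linear functional on h is encoded as a function on the whole type that is linear on h and
   vanishes off h. Equality, sums and negatives of functionals on h are then the pointwise
   ones on functions. *)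
definition dual_space :: "'g set \<Rightarrow> ('g \<Rightarrow> complex) set" where
  "dual_space h = {\<alpha>. (\<forall>x\<in>h. \<forall>y\<in>h. \<alpha> (x + y) = \<alpha> x + \<alpha> y) \<and>
     (\<forall>c. \<forall>x\<in>h. \<alpha> (scale c x) = c * \<alpha> x) \<and> (\<forall>x. x \<notin> h \<longrightarrow> \<alpha> x = 0)}"

definition root_space :: "'g set \<Rightarrow> ('g \<Rightarrow> complex) \<Rightarrow> 'g set" where
  "root_space h \<alpha> = {v. \<forall>x\<in>h. bracket x v = scale (\<alpha> x) v}"

definition roots :: "'g set \<Rightarrow> ('g \<Rightarrow> complex) set" where
  "roots h = {\<alpha> \<in> dual_space h. \<alpha> \<noteq> 0 \<and> root_space h \<alpha> \<noteq> {0}}"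

definition positive_roots :: "'g set \<Rightarrow> 'g set \<Rightarrow> ('g \<Rightarrow> complex) set" where
  "positive_roots h b = {\<alpha> \<in> roots h. root_space h \<alpha> \<subseteq> b}"

definition simple_roots :: "'g set \<Rightarrow> 'g set \<Rightarrow> ('g \<Rightarrow> complex) set" where
  "simple_roots h b = {\<alpha> \<in> positive_roots h b.
     \<not> (\<exists>\<beta>\<in>positive_roots h b. \<exists>\<gamma>\<in>positive_roots h b. \<alpha> = \<beta> + \<gamma>)}"

definition coroot :: "'g set \<Rightarrow> ('g \<Rightarrow> complex) \<Rightarrow> 'g" where
  "coroot h \<alpha> = (THE t. t \<in> brackets (root_space h \<alpha>) (root_space h (- \<alpha>)) \<and> \<alpha> t = 2)"

definition ad_nilpotent_ideals :: "'g set \<Rightarrow> 'g set set" where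
  "ad_nilpotent_ideals b = {I. ideal_of I b \<and> I \<subseteq> nilradical b}"

definition ideal_roots :: "'g set \<Rightarrow> 'g set \<Rightarrow> 'g set \<Rightarrow> ('g \<Rightarrow> complex) set" where
  "ideal_roots h b I = {\<alpha> \<in> positive_roots h b. root_space h \<alpha> \<subseteq> I}"

definition num_ideals :: "'g set \<Rightarrow> 'g set \<Rightarrow> nat \<Rightarrow> nat" where
  "num_ideals h b j =
     card {I \<in> ad_nilpotent_ideals b. card (simple_roots h b \<inter> ideal_roots h b I) = j}"

end

locale simple_complex_lie_algebra = complex_lie_algebra scale bracket
  for scale :: "complex \<Rightarrow> 'g::ab_group_add \<Rightarrow> 'g" and bracket +
  assumes finite_dimensional: "\<exists>B. finite B \<and> span B = UNIV"
    and not_abelian: "\<not> abelian UNIV"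
    and ideals_trivial: "ideal_of I UNIV \<Longrightarrow> I = {0} \<or> I = UNIV"

datatype classical_type = Type_A | Type_B | Type_C | Type_D

definition chain_matrix :: "nat \<Rightarrow> nat \<Rightarrow> int" where
  "chain_matrix i j = (if i = j then 2 else if i + 1 = j \<or> j + 1 = i then - 1 else 0)"

(* Entry (i, j), with indices in {1..n}, is the value of the i-th simple root on the j-th simple
   coroot, with Bourbaki's numbering of the Dynkin diagrams: the last simple root is the short one
   in type B and the long one in type C, and in type D the last two nodes are both joined to
   node n - 2. *)
fun cartan_matrix :: "classical_type \<Rightarrow> nat \<Rightarrow> nat \<Rightarrow> nat \<Rightarrow> int" where
  "cartan_matrix Type_A n i j = chain_matrix i j"
| "cartan_matrix Type_B n i j = (if i + 1 = n \<and> j = n then - 2 else chain_matrix i j)"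
| "cartan_matrix Type_C n i j = (if i = n \<and> j + 1 = n then - 2 else chain_matrix i j)"
| "cartan_matrix Type_D n i j =
     (if {i, j} = {n - 1, n} then 0
      else if {i, j} = {n - 2, n} then - 1
      else chain_matrix i j)"

fun standard_rank :: "classical_type \<Rightarrow> nat \<Rightarrow> bool" where
  "standard_rank Type_A n \<longleftrightarrow> n \<ge> 1"
| "standard_rank Type_B n \<longleftrightarrow> n \<ge> 2"
| "standard_rank Type_C n \<longleftrightarrow> n \<ge> 2"
| "standard_rank Type_D n \<longleftrightarrow> n \<ge> 4"

definition (in complex_lie_algebra) has_type ::
    "'g set \<Rightarrow> 'g set \<Rightarrow> classical_type \<Rightarrow> nat \<Rightarrow> bool" where
  "has_type h b X n \<longleftrightarrow> standard_rank X n \<and>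
     (\<exists>\<alpha>. bij_betw \<alpha> {1..n} (simple_roots h b) \<and>
       (\<forall>i\<in>{1..n}. \<forall>j\<in>{1..n}. \<alpha> i (coroot h (\<alpha> j)) = of_int (cartan_matrix X n i j)))"

end

theory Submission
  imports Defs
begin

text \<open>The Lie algebra enters only through its positive roots. Without the Killing form, one shows
  that every root belongs to an sl2-triple: the root spaces of the remaining roots would span a proper
  ideal, because two roots with proportional coroots differ at most by a sign (otherwise the product of
  the two reflections would have infinite order on the finite set of weights). A maximal solvable
  subalgebra containing the Cartan subalgebra is the sum of the Cartan subalgebra and the root spaces
  of a set of roots which is closed, free of vanishing sums and maximal with these properties, hence
  a positive system. Its ad-nilpotent ideals are the sums of root spaces over upper sets of positive
  roots. Simple reflections and the positive definiteness of the standard form identify this poset,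
  from the Cartan matrix alone, with the positive roots in the usual coordinates.

  There the rows (roots with the same first index) form a staircase, and an upper set with \<open>r\<close>
  nonempty rows is a weakly increasing sequence of row minima, that is, a ballot sequence whose
  contacts with the diagonal are the simple roots. With at most \<open>k\<close> columns to the right of row \<open>r\<close>
  and \<open>j\<close> contacts their number is a difference of two binomial coefficients, and the sum over
  \<open>r\<close> telescopes.\<close>

section \<open>Weight spaces\<close>

text \<open>The Killing form usually supplies the sl2-triples. Its place is taken by two facts. If
  the bracket t of two opposite root vectors is killed by their root \<alpha>, then all weights
  vanish on t, because highest weights are proportional to \<alpha>(t); so t is central, hence 0.
  And whatever would create infinitely many weights is impossible. Positivity is likewise defined
  without a separating functional: the absence of vanishing sums replaces it, and
  \<open>depth\<close> is a height available before simple roots.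

  The type is known only through the Cartan matrix, so the map to coordinates cannot be written down
  root by root. Definiteness gives each non-simple positive root, on either side, a simple
  reflection that lowers its height; so both sets grow from the simple roots by the same
  reflections.

  Types B and C lead to the same staircase, which is why their formulas agree. Type D is not a
  staircase, since two middle columns are incomparable; inclusion-exclusion along the diagram
  symmetry reduces it to two staircases.\<close>

context complex_lie_algebra
begin

lemma bracket_zero_left [simp]: "bracket 0 x = 0"
  using bracket_add_left[of 0 0 x] by simp

lemma bracket_zero_right [simp]: "bracket x 0 = 0"
  using bracket_add_right[of x 0 0] by simp

lemma bracket_minus_left [simp]: "bracket (- x) y = - bracket x y"
  using bracket_add_left[of x "- x" y] by (simp add: eq_neg_iff_add_eq_0 add.commute)

lemma bracket_minus_right [simp]: "bracket x (- y) = - bracket x y"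
  using bracket_add_right[of x y "- y"] by (simp add: eq_neg_iff_add_eq_0 add.commute)

lemma bracket_diff_left: "bracket (x - y) z = bracket x z - bracket y z"
  using bracket_add_left[of x "- y" z] by simp

lemma bracket_anti: "bracket x y = - bracket y x"
proof -
  have "0 = bracket (x + y) (x + y)" by (simp only: bracket_self)
  also have "\<dots> = bracket x y + bracket y x"
    unfolding bracket_add_left bracket_add_right by (simp add: bracket_self)
  finally show ?thesis by (simp add: eq_neg_iff_add_eq_0)
qed

lemma bracket_sum_right: "bracket x (sum f A) = (\<Sum>a\<in>A. bracket x (f a))"
  by (induction A rule: infinite_finite_induct) (simp_all add: bracket_add_right)

lemma jacobi_left: "bracket x (bracket y z) = bracket (bracket x y) z + bracket y (bracket x z)"
proof -
  have "bracket x (bracket y z) - bracket y (bracket x z) - bracket (bracket x y) z = 0"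
    using jacobi[of x y z] bracket_anti[of z x] bracket_anti[of z "bracket x y"] by simp
  then show ?thesis by (simp add: algebra_simps)
qed

lemma bracket_span:
  assumes AB: "\<And>x y. x \<in> A \<Longrightarrow> y \<in> B \<Longrightarrow> bracket x y \<in> W" and W: "subspace W"
    and "x \<in> span A" "y \<in> span B"
  shows "bracket x y \<in> W"
proof -
  have *: "bracket x y \<in> W" if "x \<in> A" "y \<in> span B" for x y
    using that(2)
    by (rule span_induct)
      (use that(1) AB W in \<open>auto simp: subspace_def bracket_add_right bracket_scale_right\<close>)
  show ?thesis
    using assms(3)
    by (rule span_induct)
      (use assms(4) * W in \<open>auto simp: subspace_def bracket_add_left bracket_scale_left\<close>)
qed

lemma subspace_root_space [simp]: "subspace (root_space X \<mu>)"
  unfolding root_space_def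
  by (auto simp: subspace_def bracket_add_right bracket_scale_right scale_right_distrib mult.commute)

lemma root_spaceD: "v \<in> root_space X \<mu> \<Longrightarrow> x \<in> X \<Longrightarrow> bracket x v = scale (\<mu> x) v"
  by (simp add: root_space_def)

lemma root_spaceD': "v \<in> root_space X \<mu> \<Longrightarrow> x \<in> X \<Longrightarrow> bracket v x = scale (- \<mu> x) v"
  by (subst bracket_anti) (simp add: root_space_def)

lemma zero_root_space [simp]: "0 \<in> root_space X \<mu>"
  by (simp add: root_space_def)

lemma bracket_root_space:
  assumes "x \<in> root_space X \<alpha>" "y \<in> root_space X \<beta>"
  shows "bracket x y \<in> root_space X (\<alpha> + \<beta>)"
  using assms unfolding root_space_def
  by (auto simp: jacobi_left[of _ x y] bracket_scale_left bracket_scale_right scale_left_distrib)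

text \<open>Subtracting \<open>m a x\<close> from the action of x kills the component at
  \<open>a\<close> and keeps a chosen other one up to a nonzero factor, so induction on the index
  set applies. With W = {0} this is independence of vectors of distinct weights; for h-stable W it
  splits subalgebras and ideals into root spaces.\<close>

lemma weight_components:
  assumes "finite I" and W: "subspace W" "\<And>x w. x \<in> X \<Longrightarrow> w \<in> W \<Longrightarrow> bracket x w \<in> W"
    and "\<And>i. i \<in> I \<Longrightarrow> v i \<in> root_space X (m i)"
    and "\<And>i j. i \<in> I \<Longrightarrow> j \<in> I \<Longrightarrow> i \<noteq> j \<Longrightarrow> \<exists>x\<in>X. m i x \<noteq> m j x"
    and "(\<Sum>i\<in>I. v i) \<in> W" and "k \<in> I"
  shows "v k \<in> W"
  using assms(1,4-)
proof (induction I arbitrary: v k rule: finite_induct)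
  case (insert a I)
  have other: "v i \<in> W" if i: "i \<in> I" for i
  proof -
    obtain x where x: "x \<in> X" "m i x \<noteq> m a x"
      using insert.prems(2)[of i a] i insert.hyps(2) by auto
    define u where "u j = scale (m j x - m a x) (v j)" for j
    have "bracket x (\<Sum>i\<in>insert a I. v i) - scale (m a x) (\<Sum>i\<in>insert a I. v i) \<in> W"
      using W x(1) insert.prems(3) by (simp add: subspace_diff subspace_scale)
    also have "bracket x (\<Sum>i\<in>insert a I. v i) - scale (m a x) (\<Sum>i\<in>insert a I. v i)
        = (\<Sum>i\<in>insert a I. u i)"
      unfolding bracket_sum_right scale_sum_right sum_subtractf[symmetric]
      by (rule sum.cong)
        (use x(1) root_spaceD[OF insert.prems(1)] in \<open>auto simp: u_def scale_left_diff_distrib\<close>)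
    also have "\<dots> = (\<Sum>i\<in>I. u i)"
      using insert.hyps by (simp add: u_def)
    finally have "(\<Sum>i\<in>I. u i) \<in> W" .
    then have "u i \<in> W"
      using insert.IH[of u i] insert.prems(1,2) i
      by (simp add: u_def subspace_scale)
    then have "scale (inverse (m i x - m a x)) (u i) \<in> W"
      using W by (simp add: subspace_scale)
    then show ?thesis using x by (simp add: u_def)
  qed
  have "(\<Sum>i\<in>insert a I. v i) - (\<Sum>i\<in>I. v i) \<in> W"
    using W(1) insert.prems(3) subspace_sum[OF W(1) other] by (rule subspace_diff)
  then have "v a \<in> W"
    using insert.hyps by simp
  then show ?case using other insert.prems(4) by auto
qed simp

lemma span_UN_subspaces:
  assumes "v \<in> span (\<Union>i\<in>I. V i)" and V: "\<And>i. i \<in> I \<Longrightarrow> subspace (V i)"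
  shows "\<exists>J u. finite J \<and> J \<subseteq> I \<and> (\<forall>i\<in>J. u i \<in> V i) \<and> v = (\<Sum>i\<in>J. u i)"
  using assms(1)
proof (induction rule: span_induct_alt)
  case base
  show ?case by (rule exI[of _ "{}"]) simp
next
  case (step c x y)
  then obtain J u where J: "finite J" "J \<subseteq> I" "\<forall>i\<in>J. u i \<in> V i" "y = (\<Sum>i\<in>J. u i)" by blast
  obtain i where i: "i \<in> I" "x \<in> V i" using step by blast
  define w where "w = u(i := scale c x + (if i \<in> J then u i else 0))"
  have "scale c x + y = (\<Sum>k\<in>insert i J. w k)"
  proof (cases "i \<in> J")
    case True
    then have "sum u J = u i + sum u (J - {i})" "sum w J = w i + sum u (J - {i})"
      using J(1) by (simp_all add: sum.remove w_def)
    then show ?thesis using True J by (simp add: w_def insert_absorb add.assoc)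
  next
    case False
    then have "sum w J = sum u J" by (intro sum.cong) (auto simp: w_def)
    then show ?thesis using J False by (simp add: w_def)
  qed
  moreover have "\<forall>k\<in>insert i J. w k \<in> V k"
    using J i V by (auto simp: w_def subspace_add subspace_scale)
  ultimately show ?case using J i by (intro exI[of _ "insert i J"] exI[of _ w]) auto
qed

end

section \<open>Weight decomposition for a Cartan subalgebra\<close>

locale cartan_setup = simple_complex_lie_algebra scale bracket
  for scale :: "complex \<Rightarrow> 'g::ab_group_add \<Rightarrow> 'g" and bracket +
  fixes h :: "'g set"
  assumes cartan: "cartan_subalgebra h"
begin

lemma subspace_h: "subspace h"
  using cartan by (simp add: cartan_subalgebra_def subalgebra_def)

lemma h_abelian: "x \<in> h \<Longrightarrow> y \<in> h \<Longrightarrow> bracket x y = 0"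
  using cartan by (simp add: cartan_subalgebra_def abelian_def)

lemma span_eigenvectors: "x \<in> h \<Longrightarrow> span {v. \<exists>c. bracket x v = scale c v} = UNIV"
  using cartan by (simp add: cartan_subalgebra_def ad_semisimple_def)

text \<open>Together with h such an element spans an abelian subalgebra, so maximality of h
  applies.\<close>

lemma centralizer_h:
  assumes v: "\<And>x. x \<in> h \<Longrightarrow> bracket x v = 0"
  shows "v \<in> h"
proof -
  let ?k = "span (insert v h)"
  have *: "bracket x y \<in> {0}" if "x \<in> ?k" "y \<in> ?k" for x y
  proof (rule bracket_span[OF _ _ that])
    show "bracket x y \<in> {0}" if "x \<in> insert v h" "y \<in> insert v h" for x y
      using that v h_abelian bracket_anti[of v y] by (auto simp: bracket_self)
  qed simp
  have "subalgebra ?k"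
    using * by (auto simp: subalgebra_def span_zero)
  moreover have "abelian ?k"
    using * by (auto simp: abelian_def)
  moreover have "h \<subseteq> ?k"
    using span_superset by blast
  ultimately have "?k = h"
    using cartan unfolding cartan_subalgebra_def by blast
  then show ?thesis by (metis insertI1 span_base)
qed

lemma root_space_0: "root_space h 0 = h"
  using h_abelian centralizer_h by (auto simp: root_space_def)

text \<open>Simultaneous diagonalisation: x commutes with F, so each joint eigenspace of F is stable
  under x and contains the x-components of its vectors. Here \<mu> is only a family of eigenvalues
  on F; linearity is established afterwards.\<close>

lemma span_joint_eigenvectors:
  assumes "finite F" "F \<subseteq> h"
  shows "span (\<Union>\<mu>. root_space F \<mu>) = UNIV"
  using assms
proof (induction F rule: finite_induct)
  case empty
  then show ?case by (simp add: root_space_def)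
next
  case (insert x F)
  have "root_space F \<mu> \<subseteq> span (\<Union>\<mu>. root_space (insert x F) \<mu>)" for \<mu>
  proof
    fix v assume v: "v \<in> root_space F \<mu>"
    have "v \<in> span (\<Union>c. root_space {x} (\<lambda>_. c))"
      using span_eigenvectors[of x] insert.prems by (auto simp: root_space_def Collect_ex_eq)
    from span_UN_subspaces[OF this] obtain J u where J: "finite J"
      "\<forall>c\<in>J. u c \<in> root_space {x} (\<lambda>_. c)" "v = (\<Sum>c\<in>J. u c)" by auto
    have "u c \<in> root_space (insert x F) (\<mu>(x := c))" if c: "c \<in> J" for c
    proof -
      have "u c \<in> root_space F \<mu>"
      proof (rule weight_components[where X = "{x}" and m = "\<lambda>c _. c" and I = J])
        fix y w assume "y \<in> {x}" "w \<in> root_space F \<mu>"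
        moreover have "bracket z x = 0" if "z \<in> F" for z
          using that insert.prems h_abelian by auto
        ultimately show "bracket y w \<in> root_space F \<mu>"
          by (auto simp: root_space_def jacobi_left[of _ x w] bracket_scale_right)
      qed (use J v c in auto)
      then show ?thesis
        using J c insert.hyps by (auto simp: root_space_def)
    qed
    then show "v \<in> span (\<Union>\<mu>. root_space (insert x F) \<mu>)"
      unfolding J(3) by (intro span_sum span_base) auto
  qed
  then have "span (\<Union>\<mu>. root_space F \<mu>) \<subseteq> span (\<Union>\<mu>. root_space (insert x F) \<mu>)"
    by (intro span_minimal) auto
  then show ?case using insert by auto
qed

lemma dual_space_ext:
  "\<alpha> \<in> dual_space h \<Longrightarrow> \<beta> \<in> dual_space h \<Longrightarrow> (\<And>x. x \<in> h \<Longrightarrow> \<alpha> x = \<beta> x) \<Longrightarrow> \<alpha> = \<beta>"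
  unfolding dual_space_def by (rule ext) (metis (mono_tags, lifting) mem_Collect_eq)

lemma dual_space_0 [simp]: "0 \<in> dual_space h"
  by (simp add: dual_space_def)

lemma dual_space_add [simp]: "\<alpha> \<in> dual_space h \<Longrightarrow> \<beta> \<in> dual_space h \<Longrightarrow> \<alpha> + \<beta> \<in> dual_space h"
  by (simp add: dual_space_def algebra_simps)

lemma dual_space_minus [simp]: "\<alpha> \<in> dual_space h \<Longrightarrow> - \<alpha> \<in> dual_space h"
  by (simp add: dual_space_def algebra_simps)

lemma dual_apply_scale: "\<alpha> \<in> dual_space h \<Longrightarrow> x \<in> h \<Longrightarrow> \<alpha> (scale c x) = c * \<alpha> x"
  by (simp add: dual_space_def)

lemma dual_apply_add: "\<alpha> \<in> dual_space h \<Longrightarrow> x \<in> h \<Longrightarrow> y \<in> h \<Longrightarrow> \<alpha> (x + y) = \<alpha> x + \<alpha> y"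
  by (simp add: dual_space_def)

text \<open>The eigenvalue of y on a fixed nonzero v is unique and hence linear in y. Setting it to
  0 off h gives the normal form required by \<open>dual_space\<close>.\<close>

lemma joint_eigenvector_weight:
  assumes "v \<noteq> 0" and v: "v \<in> root_space F \<mu>" and F: "h = span F"
  shows "\<exists>\<nu>\<in>dual_space h. v \<in> root_space h \<nu>"
proof -
  have "\<exists>c. bracket y v = scale c v" if "y \<in> span F" for y
    using that
  proof (rule span_induct)
    show "subspace {y. \<exists>c. bracket y v = scale c v}"
      unfolding subspace_def mem_Collect_eq
    proof (intro conjI ballI allI)
      show "\<exists>c. bracket 0 v = scale c v" by (rule exI[of _ 0]) simp
      show "\<exists>c. bracket (x + y) v = scale c v"
        if "x \<in> {y. \<exists>c. bracket y v = scale c v}" "y \<in> {y. \<exists>c. bracket y v = scale c v}" for x y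
        using that by (auto simp: bracket_add_left scale_left_distrib[symmetric])
      show "\<exists>c. bracket (scale a x) v = scale c v"
        if "x \<in> {y. \<exists>c. bracket y v = scale c v}" for a x
        using that by (auto simp: bracket_scale_left)
    qed
  qed (use v in \<open>auto simp: root_space_def\<close>)
  then obtain c where c: "\<And>y. y \<in> h \<Longrightarrow> bracket y v = scale (c y) v"
    unfolding F by metis
  have uniq: "a = b" if "scale a v = scale b v" for a b
    using that \<open>v \<noteq> 0\<close> by simp
  define \<nu> where "\<nu> y = (if y \<in> h then c y else 0)" for y
  have "\<nu> \<in> dual_space h"
    unfolding dual_space_def mem_Collect_eq
  proof (intro conjI ballI allI impI)
    show "\<nu> (x + y) = \<nu> x + \<nu> y" if "x \<in> h" "y \<in> h" for x y
    proof (rule uniq)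
      have "x + y \<in> h" using that subspace_h by (simp add: subspace_add)
      then show "scale (\<nu> (x + y)) v = scale (\<nu> x + \<nu> y) v"
        using that by (simp add: \<nu>_def c[symmetric] scale_left_distrib bracket_add_left)
    qed
    show "\<nu> (scale a x) = a * \<nu> x" if "x \<in> h" for a x
    proof (rule uniq)
      have "scale a x \<in> h" using that subspace_h by (simp add: subspace_scale)
      then show "scale (\<nu> (scale a x)) v = scale (a * \<nu> x) v"
        using that
        by (simp add: \<nu>_def c[symmetric] scale_scale[symmetric] bracket_scale_left del: scale_scale)
    qed
  qed (simp add: \<nu>_def)
  moreover have "v \<in> root_space h \<nu>"
    by (simp add: root_space_def \<nu>_def c)
  ultimately show ?thesis by blast
qed

text \<open>Unlike \<open>roots\<close>, this set admits 0, because root strings pass through the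
  weight space h of 0.\<close>

definition weights :: "('g \<Rightarrow> complex) set" where
  "weights = {\<mu> \<in> dual_space h. root_space h \<mu> \<noteq> {0}}"

lemma weights_dual: "\<mu> \<in> weights \<Longrightarrow> \<mu> \<in> dual_space h"
  by (simp add: weights_def)

lemma weightsI: "v \<in> root_space h \<mu> \<Longrightarrow> v \<noteq> 0 \<Longrightarrow> \<mu> \<in> dual_space h \<Longrightarrow> \<mu> \<in> weights"
  by (auto simp: weights_def)

lemma weightsE: assumes "\<mu> \<in> weights" obtains v where "v \<in> root_space h \<mu>" "v \<noteq> 0"
  using assms zero_root_space[of h \<mu>] by (auto simp: weights_def)

lemma roots_eq: "roots h = weights - {0}"
  by (auto simp: roots_def weights_def)

lemma finite_spanning_subset: obtains F where "finite F" "F \<subseteq> h" "h = span F"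
proof -
  obtain F where F: "F \<subseteq> h" "independent F" "h \<subseteq> span F"
    using maximal_independent_subset by blast
  moreover have "finite F"
    using finite_dimensional independent_span_bound F(2) by (metis UNIV_I subsetI)
  moreover have "span F = h"
    using F subspace_h by (simp add: span_minimal subset_antisym)
  ultimately show thesis using that by blast
qed

lemma span_weight_spaces: "span (\<Union>\<mu>\<in>weights. root_space h \<mu>) = UNIV"
proof -
  obtain F where F: "finite F" "F \<subseteq> h" "h = span F" by (rule finite_spanning_subset)
  have "v \<in> span (\<Union>\<mu>\<in>weights. root_space h \<mu>)" if "v \<in> root_space F \<mu>" for v \<mu>
  proof (cases "v = 0")
    case False
    then show ?thesis
      using joint_eigenvector_weight[OF False that F(3)] weightsI by (blast intro: span_base)
  qed (simp add: span_zero)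
  then have "span (\<Union>\<mu>. root_space F \<mu>) \<subseteq> span (\<Union>\<mu>\<in>weights. root_space h \<mu>)"
    by (intro span_minimal) auto
  then show ?thesis using span_joint_eigenvectors[OF F(1,2)] by auto
qed

lemma weights_differ:
  "\<mu> \<in> dual_space h \<Longrightarrow> \<nu> \<in> dual_space h \<Longrightarrow> \<mu> \<noteq> \<nu> \<Longrightarrow> \<exists>x\<in>h. \<mu> x \<noteq> \<nu> x"
  using dual_space_ext by blast

lemma finite_weights: "finite weights"
proof -
  obtain B where B: "finite B" "span B = UNIV" using finite_dimensional by blast
  have "\<forall>\<mu>\<in>weights. \<exists>v. v \<in> root_space h \<mu> \<and> v \<noteq> 0"
    using weightsE by metis
  then obtain e where e: "\<And>\<mu>. \<mu> \<in> weights \<Longrightarrow> e \<mu> \<in> root_space h \<mu> \<and> e \<mu> \<noteq> 0" by metis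
  have inj: "inj_on e weights"
  proof (rule inj_onI, rule ccontr)
    fix \<mu> \<nu> assume *: "\<mu> \<in> weights" "\<nu> \<in> weights" "e \<mu> = e \<nu>" "\<mu> \<noteq> \<nu>"
    then obtain x where "x \<in> h" "\<mu> x \<noteq> \<nu> x" using weights_differ weights_dual by blast
    moreover from this have "scale (\<mu> x) (e \<mu>) = scale (\<nu> x) (e \<mu>)"
      using * e by (metis root_spaceD)
    ultimately show False using e * by simp
  qed
  have "independent (e ` weights)"
    unfolding dependent_explicit
  proof (rule notI, elim exE conjE bexE)
    fix S u v
    assume S: "finite S" "S \<subseteq> e ` weights" "(\<Sum>v\<in>S. scale (u v) v) = 0" "v \<in> S" "u v \<noteq> 0"
    let ?m = "inv_into weights e"
    have m: "?m x \<in> weights" "e (?m x) = x" if "x \<in> S" for x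
      using that S(2) by (auto intro!: inv_into_into f_inv_into_f[of _ e])
    have "scale (u v) v \<in> {0}"
    proof (rule weight_components[where X = h and m = ?m and I = S and v = "\<lambda>x. scale (u x) x"])
      show "scale (u x) x \<in> root_space h (?m x)" if "x \<in> S" for x
        using m[OF that] e by (metis subspace_root_space subspace_scale)
      show "\<exists>x\<in>h. ?m i x \<noteq> ?m j x" if "i \<in> S" "j \<in> S" "i \<noteq> j" for i j
        using that m by (intro weights_differ weights_dual) metis+
    qed (use S in auto)
    then show False using S m e by fastforce
  qed
  then have "finite (e ` weights)"
    using independent_span_bound[OF B(1)] B(2) by auto
  then show ?thesis using inj finite_imageD by blast
qed

lemma finite_roots: "finite (roots h)"
  using finite_weights by (simp add: roots_eq)

lemma weight_decomposition:
  obtains u where "\<And>\<mu>. \<mu> \<in> weights \<Longrightarrow> u \<mu> \<in> root_space h \<mu>" "v = (\<Sum>\<mu>\<in>weights. u \<mu>)"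
proof -
  have "v \<in> span (\<Union>\<mu>\<in>weights. root_space h \<mu>)"
    using span_weight_spaces by simp
  from span_UN_subspaces[OF this] obtain J u where J: "finite J" "J \<subseteq> weights"
      "\<forall>\<mu>\<in>J. u \<mu> \<in> root_space h \<mu>" "v = (\<Sum>\<mu>\<in>J. u \<mu>)" by auto
  show thesis
  proof (rule that[of "\<lambda>\<mu>. if \<mu> \<in> J then u \<mu> else 0"])
    show "v = (\<Sum>\<mu>\<in>weights. if \<mu> \<in> J then u \<mu> else 0)"
      using J finite_weights by (simp add: sum.If_cases Int_absorb1)
  qed (use J in auto)
qed

lemma stable_subspace_span:
  assumes W: "subspace W" "\<And>x w. x \<in> h \<Longrightarrow> w \<in> W \<Longrightarrow> bracket x w \<in> W"
  shows "W = span (\<Union>\<mu>\<in>weights. W \<inter> root_space h \<mu>)"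
proof
  show "span (\<Union>\<mu>\<in>weights. W \<inter> root_space h \<mu>) \<subseteq> W"
    using W by (intro span_minimal) auto
  show "W \<subseteq> span (\<Union>\<mu>\<in>weights. W \<inter> root_space h \<mu>)"
  proof
    fix w assume w: "w \<in> W"
    obtain u where u: "\<And>\<mu>. \<mu> \<in> weights \<Longrightarrow> u \<mu> \<in> root_space h \<mu>" "w = (\<Sum>\<mu>\<in>weights. u \<mu>)"
      using weight_decomposition[of w] by blast
    have "u \<mu> \<in> W" if "\<mu> \<in> weights" for \<mu>
      by (rule weight_components[where X = h and m = "\<lambda>\<mu>. \<mu>", OF finite_weights W])
        (use that u w weights_differ weights_dual in auto)
    then show "w \<in> span (\<Union>\<mu>\<in>weights. W \<inter> root_space h \<mu>)"
      unfolding u(2) using u(1) by (intro span_sum span_base) auto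
  qed
qed

lemma component_in_span:
  assumes M: "M \<subseteq> weights" and V: "\<And>\<nu>. \<nu> \<in> M \<Longrightarrow> subspace (V \<nu>)"
    "\<And>\<nu>. \<nu> \<in> M \<Longrightarrow> V \<nu> \<subseteq> root_space h \<nu>"
    and \<mu>: "\<mu> \<in> dual_space h" "v \<in> root_space h \<mu>" and v: "v \<in> span (\<Union>\<nu>\<in>M. V \<nu>)"
  shows "v = 0 \<or> (\<mu> \<in> M \<and> v \<in> V \<mu>)"
proof -
  obtain J u where J: "finite J" "J \<subseteq> M" "\<forall>\<nu>\<in>J. u \<nu> \<in> V \<nu>" "v = (\<Sum>\<nu>\<in>J. u \<nu>)"
    using span_UN_subspaces[OF v] V(1) by blast
  define w where "w \<nu> = (if \<nu> \<in> J then u \<nu> else 0) - (if \<nu> = \<mu> then v else 0)" for \<nu>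
  have "w \<mu> \<in> {0}"
  proof (rule weight_components[where X = h and m = "\<lambda>\<mu>. \<mu>" and I = "insert \<mu> J"])
    show "w \<nu> \<in> root_space h \<nu>" if "\<nu> \<in> insert \<mu> J" for \<nu>
      unfolding w_def using that J V(2) \<mu>
      by (intro subspace_diff[OF subspace_root_space]) auto
    show "\<exists>x\<in>h. i x \<noteq> j x" if "i \<in> insert \<mu> J" "j \<in> insert \<mu> J" "i \<noteq> j" for i j
      using that J(2) M \<mu>(1) weights_dual by (intro weights_differ) blast+
    have "(\<Sum>i\<in>insert \<mu> J. w i) = (\<Sum>i\<in>insert \<mu> J. if i \<in> J then u i else 0) - v"
      using J(1) by (simp add: w_def sum_subtractf)
    also have "(\<Sum>i\<in>insert \<mu> J. if i \<in> J then u i else 0) = v"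
      unfolding J(4) using J(1) by (intro sum.mono_neutral_cong_right) auto
    finally show "(\<Sum>i\<in>insert \<mu> J. w i) \<in> {0}" by simp
  qed (use J in auto)
  then show ?thesis using J by (auto simp: w_def split: if_splits)
qed

end

section \<open>Roots and sl2-triples\<close>

context cartan_setup
begin

lemma dual_shift [simp]:
  "\<mu> \<in> dual_space h \<Longrightarrow> \<alpha> \<in> dual_space h \<Longrightarrow> (\<lambda>s. \<mu> s + c * \<alpha> s) \<in> dual_space h"
  by (simp add: dual_space_def algebra_simps)

lemma dual_apply_minus: "\<alpha> \<in> dual_space h \<Longrightarrow> t \<in> h \<Longrightarrow> \<alpha> (- t) = - \<alpha> t"
  using dual_apply_scale[of \<alpha> t "-1"] by simp

lemma dual_apply_diff: "\<alpha> \<in> dual_space h \<Longrightarrow> s \<in> h \<Longrightarrow> t \<in> h \<Longrightarrow> \<alpha> (s - t) = \<alpha> s - \<alpha> t"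
  using dual_apply_add[of \<alpha> s "- t"] subspace_neg[OF subspace_h] by (simp add: dual_apply_minus)

lemma bracket_power_root_space:
  assumes "x \<in> root_space h \<alpha>" "v \<in> root_space h \<mu>"
  shows "(bracket x ^^ k) v \<in> root_space h (\<lambda>s. \<mu> s + of_nat k * \<alpha> s)"
proof (induction k)
  case (Suc k)
  have "bracket x ((bracket x ^^ k) v) \<in> root_space h (\<alpha> + (\<lambda>s. \<mu> s + of_nat k * \<alpha> s))"
    using assms(1) Suc by (rule bracket_root_space)
  also have "\<alpha> + (\<lambda>s. \<mu> s + of_nat k * \<alpha> s) = (\<lambda>s. \<mu> s + of_nat (Suc k) * \<alpha> s)"
    by (rule ext) (simp add: algebra_simps)
  finally show ?case by simp
qed (use assms in simp)

text \<open>Otherwise the functionals \<mu> + k\<alpha> would be infinitely many distinct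
  weights.\<close>

lemma bracket_power_terminates:
  assumes x: "x \<in> root_space h \<alpha>" and \<alpha>: "\<alpha> \<in> dual_space h" "\<alpha> \<noteq> 0"
    and v: "v \<in> root_space h \<mu>" "\<mu> \<in> dual_space h" "v \<noteq> 0"
  shows "\<exists>p. (bracket x ^^ p) v \<noteq> 0 \<and> bracket x ((bracket x ^^ p) v) = 0"
proof (rule ccontr)
  assume contra: "\<not> ?thesis"
  have nz: "(bracket x ^^ k) v \<noteq> 0" for k
    by (induction k) (use v contra in auto)
  let ?f = "\<lambda>k::nat. (\<lambda>s. \<mu> s + of_nat k * \<alpha> s)"
  have "range ?f \<subseteq> weights"
    using nz bracket_power_root_space[OF x v(1)] \<alpha> v
    by (auto intro!: weightsI dual_shift)
  moreover obtain s where s: "\<alpha> s \<noteq> 0" using \<alpha>(2) by (auto simp: fun_eq_iff)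
  have "inj ?f"
  proof (rule injI)
    fix i j assume "?f i = ?f j"
    then have "\<mu> s + of_nat i * \<alpha> s = \<mu> s + of_nat j * \<alpha> s" by (rule fun_cong)
    then show "i = j" using s by simp
  qed
  ultimately show False
    using finite_weights finite_subset finite_imageD infinite_UNIV_nat by blast
qed

lemma bracket_opposite_in_h:
  assumes "x \<in> root_space h \<alpha>" "y \<in> root_space h (- \<alpha>)"
  shows "bracket x y \<in> h"
  using bracket_root_space[OF assms] by (simp add: root_space_0)

text \<open>The sl2 commutation relation, kept free of the normalisation \<alpha>(t) = 2: the
  degenerate case \<alpha>(t) = 0 is the one that decides
  \<open>bracket_opposite_zero\<close>.\<close>

lemma lowering:
  assumes x: "x \<in> root_space h \<alpha>" and y: "y \<in> root_space h (- \<alpha>)" and t: "t = bracket x y"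
    and v: "v \<in> root_space h \<mu>" "bracket x v = 0"
  shows "bracket x ((bracket y ^^ Suc k) v) =
    scale (of_nat (Suc k) * (\<mu> t - of_nat k * \<alpha> t / 2)) ((bracket y ^^ k) v)"
proof (induction k)
  case 0
  have "t \<in> h" using bracket_opposite_in_h[OF x y] t by simp
  then show ?case using v by (simp add: jacobi_left[of x y] t[symmetric] root_spaceD)
next
  case (Suc k)
  have th: "t \<in> h" using bracket_opposite_in_h[OF x y] t by simp
  let ?w = "(bracket y ^^ Suc k) v"
  have "bracket t ?w = scale (\<mu> t - of_nat (Suc k) * \<alpha> t) ?w"
    using root_spaceD[OF bracket_power_root_space[OF y v(1), of "Suc k"] th]
    by (simp del: funpow.simps of_nat_Suc)
  then have "bracket x (bracket y ?w) =
      scale (\<mu> t - of_nat (Suc k) * \<alpha> t) ?w +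
      scale (of_nat (Suc k) * (\<mu> t - of_nat k * \<alpha> t / 2)) ?w"
    unfolding jacobi_left[of x y ?w] t[symmetric] Suc by (simp add: bracket_scale_right)
  also have "\<dots> = scale (of_nat (Suc (Suc k)) * (\<mu> t - of_nat (Suc k) * \<alpha> t / 2)) ?w"
    unfolding scale_left_distrib[symmetric]
    by (rule arg_cong[where f = "\<lambda>c. scale c _"]) (simp add: field_simps)
  finally show ?case by simp
qed

text \<open>If the p-th power of y is the last one not killing v, then applying x once more after y
  must give 0, so the factor in \<open>lowering\<close> vanishes. For \<alpha>(t) = 0 the conclusion
  reads \<mu>(t) = 0.\<close>

lemma highest_weight:
  assumes x: "x \<in> root_space h \<alpha>" and y: "y \<in> root_space h (- \<alpha>)" and t: "t = bracket x y"
    and \<alpha>: "\<alpha> \<in> dual_space h" "\<alpha> \<noteq> 0"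
    and v: "v \<in> root_space h \<mu>" "bracket x v = 0" "\<mu> \<in> dual_space h" "v \<noteq> 0"
  shows "\<exists>m::nat. \<mu> t = of_nat m * \<alpha> t / 2 \<and> (\<forall>j\<le>m. (bracket y ^^ j) v \<noteq> 0)"
proof -
  have "- \<alpha> \<noteq> 0" using \<alpha>(2) by simp
  then obtain p where p: "(bracket y ^^ p) v \<noteq> 0" "bracket y ((bracket y ^^ p) v) = 0"
    using bracket_power_terminates[OF y dual_space_minus[OF \<alpha>(1)] _ v(1,3,4)] by blast
  have "scale (of_nat (Suc p) * (\<mu> t - of_nat p * \<alpha> t / 2)) ((bracket y ^^ p) v) = 0"
    using lowering[OF x y t v(1,2), of p] p(2) by simp
  then have "\<mu> t = of_nat p * \<alpha> t / 2"
    using p(1) by (simp del: of_nat_Suc)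
  moreover have "(bracket y ^^ j) v \<noteq> 0" if "j \<le> p" for j
  proof
    assume "(bracket y ^^ j) v = 0"
    moreover have "(bracket y ^^ i) 0 = 0" for i by (induction i) auto
    moreover have "(bracket y ^^ p) v = (bracket y ^^ (p - j)) ((bracket y ^^ j) v)"
      using that by (metis comp_apply funpow_add le_add_diff_inverse2)
    ultimately show False using p(1) by simp
  qed
  ultimately show ?thesis by blast
qed

text \<open>Such a t commutes with every weight vector, so its span is an ideal. It cannot be
  everything, as the algebra is not abelian.\<close>

lemma no_center:
  assumes t: "t \<in> h" "\<And>\<mu>. \<mu> \<in> weights \<Longrightarrow> \<mu> t = 0"
  shows "t = 0"
proof -
  have "bracket t v = 0" for v
  proof -
    obtain u where u: "\<And>\<mu>. \<mu> \<in> weights \<Longrightarrow> u \<mu> \<in> root_space h \<mu>" "v = (\<Sum>\<mu>\<in>weights. u \<mu>)"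
      using weight_decomposition[of v] by blast
    have "bracket t (u \<mu>) = 0" if "\<mu> \<in> weights" for \<mu>
      using root_spaceD[OF u(1)[OF that] t(1)] t(2)[OF that] by simp
    then show ?thesis unfolding u(2) bracket_sum_right by simp
  qed
  then have *: "bracket x t = 0" for x
    using bracket_anti[of x t] by simp
  have **: "bracket x y \<in> {0}" if "y \<in> span {t}" for x y
    by (rule bracket_span[of "{x}" "{t}"]) (use that * in \<open>auto intro: span_base\<close>)
  then have "ideal_of (span {t}) UNIV"
    by (auto simp: ideal_of_def span_zero)
  then have "span {t} = {0} \<or> span {t} = UNIV"
    by (rule ideals_trivial)
  moreover have "span {t} \<noteq> UNIV"
    using ** not_abelian by (auto simp: abelian_def)
  ultimately show ?thesis using span_base[of t "{t}"] by auto
qed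

text \<open>The substitute for nondegeneracy of the Killing form. At the top of the \<alpha>-string
  through any weight \<mu>, \<open>highest_weight\<close> gives the value 0 on the bracket, and
  \<alpha> itself contributes 0 there, so \<mu> vanishes on it as well.\<close>

lemma bracket_opposite_zero:
  assumes x: "x \<in> root_space h \<alpha>" and y: "y \<in> root_space h (- \<alpha>)"
    and \<alpha>: "\<alpha> \<in> dual_space h" "\<alpha> \<noteq> 0" and "\<alpha> (bracket x y) = 0"
  shows "bracket x y = 0"
proof (rule no_center)
  let ?t = "bracket x y"
  fix \<mu> assume \<mu>: "\<mu> \<in> weights"
  then obtain v where v: "v \<in> root_space h \<mu>" "v \<noteq> 0" by (rule weightsE)
  obtain p where p: "(bracket x ^^ p) v \<noteq> 0" "bracket x ((bracket x ^^ p) v) = 0"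
    using bracket_power_terminates[OF x \<alpha> v(1) weights_dual[OF \<mu>] v(2)] by blast
  have "(\<lambda>s. \<mu> s + of_nat p * \<alpha> s) \<in> dual_space h"
    using \<alpha>(1) \<mu> weights_dual by simp
  from highest_weight[OF x y refl \<alpha> bracket_power_root_space[OF x v(1)] p(2) this p(1)]
  show "\<mu> ?t = 0" using assms(5) by auto
qed (rule bracket_opposite_in_h[OF x y])

section \<open>sl2-triples and root strings\<close>

definition sl2 :: "('g \<Rightarrow> complex) \<Rightarrow> 'g \<Rightarrow> 'g \<Rightarrow> 'g \<Rightarrow> bool" where
  "sl2 \<alpha> x y t \<longleftrightarrow> \<alpha> \<in> dual_space h \<and> x \<in> root_space h \<alpha> \<and> y \<in> root_space h (- \<alpha>) \<and>
     t = bracket x y \<and> \<alpha> t = 2"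

lemma sl2D:
  assumes "sl2 \<alpha> x y t"
  shows "\<alpha> \<in> dual_space h" "x \<in> root_space h \<alpha>" "y \<in> root_space h (- \<alpha>)" "t = bracket x y"
    "\<alpha> t = 2" "t \<in> h" "\<alpha> \<noteq> 0" "x \<noteq> 0" "y \<noteq> 0"
proof -
  show *: "\<alpha> \<in> dual_space h" "x \<in> root_space h \<alpha>" "y \<in> root_space h (- \<alpha>)" "t = bracket x y"
    "\<alpha> t = 2" using assms by (auto simp: sl2_def)
  show "t \<in> h" using * bracket_opposite_in_h by simp
  show "\<alpha> \<noteq> 0" using * by auto
  have "\<alpha> 0 = 0" using dual_apply_scale[OF *(1), of 0 0] subspace_h by (simp add: subspace_0)
  then show "x \<noteq> 0" "y \<noteq> 0" using * by auto
qed

lemma sl2_weight: "sl2 \<alpha> x y t \<Longrightarrow> \<alpha> \<in> weights"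
  using weightsI[OF sl2D(2,8,1)] by blast

lemma sl2_swap: "sl2 \<alpha> x y t \<Longrightarrow> sl2 (- \<alpha>) y x (- t)"
  using dual_apply_minus[of \<alpha> t] sl2D(6)[of \<alpha> x y t] bracket_anti[of y x]
  by (auto simp: sl2_def)

lemma sl2_exists:
  assumes x: "x \<in> root_space h \<alpha>" and y: "y \<in> root_space h (- \<alpha>)" and \<alpha>: "\<alpha> \<in> dual_space h"
    and nz: "\<alpha> (bracket x y) \<noteq> 0"
  shows "\<exists>x t. sl2 \<alpha> x y t"
proof (intro exI)
  let ?c = "2 / \<alpha> (bracket x y)"
  show "sl2 \<alpha> (scale ?c x) y (bracket (scale ?c x) y)"
    using assms bracket_opposite_in_h[OF x y]
    by (simp add: sl2_def subspace_scale bracket_scale_left dual_apply_scale)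
qed

text \<open>The number p counts the steps up to the top of the string, and m is the value of the top
  weight on t; m steps down from the top still give nonzero vectors.\<close>

lemma root_string:
  assumes s: "sl2 \<alpha> x y t" and \<mu>: "\<mu> \<in> weights"
  shows "\<exists>p m::nat. \<mu> t + 2 * of_nat p = of_nat m \<and>
    (\<forall>j\<le>m. (\<lambda>s. \<mu> s + (of_nat p - of_nat j) * \<alpha> s) \<in> weights)"
proof -
  note \<alpha> = sl2D[OF s]
  obtain v where v: "v \<in> root_space h \<mu>" "v \<noteq> 0" using \<mu> by (rule weightsE)
  note \<mu>d = weights_dual[OF \<mu>]
  obtain p where p: "(bracket x ^^ p) v \<noteq> 0" "bracket x ((bracket x ^^ p) v) = 0"
    using bracket_power_terminates[OF \<alpha>(2,1,7) v(1) \<mu>d v(2)] by blast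
  let ?\<nu> = "\<lambda>s. \<mu> s + of_nat p * \<alpha> s"
  have w: "(bracket x ^^ p) v \<in> root_space h ?\<nu>"
    by (rule bracket_power_root_space[OF \<alpha>(2) v(1)])
  have \<nu>: "?\<nu> \<in> dual_space h" using \<alpha>(1) \<mu>d by simp
  obtain m where m: "?\<nu> t = of_nat m * \<alpha> t / 2"
      "\<forall>j\<le>m. (bracket y ^^ j) ((bracket x ^^ p) v) \<noteq> 0"
    using highest_weight[OF \<alpha>(2,3,4,1,7) w p(2) \<nu> p(1)] by blast
  have "(\<lambda>s. \<mu> s + (of_nat p - of_nat j) * \<alpha> s) \<in> weights" if "j \<le> m" for j
  proof -
    have eq: "(\<lambda>s. \<mu> s + of_nat p * \<alpha> s + of_nat j * (- \<alpha>) s)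
        = (\<lambda>s. \<mu> s + (of_nat p - of_nat j) * \<alpha> s)"
      by (simp add: algebra_simps)
    have "(bracket y ^^ j) ((bracket x ^^ p) v) \<in> root_space h (\<lambda>s. \<mu> s + (of_nat p - of_nat j) * \<alpha> s)"
      using bracket_power_root_space[OF \<alpha>(3) w, of j] unfolding eq .
    then show ?thesis using m(2) that \<alpha>(1) \<mu>d by (blast intro: weightsI dual_shift)
  qed
  then show ?thesis using m(1) \<alpha>(5)
    by (intro exI[of _ p] exI[of _ m]) (simp add: algebra_simps)
qed

lemma weight_integer:
  assumes "sl2 \<alpha> x y t" "\<mu> \<in> weights"
  obtains i :: int where "\<mu> t = of_int i"
proof -
  obtain p m :: nat where "\<mu> t + 2 * of_nat p = of_nat m"
    using root_string[OF assms] by blast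
  then have "\<mu> t = of_int (int m - 2 * int p)" by (simp add: algebra_simps)
  then show thesis by (rule that)
qed

text \<open>Since i + 2p = m, the member j steps below \<mu> is number p + j \<le> m from the
  top.\<close>

lemma string_interval_pos:
  assumes s: "sl2 \<alpha> x y t" and \<mu>: "\<mu> \<in> weights" "\<mu> t = of_nat i" and "j \<le> i"
  shows "(\<lambda>s. \<mu> s - of_nat j * \<alpha> s) \<in> weights"
proof -
  obtain p m :: nat where pm: "\<mu> t + 2 * of_nat p = of_nat m"
    "\<And>j. j \<le> m \<Longrightarrow> (\<lambda>s. \<mu> s + (of_nat p - of_nat j) * \<alpha> s) \<in> weights"
    using root_string[OF s \<mu>(1)] by blast
  have "(of_nat (i + 2 * p) :: complex) = of_nat m" using pm(1) \<mu>(2) by simp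
  then have "i + 2 * p = m" by (simp only: of_nat_eq_iff)
  then have "(\<lambda>s. \<mu> s + (of_nat p - of_nat (p + j)) * \<alpha> s) \<in> weights"
    using pm(2)[of "p + j"] \<open>j \<le> i\<close> by simp
  then show ?thesis by simp
qed

lemma string_interval_neg:
  assumes s: "sl2 \<alpha> x y t" and \<mu>: "\<mu> \<in> weights" "\<mu> t = - of_nat i" and "j \<le> i"
  shows "(\<lambda>s. \<mu> s + of_nat j * \<alpha> s) \<in> weights"
  using string_interval_pos[OF sl2_swap[OF s] \<mu>(1) _ \<open>j \<le> i\<close>] \<mu>
    dual_apply_minus[OF weights_dual[OF \<mu>(1)] sl2D(6)[OF s]] by simp

lemma weight_reflection:
  assumes s: "sl2 \<alpha> x y t" and \<mu>: "\<mu> \<in> weights"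
  shows "(\<lambda>s. \<mu> s - \<mu> t * \<alpha> s) \<in> weights"
proof -
  obtain i where i: "\<mu> t = of_int i" using weight_integer[OF s \<mu>] .
  show ?thesis
  proof (cases "i \<ge> 0")
    case True
    then show ?thesis
      using string_interval_pos[OF s \<mu>, of "nat i" "nat i"] i by simp
  next
    case False
    then have eq: "\<mu> t = - of_nat (nat (- i))" using i by simp
    from string_interval_neg[OF s \<mu> this order_refl]
    show ?thesis by (simp add: eq)
  qed
qed

lemma sl2_root_space:
  assumes s: "sl2 \<alpha> x y t"
  shows "root_space h \<alpha> = span {x}"
proof
  note \<alpha> = sl2D[OF s]
  show "span {x} \<subseteq> root_space h \<alpha>" using \<alpha> by (intro span_minimal) auto
  show "root_space h \<alpha> \<subseteq> span {x}"
  proof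
    fix z assume z: "z \<in> root_space h \<alpha>"
    \<comment> \<open>Chosen so that \<alpha> vanishes on the bracket of \<open>?z\<close> with y,
      which is then 0. A nonzero \<open>?z\<close> would be a highest weight vector for the swapped
      triple with weight -2, but highest weights are nonnegative.\<close>
    let ?c = "\<alpha> (bracket z y) / 2"
    let ?z = "z - scale ?c x"
    have z': "?z \<in> root_space h \<alpha>"
      using z \<alpha> by (simp add: subspace_diff subspace_scale)
    have "\<alpha> (bracket ?z y) = \<alpha> (bracket z y - scale ?c t)"
      by (simp add: bracket_diff_left bracket_scale_left \<alpha>(4))
    also have "\<dots> = \<alpha> (bracket z y) - ?c * \<alpha> t"
      using bracket_opposite_in_h[OF z \<alpha>(3)] \<alpha>(1,6) subspace_scale[OF subspace_h \<alpha>(6)]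
      by (simp add: dual_apply_diff dual_apply_scale)
    finally have "\<alpha> (bracket ?z y) = 0" using \<alpha>(5) by simp
    then have "bracket ?z y = 0"
      by (rule bracket_opposite_zero[OF z' \<alpha>(3,1,7)])
    then have yz: "bracket y ?z = 0" using bracket_anti[of y ?z] by simp
    have "?z = 0"
    proof (rule ccontr)
      assume "?z \<noteq> 0"
      note \<beta> = sl2D[OF sl2_swap[OF s]]
      obtain m :: nat where "\<alpha> (- t) = of_nat m * (- \<alpha>) (- t) / 2"
        using highest_weight[OF \<beta>(2,3,4,1,7) z' yz \<alpha>(1) \<open>?z \<noteq> 0\<close>] by blast
      then have "- 2 = (of_nat m :: complex)"
        using dual_apply_minus[OF \<alpha>(1,6)] \<alpha>(5) by simp
      then have "of_nat (m + 2) = (0 :: complex)" by simp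
      then show False unfolding of_nat_eq_0_iff by simp
    qed
    then show "z \<in> span {x}" by (metis eq_iff_diff_eq_0 insertI1 span_base span_scale)
  qed
qed

text \<open>From a vector of weight \<beta> + \<alpha> one climbs p steps to the top of its string
  and then descends p + 1 steps. This ends on the line of v, which x kills, whereas
  \<open>lowering\<close> gives the nonzero factor (p + 1)(m + 2 + p), where m is the value of
  \<beta> on t.\<close>

lemma bracket_zero_no_sum:
  assumes s: "sl2 \<alpha> x y t" and v: "v \<in> root_space h \<beta>" "v \<noteq> 0" "\<beta> \<in> dual_space h"
    and one: "root_space h \<beta> \<subseteq> span {v}" and xv: "bracket x v = 0"
  shows "root_space h (\<beta> + \<alpha>) = {0}"
proof (rule ccontr)
  note \<alpha> = sl2D[OF s]
  assume "root_space h (\<beta> + \<alpha>) \<noteq> {0}"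
  then obtain z where z: "z \<in> root_space h (\<beta> + \<alpha>)" "z \<noteq> 0"
    using zero_root_space by blast
  have d: "\<beta> + \<alpha> \<in> dual_space h" using v \<alpha> by simp
  obtain p where p: "(bracket x ^^ p) z \<noteq> 0" "bracket x ((bracket x ^^ p) z) = 0"
    using bracket_power_terminates[OF \<alpha>(2,1,7) z(1) d z(2)] by blast
  let ?w = "(bracket x ^^ p) z"
  let ?\<nu> = "\<lambda>s. (\<beta> + \<alpha>) s + of_nat p * \<alpha> s"
  have w: "?w \<in> root_space h ?\<nu>"
    by (rule bracket_power_root_space[OF \<alpha>(2) z(1)])
  have \<nu>: "?\<nu> \<in> dual_space h" using \<alpha>(1) d by (rule dual_shift[rotated])
  obtain M where M: "?\<nu> t = of_nat M * \<alpha> t / 2" "\<forall>j\<le>M. (bracket y ^^ j) ?w \<noteq> 0"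
    using highest_weight[OF \<alpha>(2,3,4,1,7) w p(2) \<nu> p(1)] by blast
  obtain m :: nat where m: "\<beta> t = of_nat m * \<alpha> t / 2"
    using highest_weight[OF \<alpha>(2,3,4,1,7) v(1) xv v(3,2)] by blast
  have "of_nat (m + 2 + 2 * p) = (of_nat M :: complex)"
  proof -
    have bt: "\<beta> t = of_nat m" using m \<alpha>(5) by simp
    have "?\<nu> t = \<beta> t + \<alpha> t + of_nat p * \<alpha> t" by simp
    also have "\<dots> = of_nat (m + 2 + 2 * p)" unfolding bt \<alpha>(5) by simp
    finally have "?\<nu> t = of_nat (m + 2 + 2 * p)" .
    moreover have "?\<nu> t = of_nat M" using M(1) unfolding \<alpha>(5) by simp
    ultimately show ?thesis by metis
  qed
  then have Mm: "M = m + 2 + 2 * p" by (simp only: of_nat_eq_iff)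
  have eq: "(\<lambda>s. (\<beta> + \<alpha>) s + of_nat p * \<alpha> s + of_nat (Suc p) * (- \<alpha>) s) = \<beta>"
    by (rule ext) (simp add: algebra_simps)
  have "(bracket y ^^ Suc p) ?w \<in> root_space h \<beta>"
    using bracket_power_root_space[OF \<alpha>(3) w, of "Suc p"] unfolding eq .
  then have *: "(bracket y ^^ Suc p) ?w \<in> span {v}" using one by blast
  have "bracket x ((bracket y ^^ Suc p) ?w) \<in> {0}"
    by (rule bracket_span[OF _ _ span_base *, of "{x}"]) (simp_all add: xv)
  then have "scale (of_nat (Suc p) * (?\<nu> t - of_nat p * \<alpha> t / 2)) ((bracket y ^^ p) ?w) = 0"
    using lowering[OF \<alpha>(2,3,4) w p(2), of p] by (metis singletonD)
  moreover have "?\<nu> t - of_nat p * \<alpha> t / 2 = of_nat (m + 2 + p)"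
    by (subst M(1)) (simp add: Mm \<alpha>(5))
  moreover have "(bracket y ^^ p) ?w \<noteq> 0" using M(2) Mm by simp
  ultimately have "of_nat (Suc p) * of_nat (m + 2 + p) = (0::complex)"
    by (simp del: of_nat_Suc of_nat_add)
  then have "of_nat (Suc p * (m + 2 + p)) = (0::complex)" by (simp only: of_nat_mult)
  then show False unfolding of_nat_eq_0_iff by simp
qed

text \<open>The bracket of x with itself is 0 and x spans its root space, so no weight lies one step
  above \<alpha>.\<close>

lemma double_not_weight:
  assumes s: "sl2 \<alpha> x y t" shows "\<alpha> + \<alpha> \<notin> weights"
  using bracket_zero_no_sum[OF s sl2D(2,8,1)[OF s]] sl2_root_space[OF s]
  by (simp add: bracket_self weights_def)

lemma sl2_brackets:
  assumes s: "sl2 \<alpha> x y t"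
  shows "brackets (root_space h \<alpha>) (root_space h (- \<alpha>)) = span {t}"
proof
  note \<alpha> = sl2D[OF s]
  show "span {t} \<subseteq> brackets (root_space h \<alpha>) (root_space h (- \<alpha>))"
    unfolding brackets_def \<alpha>(4) using \<alpha>(2,3) by (intro span_mono) auto
  have "bracket a b \<in> span {t}" if "a \<in> span {x}" "b \<in> span {y}" for a b
    by (rule bracket_span[OF _ _ that]) (use \<alpha>(4) in \<open>auto intro: span_base\<close>)
  then show "brackets (root_space h \<alpha>) (root_space h (- \<alpha>)) \<subseteq> span {t}"
    unfolding brackets_def sl2_root_space[OF s] sl2_root_space[OF sl2_swap[OF s]]
    by (intro span_minimal) auto
qed

text \<open>The brackets of the two opposite root spaces span only the line through t, so the
  definite description has a unique solution.\<close>

lemma coroot_sl2: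
  assumes s: "sl2 \<alpha> x y t"
  shows "coroot h \<alpha> = t"
  unfolding coroot_def sl2_brackets[OF s]
proof (rule the_equality)
  note \<alpha> = sl2D[OF s]
  show "t \<in> span {t} \<and> \<alpha> t = 2" using \<alpha>(5) by (simp add: span_base)
  fix u assume u: "u \<in> span {t} \<and> \<alpha> u = 2"
  then obtain c where "u = scale c t" by (auto simp: span_singleton)
  with u \<alpha> show "u = t" by (simp add: dual_apply_scale)
qed

text \<open>The composition of the two reflections is the transvection
  \<open>\<mu> \<mapsto> \<mu> + r \<mu>(t) \<delta>\<close> with \<open>\<delta> = \<gamma> - \<beta> / r\<close>; it maps the finite set of weights
  to itself, so \<open>\<delta> = 0\<close>.\<close>

lemma proportional_coroots:
  assumes s: "sl2 \<beta> x y t" and s': "sl2 \<gamma> x' y' t'" and t': "t' = scale r t"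
  shows "\<gamma> = \<beta> \<or> \<gamma> = - \<beta>"
proof -
  note \<beta> = sl2D[OF s] and \<gamma> = sl2D[OF s']
  have r: "r \<noteq> 0" using \<gamma> t' dual_apply_scale[OF \<gamma>(1) \<beta>(6), of r] by auto
  have gt: "\<gamma> t = 2 / r"
    using \<gamma>(5) r unfolding t' dual_apply_scale[OF \<gamma>(1) \<beta>(6)] by (simp add: field_simps)
  define \<delta> where "\<delta> s = \<gamma> s - \<beta> s / r" for s
  have \<delta>t: "\<delta> t = 0" by (simp add: \<delta>_def gt \<beta>(5))
  \<comment> \<open>The orbit of \<beta> under the transvection. Since \<delta>(t) = 0, all its
    members take the value 2 on t, so each application adds the same vector 2r\<delta>.\<close>
  let ?f = "\<lambda>k::nat. (\<lambda>s. \<beta> s + of_nat k * (2 * r * \<delta> s))"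
  have f: "?f k \<in> weights" for k
  proof (induction k)
    case 0
    then show ?case using sl2_weight[OF s] by simp
  next
    case (Suc k)
    define \<mu> where "\<mu> = ?f k"
    define \<nu> where "\<nu> = (\<lambda>s. \<mu> s - \<mu> t * \<beta> s)"
    have mt: "\<mu> t = 2" by (simp add: \<mu>_def \<delta>t \<beta>(5))
    have \<nu>: "\<nu> \<in> weights" unfolding \<nu>_def by (rule weight_reflection[OF s]) (simp add: \<mu>_def Suc)
    have nt: "\<nu> t' = - 2 * r"
      unfolding t' dual_apply_scale[OF weights_dual[OF \<nu>] \<beta>(6)] by (simp add: \<nu>_def mt \<beta>(5))
    have "(\<lambda>s. \<nu> s - \<nu> t' * \<gamma> s) \<in> weights"
      by (rule weight_reflection[OF s' \<nu>])
    also have "(\<lambda>s. \<nu> s - \<nu> t' * \<gamma> s) = ?f (Suc k)"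
      unfolding nt unfolding \<nu>_def mt unfolding \<mu>_def \<delta>_def
      by (rule ext) (use r in \<open>simp add: field_simps\<close>)
    finally show ?case .
  qed
  have "\<delta> s = 0" for s
  proof (rule ccontr)
    assume s: "\<delta> s \<noteq> 0"
    have "inj ?f"
    proof (rule injI)
      fix i j assume "?f i = ?f j"
      then have "\<beta> s + of_nat i * (2 * r * \<delta> s) = \<beta> s + of_nat j * (2 * r * \<delta> s)" by (rule fun_cong)
      then show "i = j" using s r by simp
    qed
    moreover have "range ?f \<subseteq> weights" using f by blast
    ultimately show False
      using finite_weights finite_subset finite_imageD infinite_UNIV_nat by blast
  qed
  then have g: "\<gamma> s = \<beta> s / r" for s by (simp add: \<delta>_def)
  obtain i where i: "\<gamma> t = of_int i" using weight_integer[OF s sl2_weight[OF s']] .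
  obtain j where j: "\<beta> t' = of_int j" using weight_integer[OF s' sl2_weight[OF s]] .
  have j': "2 * r = of_int j" using j unfolding t' dual_apply_scale[OF \<beta>(1,6)] \<beta>(5) by (simp add: mult.commute)
  \<comment> \<open>The two pairings are i = 2/r and j = 2r, so j divides 4. For r = 1/2 or r = 2,
    up to sign, one of the two roots would be twice the other up to sign.\<close>
  have "of_int (i * j) = (of_int 4 :: complex)"
    using r unfolding of_int_mult j'[symmetric] i[symmetric] gt by simp
  then have "i * j = 4" by (simp only: of_int_eq_iff)
  then have "j dvd 4" by (metis dvd_triv_right)
  then have "\<bar>j\<bar> \<le> 4" using dvd_imp_le_int[of 4 j] by simp
  then have "j \<in> {-4,-3,-2,-1,0,1,2,3,4}" by auto
  then have j_cases: "j = 1 \<or> j = -1 \<or> j = 2 \<or> j = -2 \<or> j = 4 \<or> j = -4"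
    using \<open>j dvd 4\<close> by auto
  have rj: "r = of_int j / 2" using j' by (simp add: field_simps)
  have no: "\<mu> \<in> weights \<Longrightarrow> (\<And>s. \<mu> s = 2 * \<nu> s) \<Longrightarrow> sl2 \<nu> a b c \<Longrightarrow> False" for \<mu> \<nu> a b c
  proof -
    assume "\<mu> \<in> weights" "\<And>s. \<mu> s = 2 * \<nu> s" "sl2 \<nu> a b c"
    moreover from this have "\<mu> = \<nu> + \<nu>" by (intro ext) simp
    ultimately show False using double_not_weight by blast
  qed
  from j_cases show ?thesis
  proof (elim disjE)
    assume "j = 1"
    then have "\<gamma> s = 2 * \<beta> s" for s by (simp add: g rj)
    then show ?thesis using no[OF sl2_weight[OF s'] _ s] by blast
  next
    assume "j = - 1"
    then have "\<gamma> s = 2 * (- \<beta>) s" for s by (simp add: g rj)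
    then show ?thesis using no[OF sl2_weight[OF s'] _ sl2_swap[OF s]] by blast
  next
    assume "j = 2"
    then show ?thesis by (intro disjI1 ext) (simp add: g rj)
  next
    assume "j = - 2"
    then show ?thesis by (intro disjI2 ext) (simp add: g rj)
  next
    assume "j = 4"
    then have "\<beta> s = 2 * \<gamma> s" for s by (simp add: g rj)
    then show ?thesis using no[OF sl2_weight[OF s] _ s'] by blast
  next
    assume "j = - 4"
    then have "\<beta> s = 2 * (- \<gamma>) s" for s by (simp add: g rj)
    then show ?thesis using no[OF sl2_weight[OF s] _ sl2_swap[OF s']] by blast
  qed
qed

lemma h_nontrivial: "h \<noteq> {0}"
proof
  assume h: "h = {0}"
  have "\<mu> = 0" if "\<mu> \<in> weights" for \<mu>
    using dual_space_ext[OF weights_dual[OF that] dual_space_0] dual_apply_scale[OF weights_dual[OF that], of 0 0]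
    by (auto simp: h)
  then have "(\<Union>\<mu>\<in>weights. root_space h \<mu>) \<subseteq> {0}"
    using root_space_0 h by blast
  then have "span (\<Union>\<mu>\<in>weights. root_space h \<mu>) \<subseteq> {0}"
    by (rule span_minimal) simp
  then have "x = 0" for x :: 'g using span_weight_spaces by auto
  then show False using not_abelian by (metis abelian_def)
qed

text \<open>The root spaces of the roots without such a triple span an ideal: if \<open>\<alpha>\<close> is bad
  and \<open>\<gamma> = \<mu> + \<alpha>\<close> is good, the Jacobi identity puts the coroot of \<open>\<gamma>\<close> into
  \<open>[\<g>\<^sub>\<mu>, \<g>\<^sub>-\<^sub>\<mu>]\<close>, so \<open>\<mu>\<close> is good with a proportional coroot.\<close>

theorem root_sl2:
  assumes "\<alpha> \<in> roots h" shows "\<exists>x y t. sl2 \<alpha> x y t"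
proof -
  define Bad where "Bad = {\<alpha> \<in> roots h. \<nexists>x y t. sl2 \<alpha> x y t}"
  have Bad_w: "Bad \<subseteq> weights" by (auto simp: Bad_def roots_eq)
  have Bad0: "bracket a b = 0" if "\<alpha> \<in> Bad" "a \<in> root_space h \<alpha>" "b \<in> root_space h (- \<alpha>)" for \<alpha> a b
  proof (rule ccontr)
    assume nz: "bracket a b \<noteq> 0"
    have \<alpha>: "\<alpha> \<in> dual_space h" "\<alpha> \<noteq> 0" using that(1) by (auto simp: Bad_def roots_def)
    then have "\<alpha> (bracket a b) \<noteq> 0" using bracket_opposite_zero[OF that(2,3)] nz by blast
    then show False using sl2_exists[OF that(2,3) \<alpha>(1)] that(1) by (auto simp: Bad_def)
  qed
  let ?N = "span (\<Union>\<alpha>\<in>Bad. root_space h \<alpha>)"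
  have step: "bracket u v \<in> ?N"
    if \<mu>: "\<mu> \<in> weights" "u \<in> root_space h \<mu>" and \<alpha>: "\<alpha> \<in> Bad" "v \<in> root_space h \<alpha>" for \<mu> u \<alpha> v
  proof (cases "bracket u v = 0")
    case False
    have \<alpha>r: "\<alpha> \<in> weights" "\<alpha> \<noteq> 0" using \<alpha> by (auto simp: Bad_def roots_eq)
    show ?thesis
    proof (cases "\<mu> = 0")
      case True
      then have "u \<in> h" using \<mu> root_space_0 by simp
      then have "bracket u v \<in> root_space h \<alpha>"
        using \<alpha> by (simp add: root_spaceD subspace_scale)
      then show ?thesis using \<alpha> by (blast intro: span_base)
    next
      case \<mu>0: False
      let ?\<gamma> = "\<mu> + \<alpha>"
      have uv: "bracket u v \<in> root_space h ?\<gamma>"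
        using \<mu> \<alpha> by (simp add: bracket_root_space)
      have \<gamma>w: "?\<gamma> \<in> weights"
        using weightsI[OF uv False] \<mu>(1) \<alpha>r weights_dual by simp
      have \<gamma>0: "?\<gamma> \<noteq> 0"
      proof
        assume "?\<gamma> = 0"
        then have "\<mu> = - \<alpha>" by (simp add: eq_neg_iff_add_eq_0)
        then have "bracket v u = 0" using Bad0 \<alpha> \<mu> by simp
        then show False using False bracket_anti[of u v] by simp
      qed
      show ?thesis
      proof (cases "?\<gamma> \<in> Bad")
        case True
        then show ?thesis using uv by (blast intro: span_base)
      next
        case good: False
        obtain x y t where s: "sl2 ?\<gamma> x y t"
          using good \<gamma>w \<gamma>0 by (auto simp: Bad_def roots_eq)
        note \<gamma> = sl2D[OF s]
        obtain c where c: "bracket u v = scale c x"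
          using uv sl2_root_space[OF s] by (auto simp: span_singleton)
        have "c \<noteq> 0" using c False by auto
        have uy: "bracket u y \<in> root_space h (- \<alpha>)"
          using bracket_root_space[OF \<mu>(2) \<gamma>(3)] by simp
        have vy: "bracket v y \<in> root_space h (- \<mu>)"
          using bracket_root_space[OF \<alpha>(2) \<gamma>(3)] by (simp add: add.commute)
        have "scale c t = bracket (bracket u v) y"
          by (simp add: c bracket_scale_left \<gamma>(4))
        also have "\<dots> = bracket u (bracket v y) - bracket v (bracket u y)"
          using jacobi_left[of u v y] by simp
        also have "bracket v (bracket u y) = 0"
          using Bad0 \<alpha> uy by blast
        finally have ct: "scale c t = bracket u (bracket v y)" by simp
        have tnz: "t \<noteq> 0" using \<gamma>(1,5) dual_apply_scale[OF \<gamma>(1), of 0 0] subspace_0[OF subspace_h] by auto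
        have "\<mu> (bracket u (bracket v y)) \<noteq> 0"
          using bracket_opposite_zero[OF \<mu>(2) vy weights_dual[OF \<mu>(1)] \<mu>0] ct tnz \<open>c \<noteq> 0\<close> by auto
        then obtain x' t' where s': "sl2 \<mu> x' (bracket v y) t'"
          using sl2_exists[OF \<mu>(2) vy weights_dual[OF \<mu>(1)]] by blast
        have "scale c t \<in> brackets (root_space h \<mu>) (root_space h (- \<mu>))"
          unfolding ct brackets_def using \<mu>(2) vy by (blast intro: span_base)
        then obtain d where d: "scale c t = scale d t'"
          unfolding sl2_brackets[OF s'] by (auto simp: span_singleton)
        have "t = scale (d / c) t'"
          using arg_cong[OF d, of "scale (1 / c)"] \<open>c \<noteq> 0\<close> by simp
        \<comment> \<open>The first alternative makes \<alpha> zero, the second makes it twice the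
          negative of \<mu>; neither is a root.\<close>
        from proportional_coroots[OF s' s this] have "\<mu> + \<alpha> = \<mu> \<or> \<mu> + \<alpha> = - \<mu>" .
        then show ?thesis
        proof
          assume "\<mu> + \<alpha> = - \<mu>"
          then have "\<alpha> = - \<mu> + - \<mu>" by (simp add: algebra_simps eq_neg_iff_add_eq_0)
          then show ?thesis using double_not_weight[OF sl2_swap[OF s']] \<alpha>r(1) by simp
        qed (use \<alpha>r in simp)
      qed
    qed
  qed (simp add: span_zero)
  have "bracket x v \<in> ?N" if "v \<in> ?N" for x v
    by (rule bracket_span[OF _ subspace_span _ that, of "\<Union>\<mu>\<in>weights. root_space h \<mu>"])
      (use step span_weight_spaces in auto)
  then have "ideal_of ?N UNIV" by (auto simp: ideal_of_def)
  then have "?N = {0} \<or> ?N = UNIV" by (rule ideals_trivial)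
  \<comment> \<open>Since 0 is not in \<open>Bad\<close>, the nonzero space h of weight 0 meets
    \<open>?N\<close> only in 0.\<close>
  moreover have "?N \<noteq> UNIV"
  proof
    assume N: "?N = UNIV"
    have "v = 0" if "v \<in> h" for v
    proof -
      have "v = 0 \<or> (0 \<in> Bad \<and> v \<in> root_space h 0)"
        by (rule component_in_span[where V = "root_space h"]) (use Bad_w N that root_space_0 in auto)
      then show ?thesis by (auto simp: Bad_def roots_eq)
    qed
    then show False using h_nontrivial subspace_0[OF subspace_h] by blast
  qed
  ultimately have N: "?N = {0}" by blast
  show ?thesis
  proof (rule ccontr)
    assume "\<not> ?thesis"
    then have "\<alpha> \<in> Bad" using assms by (simp add: Bad_def)
    moreover from this obtain v where "v \<in> root_space h \<alpha>" "v \<noteq> 0"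
      using Bad_w weightsE by blast
    ultimately have "v \<in> ?N" by (blast intro: span_base)
    then show False using N \<open>v \<noteq> 0\<close> by simp
  qed
qed

text \<open>The contrapositive of \<open>bracket_zero_no_sum\<close>, now that all root spaces are
  known to be lines. It is what turns sums of roots into nonzero brackets, for the Borel subalgebra
  and for its ideals.\<close>

lemma root_sum_bracket:
  assumes s: "sl2 \<alpha> x y t" and \<beta>: "\<beta> \<in> roots h" and sum: "\<beta> + \<alpha> \<in> weights"
    and v: "v \<in> root_space h \<beta>" "v \<noteq> 0"
  shows "bracket x v \<noteq> 0"
proof
  assume xv: "bracket x v = 0"
  obtain x' y' t' where s': "sl2 \<beta> x' y' t'" using root_sl2[OF \<beta>] by blast
  obtain c where c: "v = scale c x'"
    using v(1) sl2_root_space[OF s'] by (auto simp: span_singleton)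
  have "x' = scale (1 / c) v" using c v(2) by auto
  then have "root_space h \<beta> \<subseteq> span {v}"
    unfolding sl2_root_space[OF s'] by (intro span_minimal) (auto intro: span_scale span_base)
  from bracket_zero_no_sum[OF s v sl2D(1)[OF s'] this xv] sum show False
    by (simp add: weights_def)
qed

end

section \<open>Borel subalgebras and their ideals\<close>

text \<open>Stated with a single added root, not with the order generated by sums, because one
  bracket with a root vector adds exactly one root.\<close>

definition upper_subset :: "'a::plus set \<Rightarrow> 'a set \<Rightarrow> bool" where
  "upper_subset P U \<longleftrightarrow> U \<subseteq> P \<and> (\<forall>\<alpha>\<in>U. \<forall>\<beta>\<in>P. \<alpha> + \<beta> \<in> P \<longrightarrow> \<alpha> + \<beta> \<in> U)"

text \<open>Lists allow repetitions. This combinatorial condition stands in for a linear functional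
  that is positive on P.\<close>

definition zero_sum_free :: "'a::monoid_add set \<Rightarrow> bool" where
  "zero_sum_free P \<longleftrightarrow> (\<forall>xs. set xs \<subseteq> P \<and> xs \<noteq> [] \<longrightarrow> sum_list xs \<noteq> 0)"

definition cone :: "'a::monoid_add set \<Rightarrow> 'a set" where
  "cone S = {sum_list xs | xs. set xs \<subseteq> S \<and> xs \<noteq> []}"

text \<open>The number of elements of P strictly below \<alpha> in the order generated by P: a
  height function that does not refer to simple roots.\<close>

definition depth :: "'a::monoid_add set \<Rightarrow> 'a \<Rightarrow> nat" where
  "depth P \<alpha> = card {\<beta> \<in> P. \<alpha> \<in> (+) \<beta> ` cone P}"

lemma cone_base: "x \<in> S \<Longrightarrow> x \<in> cone S"
  unfolding cone_def by (auto intro!: exI[of _ "[x]"])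

lemma cone_add: "x \<in> cone S \<Longrightarrow> y \<in> cone S \<Longrightarrow> x + y \<in> cone S"
  unfolding cone_def
  by (auto simp flip: sum_list_append) (metis Un_subset_iff append_is_Nil_conv set_append)

lemma sum_list_in_cone: "set ys \<subseteq> cone S \<Longrightarrow> ys \<noteq> [] \<Longrightarrow> sum_list ys \<in> cone S"
proof (induction ys)
  case (Cons y ys)
  then show ?case by (cases "ys = []") (auto intro: cone_add)
qed simp

lemma zero_sum_free_iff: "zero_sum_free S \<longleftrightarrow> 0 \<notin> cone S"
  unfolding zero_sum_free_def cone_def by (auto dest: sym)

lemma zero_sum_free_cone: "zero_sum_free S \<Longrightarrow> P \<subseteq> cone S \<Longrightarrow> zero_sum_free P"
  unfolding zero_sum_free_def[of P] zero_sum_free_iff[of S] using sum_list_in_cone[of _ S] by fastforce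

text \<open>Everything counted for \<alpha> is counted for \<alpha> + \<beta>, and \<alpha> itself
  is new: it would lie below itself only through a vanishing sum.\<close>

lemma depth_add:
  fixes P :: "'a::ab_group_add set"
  assumes "finite P" "zero_sum_free P" "\<alpha> \<in> P" "\<beta> \<in> P"
  shows "depth P \<alpha> < depth P (\<alpha> + \<beta>)"
  unfolding depth_def
proof (rule psubset_card_mono)
  let ?S = "\<lambda>\<alpha>. {\<beta> \<in> P. \<alpha> \<in> (+) \<beta> ` cone P}"
  have "\<gamma> + s + \<beta> \<in> (+) \<gamma> ` cone P" if "s \<in> cone P" for \<gamma> s
    unfolding add.assoc using that assms(4) by (intro imageI cone_add) (auto intro: cone_base)
  then have "?S \<alpha> \<subseteq> ?S (\<alpha> + \<beta>)" by auto
  moreover have "\<alpha> \<in> ?S (\<alpha> + \<beta>)"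
    using assms by (auto intro: cone_base)
  moreover have "\<alpha> \<notin> ?S \<alpha>"
    using assms by (auto simp: zero_sum_free_iff)
  ultimately show "?S \<alpha> \<subset> ?S (\<alpha> + \<beta>)" by blast
qed (use assms in simp)

lemma depth_less_card:
  fixes P :: "'a::ab_group_add set"
  assumes "finite P" "zero_sum_free P" "\<alpha> \<in> P"
  shows "depth P \<alpha> < card P"
  unfolding depth_def
proof (rule psubset_card_mono)
  have "\<alpha> \<notin> {\<beta> \<in> P. \<alpha> \<in> (+) \<beta> ` cone P}"
    using assms by (auto simp: zero_sum_free_iff)
  then show "{\<beta> \<in> P. \<alpha> \<in> (+) \<beta> ` cone P} \<subset> P" using assms(3) by blast
qed (rule assms)

lemma sum_list_concat_replicate_apply:
  "(sum_list (concat (replicate l ys))) s = of_nat l * (sum_list ys) s"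
  for ys :: "('x \<Rightarrow> complex) list"
  by (induction l) (auto simp: algebra_simps)

lemma split_insert_sum:
  fixes \<alpha> :: "'x \<Rightarrow> complex"
  assumes "set xs \<subseteq> insert \<alpha> P"
  shows "\<exists>k ys. set ys \<subseteq> P \<and> (\<forall>s. (sum_list xs) s = of_nat k * \<alpha> s + (sum_list ys) s) \<and>
    (xs \<noteq> [] \<longrightarrow> k > 0 \<or> ys \<noteq> [])"
  using assms
proof (induction xs)
  case Nil
  show ?case by (rule exI[of _ 0], rule exI[of _ "[]"]) simp
next
  case (Cons x xs)
  then obtain k ys where IH: "set ys \<subseteq> P" "\<And>s. (sum_list xs) s = of_nat k * \<alpha> s + (sum_list ys) s" by auto
  show ?case
  proof (cases "x = \<alpha>")
    case True
    then show ?thesis using IH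
      by (intro exI[of _ "Suc k"] exI[of _ ys]) (auto simp: algebra_simps)
  next
    case False
    then show ?thesis using IH Cons.prems
      by (intro exI[of _ k] exI[of _ "x # ys"]) (auto simp: algebra_simps)
  qed
qed

text \<open>If both extensions fail, there are vanishing sums containing \<alpha> k times and
  -\<alpha> l times. Taking the first l times and the second k times cancels \<alpha> and leaves a
  vanishing sum inside P.\<close>

lemma zero_sum_free_extend:
  fixes \<alpha> :: "'x \<Rightarrow> complex"
  assumes P: "zero_sum_free P" and \<alpha>: "\<alpha> \<noteq> 0"
  shows "zero_sum_free (insert \<alpha> P) \<or> zero_sum_free (insert (- \<alpha>) P)"
proof (rule ccontr)
  assume contra: "\<not> ?thesis"
  have *: "\<exists>k ys. set ys \<subseteq> P \<and> k > 0 \<and> (\<forall>s. of_nat k * \<beta> s + (sum_list ys) s = 0)"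
    if not: "\<not> zero_sum_free (insert \<beta> P)" for \<beta> :: "'x \<Rightarrow> complex"
  proof -
    obtain xs where xs: "set xs \<subseteq> insert \<beta> P" "xs \<noteq> []" "sum_list xs = 0"
      using not unfolding zero_sum_free_def by blast
    obtain k ys where k: "set ys \<subseteq> P" "\<forall>s. (sum_list xs) s = of_nat k * \<beta> s + (sum_list ys) s"
        "k > 0 \<or> ys \<noteq> []"
      using split_insert_sum[OF xs(1)] xs(2) by blast
    have "k > 0"
    proof (rule ccontr)
      assume k0: "\<not> k > 0"
      then have "sum_list ys = 0" using k(2) xs(3) by (intro ext) auto
      then show False using P k k0 unfolding zero_sum_free_def by blast
    qed
    then show ?thesis using k xs(3) by (intro exI[of _ k] exI[of _ ys]) auto
  qed
  obtain k ys where k: "set ys \<subseteq> P" "k > 0" "\<And>s. of_nat k * \<alpha> s + (sum_list ys) s = 0"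
    using * contra by blast
  obtain l zs where l: "set zs \<subseteq> P" "l > 0" "\<And>s. of_nat l * (- \<alpha>) s + (sum_list zs) s = 0"
    using * contra by blast
  let ?ws = "concat (replicate l ys) @ concat (replicate k zs)"
  have "(sum_list ?ws) s = 0" for s
  proof -
    have "(sum_list ys) s = - of_nat k * \<alpha> s" "(sum_list zs) s = of_nat l * \<alpha> s"
      using k(3)[of s] l(3)[of s] by (simp_all add: add_eq_0_iff2 add_eq_0_iff)
    then show ?thesis by (simp add: sum_list_concat_replicate_apply)
  qed
  then have "sum_list ?ws = 0" by (intro ext) simp
  moreover have "set ?ws \<subseteq> P" using k l by auto
  moreover obtain s where "\<alpha> s \<noteq> 0" using \<alpha> by (auto simp: fun_eq_iff)
  with k(2) k(3)[of s] have "ys \<noteq> []" by auto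
  then have "?ws \<noteq> []" using l(2) by auto
  ultimately show False using P unfolding zero_sum_free_def by blast
qed

section \<open>The subalgebra attached to a closed set of roots\<close>

context cartan_setup
begin

definition closed_roots :: "('g \<Rightarrow> complex) set \<Rightarrow> bool" where
  "closed_roots P \<longleftrightarrow> P \<subseteq> roots h \<and> (\<forall>\<alpha>\<in>P. \<forall>\<beta>\<in>P. \<alpha> + \<beta> \<in> roots h \<longrightarrow> \<alpha> + \<beta> \<in> P)"

text \<open>The filtration by \<open>depth\<close>. It bounds the derived series of
  \<open>borel_of P\<close> and the lower central series of its nilpotent part at the same
  time.\<close>

definition level :: "('g \<Rightarrow> complex) set \<Rightarrow> nat \<Rightarrow> 'g set" where
  "level P k = span (\<Union>\<alpha>\<in>{\<alpha> \<in> P. k \<le> depth P \<alpha>}. root_space h \<alpha>)"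

definition borel_of :: "('g \<Rightarrow> complex) set \<Rightarrow> 'g set" where
  "borel_of P = span (h \<union> (\<Union>\<alpha>\<in>P. root_space h \<alpha>))"

lemma root_line:
  assumes "\<alpha> \<in> roots h" "v \<in> root_space h \<alpha>" "v \<noteq> 0" "v \<in> W" "subspace W"
  shows "root_space h \<alpha> \<subseteq> W"
proof -
  obtain x y t where s: "sl2 \<alpha> x y t" using root_sl2[OF assms(1)] by blast
  then obtain c where c: "v = scale c x"
    using assms(2) sl2_root_space[OF s] by (auto simp: span_singleton)
  then have "x = scale (1 / c) v" using assms(3) by auto
  then have "x \<in> W" using assms by (simp add: subspace_scale)
  then show ?thesis unfolding sl2_root_space[OF s] using assms(5) by (intro span_minimal) auto
qed

lemma root_dual: "\<alpha> \<in> roots h \<Longrightarrow> \<alpha> \<in> dual_space h"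
  by (simp add: roots_def)

lemma minus_root: "\<alpha> \<in> roots h \<Longrightarrow> - \<alpha> \<in> roots h"
  using root_sl2[of \<alpha>] sl2_swap sl2_weight by (fastforce simp: roots_eq)

lemma root_vector:
  assumes "\<alpha> \<in> roots h" obtains v where "v \<in> root_space h \<alpha>" "v \<noteq> 0"
  using assms weightsE[of \<alpha>] by (auto simp: roots_eq)

text \<open>In a vanishing sum that starts with \<open>\<alpha>\<close>, some term pairs negatively with the coroot of
  \<open>\<alpha>\<close>; its sum with \<open>\<alpha>\<close> is again in \<open>P\<close>, which shortens the sum.\<close>

lemma closed_antisymmetric_zero_sum_free:
  assumes cl: "closed_roots P" and anti: "\<And>\<alpha>. \<alpha> \<in> P \<Longrightarrow> - \<alpha> \<notin> P"
  shows "zero_sum_free P"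
proof -
  have "sum_list xs \<noteq> 0" if "set xs \<subseteq> P" "xs \<noteq> []" for xs
    using that
  proof (induction "length xs" arbitrary: xs rule: less_induct)
    case less
    then obtain \<alpha> ys where xs: "xs = \<alpha> # ys" by (cases xs) auto
    have \<alpha>P: "\<alpha> \<in> P" "\<alpha> \<in> roots h" using less xs cl by (auto simp: closed_roots_def)
    obtain x y t where s: "sl2 \<alpha> x y t" using root_sl2[OF \<alpha>P(2)] by blast
    show ?case
    proof
      assume "sum_list xs = 0"
      then have "\<alpha> t + (sum_list ys) t = 0" using xs by (metis plus_fun_apply sum_list.Cons zero_fun_apply)
      then have "Re ((sum_list ys) t) < 0"
        using sl2D(5)[OF s] by (simp add: add_eq_0_iff)
      moreover have "Re ((sum_list zs) t) \<ge> 0" if "\<forall>\<beta>\<in>set zs. Re (\<beta> t) \<ge> 0" for zs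
        using that by (induction zs) auto
      ultimately obtain \<beta> where \<beta>: "\<beta> \<in> set ys" "Re (\<beta> t) < 0" by force
      have \<beta>P: "\<beta> \<in> P" "\<beta> \<in> roots h" using \<beta> less.prems xs cl by (auto simp: closed_roots_def)
      have \<beta>w: "\<beta> \<in> weights" using \<beta>P by (simp add: roots_eq)
      obtain i where i: "\<beta> t = of_int i" using weight_integer[OF s \<beta>w] .
      then have "i < 0" using \<beta>(2) by simp
      then have "\<beta> t = - of_nat (nat (- i))" "1 \<le> nat (- i)" using i by auto
      from string_interval_neg[OF s \<beta>w this]
      have "(\<lambda>s. \<beta> s + of_nat 1 * \<alpha> s) \<in> weights" .
      moreover have "(\<lambda>s. \<beta> s + of_nat 1 * \<alpha> s) = \<alpha> + \<beta>" by (rule ext) simp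
      ultimately have "\<alpha> + \<beta> \<in> weights" by simp
      moreover have "\<alpha> + \<beta> \<noteq> 0" using anti \<alpha>P \<beta>P by (metis add_eq_0_iff)
      ultimately have sumP: "\<alpha> + \<beta> \<in> P"
        using cl \<alpha>P \<beta>P by (auto simp: closed_roots_def roots_eq)
      let ?zs = "(\<alpha> + \<beta>) # remove1 \<beta> ys"
      have "sum_list ?zs = sum_list xs"
        using sum_list_map_remove1[OF \<beta>(1), of "\<lambda>x. x"] xs by (simp add: add.assoc)
      moreover have "sum_list ?zs \<noteq> 0"
      proof (rule less.hyps)
        show "length ?zs < length xs"
          using \<beta>(1) xs length_pos_if_in_set[OF \<beta>(1)] by (simp add: length_remove1)
        show "set ?zs \<subseteq> P"
          using sumP less.prems(1) xs set_remove1_subset[of \<beta> ys] by auto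
      qed simp
      ultimately show False using \<open>sum_list xs = 0\<close> by simp
    qed
  qed
  then show ?thesis by (auto simp: zero_sum_free_def)
qed

lemma closed_roots_cone:
  "closed_roots (roots h \<inter> cone S)"
  unfolding closed_roots_def by (auto intro: cone_add)

lemma subspace_level [simp]: "subspace (level P k)"
  by (simp add: level_def)

lemma subspace_borel_of [simp]: "subspace (borel_of P)"
  by (simp add: borel_of_def)

context
  fixes P
  assumes cl: "closed_roots P" and zsf: "zero_sum_free P"
begin

lemma P_roots: "P \<subseteq> roots h" using cl by (simp add: closed_roots_def)

lemma finite_P: "finite P" using P_roots finite_roots finite_subset by blast

lemma bracket_in_level_Suc:
  assumes "x \<in> root_space h \<alpha>" "\<alpha> \<in> P" "y \<in> root_space h \<beta>" "\<beta> \<in> P"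
  shows "bracket x y \<in> level P (Suc (depth P \<beta>))"
proof (cases "bracket x y = 0")
  case True
  then show ?thesis by (simp add: level_def span_zero)
next
  case False
  have xy: "bracket x y \<in> root_space h (\<alpha> + \<beta>)" using assms bracket_root_space by blast
  moreover have "\<alpha> \<in> dual_space h" "\<beta> \<in> dual_space h" using assms P_roots root_dual by blast+
  ultimately have "\<alpha> + \<beta> \<in> weights" using weightsI[OF xy False] by simp
  moreover have "\<alpha> + \<beta> \<noteq> 0"
    using zsf assms cone_add[OF cone_base cone_base] unfolding zero_sum_free_iff by metis
  ultimately have "\<alpha> + \<beta> \<in> P" using cl assms by (auto simp: closed_roots_def roots_eq)
  moreover have "depth P \<beta> < depth P (\<alpha> + \<beta>)"
    using depth_add[OF finite_P zsf assms(4,2)] by (simp add: add.commute)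
  ultimately show ?thesis unfolding level_def using xy by (auto intro!: span_base)
qed

lemma level_mono: "k \<le> l \<Longrightarrow> level P l \<subseteq> level P k"
  unfolding level_def by (intro span_mono) auto

lemma level_0: "level P 0 = span (\<Union>\<alpha>\<in>P. root_space h \<alpha>)"
  by (simp add: level_def)

lemma bracket_level:
  assumes "x \<in> level P 0" "y \<in> level P k"
  shows "bracket x y \<in> level P (Suc k)"
proof (rule bracket_span[OF _ _ assms[unfolded level_def]])
  fix x y
  assume "x \<in> (\<Union>\<alpha>\<in>{\<alpha> \<in> P. 0 \<le> depth P \<alpha>}. root_space h \<alpha>)"
    and "y \<in> (\<Union>\<alpha>\<in>{\<alpha> \<in> P. k \<le> depth P \<alpha>}. root_space h \<alpha>)"
  then obtain \<alpha> \<beta> where *: "x \<in> root_space h \<alpha>" "\<alpha> \<in> P" "y \<in> root_space h \<beta>" "\<beta> \<in> P"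
    "Suc k \<le> Suc (depth P \<beta>)" by auto
  show "bracket x y \<in> level P (Suc k)"
    using bracket_in_level_Suc[OF *(1-4)] level_mono[OF *(5)] by blast
qed simp

lemma level_card: "level P (card P) = {0}"
proof -
  have "{\<alpha> \<in> P. card P \<le> depth P \<alpha>} = {}"
    using depth_less_card[OF finite_P zsf] by (auto simp: not_le)
  then show ?thesis unfolding level_def by (simp only: UN_empty image_empty Union_empty span_empty)
qed

lemma bracket_borel_of:
  assumes "x \<in> borel_of P" "y \<in> borel_of P"
  shows "bracket x y \<in> level P 0"
proof (rule bracket_span[OF _ _ assms[unfolded borel_of_def]])
  fix x y assume *: "x \<in> h \<union> (\<Union>\<alpha>\<in>P. root_space h \<alpha>)" "y \<in> h \<union> (\<Union>\<alpha>\<in>P. root_space h \<alpha>)"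
  have hg: "bracket t v \<in> level P 0" "bracket v t \<in> level P 0"
    if "t \<in> h" "v \<in> root_space h \<alpha>" "\<alpha> \<in> P" for t v \<alpha>
  proof -
    have "v \<in> level P 0" unfolding level_0 using that by (auto intro: span_base)
    then show "bracket t v \<in> level P 0" "bracket v t \<in> level P 0"
      using that subspace_level
      by (auto simp: root_spaceD root_spaceD' subspace_scale simp del: scale_minus_left)
  qed
  from * show "bracket x y \<in> level P 0"
  proof (elim UnE)
    assume "x \<in> (\<Union>\<alpha>\<in>P. root_space h \<alpha>)" "y \<in> (\<Union>\<alpha>\<in>P. root_space h \<alpha>)"
    then show "bracket x y \<in> level P 0"
      using bracket_in_level_Suc level_mono[of 0] by blast
  qed (use hg h_abelian[of x y] in \<open>auto simp: subspace_0\<close>)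
qed simp

lemma level_subset_borel: "level P k \<subseteq> borel_of P"
  unfolding borel_of_def level_def by (rule span_mono) auto

lemma subalgebra_borel_of: "subalgebra (borel_of P)"
  using bracket_borel_of level_subset_borel by (auto simp: subalgebra_def)

text \<open>The index is shifted by one because the first derived algebra only loses h; from then on
  each step raises the depth.\<close>

lemma derived_series_borel_of: "derived_series (borel_of P) (Suc k) \<subseteq> level P k"
proof (induction k)
  case 0
  show ?case
    unfolding derived_series.simps brackets_def
    by (intro span_minimal) (use bracket_borel_of in auto)
next
  case (Suc k)
  have "bracket x y \<in> level P (Suc k)"
    if "x \<in> derived_series (borel_of P) (Suc k)" "y \<in> derived_series (borel_of P) (Suc k)" for x y
    using that Suc bracket_level level_mono[of 0 k] by blast
  then show ?case
    unfolding derived_series.simps(2)[of _ "Suc k"] brackets_def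
    by (intro span_minimal) (simp_all only: subspace_level, blast)
qed

lemma derived_series_0_mem: "0 \<in> derived_series (borel_of P) k"
  by (cases k) (simp_all add: brackets_def borel_of_def span_zero)

lemma solvable_borel_of: "solvable (borel_of P)"
  unfolding solvable_def
  using derived_series_borel_of[of "card P"] level_card derived_series_0_mem[of "Suc (card P)"]
  by (metis empty_iff subset_singleton_iff)

lemma lower_central_series_level: "lower_central_series (level P 0) k \<subseteq> level P k"
proof (induction k)
  case (Suc k)
  then show ?case
    unfolding lower_central_series.simps brackets_def
    by (intro span_minimal) (use bracket_level in auto)
qed simp

lemma nilpotent_level: "nilpotent (level P 0)"
proof -
  have "0 \<in> lower_central_series (level P 0) k" for k
    by (cases k) (simp_all add: brackets_def level_def span_zero)
  then show ?thesis
    unfolding nilpotent_def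
    using lower_central_series_level[of "card P"] level_card by (metis empty_iff subset_singleton_iff)
qed

lemma ideal_level: "ideal_of (level P 0) (borel_of P)"
  unfolding ideal_of_def using bracket_borel_of level_subset_borel by auto

end

end

section \<open>The positive roots of a Borel subalgebra and its ad-nilpotent ideals\<close>

locale borel_setup = cartan_setup scale bracket h
  for scale :: "complex \<Rightarrow> 'g::ab_group_add \<Rightarrow> 'g" and bracket and h +
  fixes b :: "'g set"
  assumes borel: "borel_subalgebra b" and h_subset_b: "h \<subseteq> b"
begin

abbreviation \<Psi> :: "('g \<Rightarrow> complex) set" where "\<Psi> \<equiv> positive_roots h b"

lemma subspace_b: "subspace b"
  using borel by (simp add: borel_subalgebra_def subalgebra_def)

lemma bracket_b: "x \<in> b \<Longrightarrow> y \<in> b \<Longrightarrow> bracket x y \<in> b"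
  using borel by (simp add: borel_subalgebra_def subalgebra_def)

lemma \<Psi>_roots: "\<Psi> \<subseteq> roots h"
  by (auto simp: positive_roots_def)

lemma \<Psi>_root: "\<alpha> \<in> \<Psi> \<Longrightarrow> \<alpha> \<in> roots h"
  using \<Psi>_roots by blast

lemma root_in_\<Psi>: "\<alpha> \<in> roots h \<Longrightarrow> v \<in> root_space h \<alpha> \<Longrightarrow> v \<noteq> 0 \<Longrightarrow> v \<in> b \<Longrightarrow> \<alpha> \<in> \<Psi>"
  unfolding positive_roots_def using root_line[OF _ _ _ _ subspace_b] by blast

text \<open>As h lies in b, the space b is h-stable and hence the sum of its weight parts; root
  spaces are lines, so each one is contained in b or meets it in 0.\<close>

lemma borel_of_\<Psi>: "borel_of \<Psi> = b"
proof
  show "borel_of \<Psi> \<subseteq> b"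
    unfolding borel_of_def
    by (rule span_minimal) (use h_subset_b subspace_b in \<open>auto simp: positive_roots_def\<close>)
  have b: "b = span (\<Union>\<mu>\<in>weights. b \<inter> root_space h \<mu>)"
    using stable_subspace_span[OF subspace_b] h_subset_b bracket_b by blast
  have "b \<inter> root_space h \<mu> \<subseteq> borel_of \<Psi>" if \<mu>: "\<mu> \<in> weights" for \<mu>
  proof
    fix v assume v: "v \<in> b \<inter> root_space h \<mu>"
    show "v \<in> borel_of \<Psi>"
    proof (cases "v = 0 \<or> \<mu> = 0")
      case True
      then show ?thesis using v root_space_0 unfolding borel_of_def
        by (auto intro: span_base simp: span_zero)
    next
      case False
      then have "\<mu> \<in> \<Psi>" using v \<mu> root_in_\<Psi>[of \<mu> v] by (auto simp: roots_eq)
      then show ?thesis using v unfolding borel_of_def by (blast intro: span_base)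
    qed
  qed
  then show "b \<subseteq> borel_of \<Psi>"
    by (subst b) (rule span_minimal, auto)
qed

lemma \<Psi>_closed: "closed_roots \<Psi>"
  unfolding closed_roots_def
proof (intro conjI ballI impI)
  fix \<alpha> \<beta> assume *: "\<alpha> \<in> \<Psi>" "\<beta> \<in> \<Psi>" and sum: "\<alpha> + \<beta> \<in> roots h"
  obtain x y t where s: "sl2 \<alpha> x y t" using root_sl2 \<Psi>_root[OF *(1)] by blast
  obtain v where v: "v \<in> root_space h \<beta>" "v \<noteq> 0" using root_vector \<Psi>_root[OF *(2)] by blast
  have "bracket x v \<noteq> 0"
    using root_sum_bracket[OF s \<Psi>_root[OF *(2)] _ v] sum by (auto simp: roots_eq add.commute)
  moreover have "bracket x v \<in> root_space h (\<alpha> + \<beta>)"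
    using bracket_root_space[OF sl2D(2)[OF s] v(1)] .
  moreover have "bracket x v \<in> b"
    using * v sl2D(2)[OF s] bracket_b by (auto simp: positive_roots_def)
  ultimately show "\<alpha> + \<beta> \<in> \<Psi>" using sum root_in_\<Psi> by blast
qed (rule \<Psi>_roots)

text \<open>Otherwise b contains a whole triple x, y, t. Each of the three is a multiple of a
  bracket of two of them, so they survive in every derived algebra.\<close>

lemma \<Psi>_antisymmetric: assumes \<alpha>: "\<alpha> \<in> \<Psi>" shows "- \<alpha> \<notin> \<Psi>"
proof
  assume m: "- \<alpha> \<in> \<Psi>"
  obtain x y t where s: "sl2 \<alpha> x y t" using root_sl2 \<Psi>_root[OF \<alpha>] by blast
  note d = sl2D[OF s]
  have tx: "bracket t x = scale 2 x" using root_spaceD[OF d(2,6)] d(5) by simp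
  have ty: "bracket t y = scale (- 2) y" using root_spaceD[OF d(3,6)] d(5) by simp
  have "x \<in> derived_series b k \<and> y \<in> derived_series b k \<and> t \<in> derived_series b k" for k
  proof (induction k)
    case 0
    then show ?case
      using \<alpha> m d h_subset_b by (auto simp: positive_roots_def)
  next
    case (Suc k)
    let ?D = "derived_series b (Suc k)"
    have D: "bracket u v \<in> ?D" if "u \<in> derived_series b k" "v \<in> derived_series b k" for u v
      using that by (auto simp: brackets_def intro!: span_base)
    have sc: "scale c u \<in> ?D" if "u \<in> ?D" for c u
      using that by (simp add: brackets_def span_scale)
    have "scale (1/2) (bracket t x) \<in> ?D" "scale (- 1/2) (bracket t y) \<in> ?D" "bracket x y \<in> ?D"
      using Suc D sc by blast+
    moreover have "scale (1/2) (bracket t x) = x" "scale (- 1/2) (bracket t y) = y"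
      unfolding tx ty scale_scale by simp_all
    ultimately show ?case using d(4) by metis
  qed
  moreover obtain k where "derived_series b k = {0}"
    using borel by (auto simp: borel_subalgebra_def solvable_def)
  ultimately show False using d(8) by blast
qed

lemma \<Psi>_zero_sum_free: "zero_sum_free \<Psi>"
  using closed_antisymmetric_zero_sum_free[OF \<Psi>_closed \<Psi>_antisymmetric] by blast

text \<open>The roots in the cone of \<Psi> and \<alpha> are closed and free of vanishing sums, so
  they give a solvable subalgebra containing b. By maximality it is b.\<close>

lemma \<Psi>_extend:
  assumes \<alpha>: "\<alpha> \<in> roots h" and zsf: "zero_sum_free (insert \<alpha> \<Psi>)"
  shows "\<alpha> \<in> \<Psi>"
proof -
  let ?P = "roots h \<inter> cone (insert \<alpha> \<Psi>)"
  have cl: "closed_roots ?P" by (rule closed_roots_cone)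
  have z: "zero_sum_free ?P" using zero_sum_free_cone[OF zsf] by blast
  have sub: "insert \<alpha> \<Psi> \<subseteq> ?P" using \<alpha> \<Psi>_roots by (auto intro: cone_base)
  have "borel_of \<Psi> \<subseteq> borel_of ?P"
    unfolding borel_of_def using sub by (intro span_mono) auto
  then have "b \<subseteq> borel_of ?P" by (simp add: borel_of_\<Psi>)
  then have "borel_of ?P = b"
    using borel subalgebra_borel_of[OF cl z] solvable_borel_of[OF cl z]
    unfolding borel_subalgebra_def by blast
  moreover have "root_space h \<alpha> \<subseteq> borel_of ?P"
    using sub unfolding borel_of_def by (auto intro!: span_base)
  ultimately show ?thesis using \<alpha> by (simp add: positive_roots_def)
qed

lemma root_cases: assumes "\<alpha> \<in> roots h" shows "\<alpha> \<in> \<Psi> \<or> - \<alpha> \<in> \<Psi>"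
proof -
  have "\<alpha> \<noteq> 0" using assms by (simp add: roots_def)
  then show ?thesis
    using zero_sum_free_extend[OF \<Psi>_zero_sum_free] \<Psi>_extend assms minus_root by blast
qed

lemma nilpotent_ideal_subset:
  assumes I: "ideal_of I b" "nilpotent I"
  shows "I \<subseteq> level \<Psi> 0"
proof -
  have sub: "subspace I" "I \<subseteq> b" and br: "\<And>x y. x \<in> b \<Longrightarrow> y \<in> I \<Longrightarrow> bracket x y \<in> I"
    using I(1) by (auto simp: ideal_of_def)
  obtain N where N: "lower_central_series I N = {0}" using I(2) by (auto simp: nilpotent_def)
  \<comment> \<open>If a positive \<alpha> were nonzero on t, then e, a multiple of its bracket with
    t, would lie in I and in every term of the lower central series of I.\<close>
  have h0: "t = 0" if t: "t \<in> I" "t \<in> h" for t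
  proof (rule no_center[OF t(2)], rule ccontr)
    fix \<mu> assume \<mu>: "\<mu> \<in> weights" "\<mu> t \<noteq> 0"
    then have "\<mu> \<in> roots h" by (auto simp: roots_eq)
    then obtain \<alpha> where \<alpha>: "\<alpha> \<in> \<Psi>" "\<alpha> t \<noteq> 0" using root_cases[of \<mu>] \<mu>(2) by force
    obtain e where e: "e \<in> root_space h \<alpha>" "e \<noteq> 0" using root_vector \<Psi>_root[OF \<alpha>(1)] by blast
    have te: "scale (1 / \<alpha> t) (bracket t e) = e" using root_spaceD[OF e(1) t(2)] \<alpha>(2) by simp
    have "e \<in> b" using e \<alpha> by (auto simp: positive_roots_def)
    then have "- bracket e t \<in> I" using br[OF _ t(1)] sub(1) by (blast intro: subspace_neg)
    then have "bracket t e \<in> I" using bracket_anti[of t e] by simp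
    from subspace_scale[OF sub(1) this] have eI: "e \<in> I" using te by metis
    have "e \<in> lower_central_series I k" for k
    proof (induction k)
      case (Suc k)
      then have "bracket t e \<in> lower_central_series I (Suc k)"
        using t(1) by (auto simp: brackets_def intro!: span_base)
      then have "scale (1 / \<alpha> t) (bracket t e) \<in> lower_central_series I (Suc k)"
        unfolding lower_central_series.simps brackets_def by (rule span_scale)
      then show ?case unfolding te .
    qed (use eI in simp)
    then show False using N e(2) by blast
  qed
  have I_span: "I = span (\<Union>\<mu>\<in>weights. I \<inter> root_space h \<mu>)"
    by (rule stable_subspace_span) (use sub br h_subset_b in auto)
  have "I \<inter> root_space h \<mu> \<subseteq> level \<Psi> 0" if \<mu>: "\<mu> \<in> weights" for \<mu>
  proof
    fix v assume v: "v \<in> I \<inter> root_space h \<mu>"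
    show "v \<in> level \<Psi> 0"
    proof (cases "v = 0")
      case False
      then have "\<mu> \<noteq> 0" using h0 v root_space_0 by auto
      then have "\<mu> \<in> \<Psi>" using v False \<mu> sub(2) root_in_\<Psi>[of \<mu> v] by (auto simp: roots_eq)
      then show ?thesis using v unfolding level_def by (auto intro!: span_base)
    qed (simp add: subspace_0)
  qed
  then show ?thesis by (subst I_span) (rule span_minimal, auto)
qed

lemma nilradical_b: "nilradical b = level \<Psi> 0"
proof
  show "nilradical b \<subseteq> level \<Psi> 0"
    unfolding nilradical_def using nilpotent_ideal_subset by (intro span_minimal) auto
  have "ideal_of (level \<Psi> 0) b" "nilpotent (level \<Psi> 0)"
    using ideal_level[OF \<Psi>_closed \<Psi>_zero_sum_free] nilpotent_level[OF \<Psi>_closed \<Psi>_zero_sum_free]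
    by (simp_all add: borel_of_\<Psi>)
  then show "level \<Psi> 0 \<subseteq> nilradical b"
    unfolding nilradical_def by (blast intro: span_base)
qed

definition ideal_from :: "('g \<Rightarrow> complex) set \<Rightarrow> 'g set" where
  "ideal_from U = span (\<Union>\<alpha>\<in>U. root_space h \<alpha>)"

lemma ideal_roots_from:
  assumes "U \<subseteq> \<Psi>"
  shows "ideal_roots h b (ideal_from U) = U"
proof
  show "U \<subseteq> ideal_roots h b (ideal_from U)"
    using assms by (auto simp: ideal_roots_def ideal_from_def intro!: span_base)
  show "ideal_roots h b (ideal_from U) \<subseteq> U"
  proof
    fix \<alpha> assume a: "\<alpha> \<in> ideal_roots h b (ideal_from U)"
    then have \<alpha>: "\<alpha> \<in> roots h" "root_space h \<alpha> \<subseteq> ideal_from U"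
      using \<Psi>_root by (auto simp: ideal_roots_def)
    obtain v where v: "v \<in> root_space h \<alpha>" "v \<noteq> 0" using root_vector[OF \<alpha>(1)] .
    have "v = 0 \<or> (\<alpha> \<in> U \<and> v \<in> root_space h \<alpha>)"
      by (rule component_in_span[where V = "root_space h"])
        (use assms \<Psi>_roots \<alpha> v in \<open>auto simp: ideal_from_def roots_eq weights_dual\<close>)
    then show "\<alpha> \<in> U" using v by blast
  qed
qed

lemma ideal_from_roots:
  assumes I: "I \<in> ad_nilpotent_ideals b"
  shows "ideal_from (ideal_roots h b I) = I"
proof
  have sub: "subspace I" "I \<subseteq> level \<Psi> 0" "I \<subseteq> b"
    and br: "\<And>x y. x \<in> b \<Longrightarrow> y \<in> I \<Longrightarrow> bracket x y \<in> I"
    using I by (auto simp: ad_nilpotent_ideals_def ideal_of_def nilradical_b)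
  show "ideal_from (ideal_roots h b I) \<subseteq> I"
    unfolding ideal_from_def using sub by (intro span_minimal) (auto simp: ideal_roots_def)
  have I_span: "I = span (\<Union>\<mu>\<in>weights. I \<inter> root_space h \<mu>)"
    by (rule stable_subspace_span) (use sub br h_subset_b in auto)
  have "I \<inter> root_space h \<mu> \<subseteq> ideal_from (ideal_roots h b I)" if \<mu>: "\<mu> \<in> weights" for \<mu>
  proof
    fix v assume v: "v \<in> I \<inter> root_space h \<mu>"
    show "v \<in> ideal_from (ideal_roots h b I)"
    proof (cases "v = 0")
      case False
      have "v = 0 \<or> (\<mu> \<in> \<Psi> \<and> v \<in> root_space h \<mu>)"
        by (rule component_in_span[where V = "root_space h"])
          (use \<Psi>_roots v sub \<mu> in \<open>auto simp: level_def roots_eq weights_dual\<close>)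
      then have "\<mu> \<in> \<Psi>" using False by blast
      then have "\<mu> \<in> ideal_roots h b I"
        using root_line[OF \<Psi>_root _ False _ sub(1), of \<mu>] v by (auto simp: ideal_roots_def)
      then show ?thesis using v by (auto simp: ideal_from_def intro!: span_base)
    qed (simp add: ideal_from_def span_zero)
  qed
  then show "I \<subseteq> ideal_from (ideal_roots h b I)"
    by (subst I_span) (rule span_minimal, auto simp: ideal_from_def)
qed

lemma upper_ideal_roots:
  assumes I: "I \<in> ad_nilpotent_ideals b"
  shows "upper_subset \<Psi> (ideal_roots h b I)"
  unfolding upper_subset_def
proof (intro conjI ballI impI)
  fix \<alpha> \<beta> assume *: "\<alpha> \<in> ideal_roots h b I" "\<beta> \<in> \<Psi>" "\<alpha> + \<beta> \<in> \<Psi>"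
  have sub: "subspace I" and br: "\<And>x y. x \<in> b \<Longrightarrow> y \<in> I \<Longrightarrow> bracket x y \<in> I"
    using I by (auto simp: ad_nilpotent_ideals_def ideal_of_def)
  have \<alpha>: "\<alpha> \<in> roots h" "root_space h \<alpha> \<subseteq> I" using * \<Psi>_root by (auto simp: ideal_roots_def)
  obtain x y t where s: "sl2 \<beta> x y t" using root_sl2 \<Psi>_root[OF *(2)] by blast
  obtain v where v: "v \<in> root_space h \<alpha>" "v \<noteq> 0" using root_vector \<alpha>(1) by blast
  have "bracket x v \<noteq> 0"
    using root_sum_bracket[OF s \<alpha>(1) _ v] \<Psi>_root[OF *(3)] by (auto simp: roots_eq)
  moreover have "bracket x v \<in> root_space h (\<alpha> + \<beta>)"
    using bracket_root_space[OF sl2D(2)[OF s] v(1)] by (simp add: add.commute)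
  moreover have "bracket x v \<in> I"
    using br[of x v] v \<alpha>(2) *(2) sl2D(2)[OF s] by (auto simp: positive_roots_def)
  ultimately have "root_space h (\<alpha> + \<beta>) \<subseteq> I"
    using root_line[OF \<Psi>_root[OF *(3)]] sub by blast
  then show "\<alpha> + \<beta> \<in> ideal_roots h b I" using *(3) by (simp add: ideal_roots_def)
qed (auto simp: ideal_roots_def)

lemma ideal_from_upper:
  assumes U: "upper_subset \<Psi> U"
  shows "ideal_from U \<in> ad_nilpotent_ideals b"
proof -
  have U\<Psi>: "U \<subseteq> \<Psi>" using U by (simp add: upper_subset_def)
  have sub: "ideal_from U \<subseteq> level \<Psi> 0"
    unfolding ideal_from_def level_def using U\<Psi> by (intro span_mono) auto
  have "bracket x y \<in> ideal_from U" if "x \<in> borel_of \<Psi>" "y \<in> ideal_from U" for x y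
  proof (rule bracket_span[OF _ _ that[unfolded borel_of_def ideal_from_def]])
    fix x y assume x: "x \<in> h \<union> (\<Union>\<alpha>\<in>\<Psi>. root_space h \<alpha>)" and "y \<in> (\<Union>\<alpha>\<in>U. root_space h \<alpha>)"
    then obtain \<alpha> where \<alpha>: "\<alpha> \<in> U" "y \<in> root_space h \<alpha>" by blast
    then have y: "y \<in> ideal_from U" by (auto simp: ideal_from_def intro: span_base)
    from x show "bracket x y \<in> ideal_from U"
    proof
      assume "x \<in> h"
      then show ?thesis using root_spaceD[OF \<alpha>(2)] y by (simp add: ideal_from_def span_scale)
    next
      assume "x \<in> (\<Union>\<alpha>\<in>\<Psi>. root_space h \<alpha>)"
      then obtain \<beta> where \<beta>: "\<beta> \<in> \<Psi>" "x \<in> root_space h \<beta>" by blast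
      have xy: "bracket x y \<in> root_space h (\<alpha> + \<beta>)"
        using bracket_root_space[OF \<beta>(2) \<alpha>(2)] by (simp add: add.commute)
      show ?thesis
      proof (cases "bracket x y = 0")
        case False
        have \<alpha>\<Psi>: "\<alpha> \<in> \<Psi>" using \<alpha> U\<Psi> by blast
        have "\<alpha> + \<beta> \<in> weights"
          using weightsI[OF xy False] root_dual \<Psi>_root \<alpha>\<Psi> \<beta>(1) by simp
        moreover have "\<alpha> + \<beta> \<noteq> 0"
          using \<Psi>_antisymmetric \<alpha>\<Psi> \<beta>(1) by (metis add_eq_0_iff)
        ultimately have "\<alpha> + \<beta> \<in> \<Psi>"
          using \<Psi>_closed \<alpha>\<Psi> \<beta>(1) by (auto simp: closed_roots_def roots_eq)
        then have "\<alpha> + \<beta> \<in> U" using U \<alpha>(1) \<beta>(1) by (auto simp: upper_subset_def)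
        then show ?thesis using xy by (auto simp: ideal_from_def intro: span_base)
      qed (simp add: ideal_from_def span_zero)
    qed
  qed (simp add: ideal_from_def)
  moreover have "ideal_from U \<subseteq> b"
    using sub level_subset_borel[of \<Psi> 0] borel_of_\<Psi> \<Psi>_closed \<Psi>_zero_sum_free by blast
  ultimately show ?thesis
    using sub unfolding ad_nilpotent_ideals_def nilradical_b ideal_of_def borel_of_\<Psi>
    by (simp add: ideal_from_def)
qed

theorem num_ideals_eq_upper_subsets:
  "num_ideals h b j = card {U. upper_subset \<Psi> U \<and> card (simple_roots h b \<inter> U) = j}"
  unfolding num_ideals_def
proof (rule bij_betw_same_card[of "ideal_roots h b"], rule bij_betw_byWitness[where f' = ideal_from])
  let ?A = "{I \<in> ad_nilpotent_ideals b. card (simple_roots h b \<inter> ideal_roots h b I) = j}"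
  let ?B = "{U. upper_subset \<Psi> U \<and> card (simple_roots h b \<inter> U) = j}"
  show "\<forall>I\<in>?A. ideal_from (ideal_roots h b I) = I" using ideal_from_roots by blast
  have *: "ideal_roots h b (ideal_from U) = U" if "upper_subset \<Psi> U" for U
    using that ideal_roots_from by (simp add: upper_subset_def)
  then show "\<forall>U\<in>?B. ideal_roots h b (ideal_from U) = U" by blast
  show "ideal_roots h b ` ?A \<subseteq> ?B" using upper_ideal_roots by blast
  show "ideal_from ` ?B \<subseteq> ?A" using * ideal_from_upper by auto
qed

end

section \<open>Comparison with a root system in coordinates\<close>

definition num_upper :: "'a::plus set \<Rightarrow> 'a set \<Rightarrow> nat \<Rightarrow> nat" where
  "num_upper P S j = card {U. upper_subset P U \<and> card (S \<inter> U) = j}"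

text \<open>Being an upper set is a condition on the triples of P with x + y = z, so f has to
  respect just these.\<close>

lemma num_upper_transport:
  assumes f: "bij_betw f P Q" and S: "S \<subseteq> P"
    and add: "\<And>x y z. x \<in> P \<Longrightarrow> y \<in> P \<Longrightarrow> z \<in> P \<Longrightarrow> x + y = z \<longleftrightarrow> f x + f y = f z"
  shows "num_upper P S j = num_upper Q (f ` S) j"
proof -
  have inj: "inj_on f P" and im: "f ` P = Q" using f by (auto simp: bij_betw_def)
  have up: "upper_subset P U \<longleftrightarrow> upper_subset Q (f ` U)" if U: "U \<subseteq> P" for U
  proof
    assume u: "upper_subset P U"
    show "upper_subset Q (f ` U)"
      unfolding upper_subset_def
    proof (intro conjI ballI impI)
      show "f ` U \<subseteq> Q" using U im by blast
      fix p q assume "p \<in> f ` U" "q \<in> Q" "p + q \<in> Q"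
      then obtain x y z where "x \<in> U" "p = f x" "y \<in> P" "q = f y" "z \<in> P" "p + q = f z"
        using im by blast
      moreover from this have "x + y = z" using add[of x y z] U by auto
      ultimately show "p + q \<in> f ` U" using u by (auto simp: upper_subset_def)
    qed
  next
    assume u: "upper_subset Q (f ` U)"
    show "upper_subset P U"
      unfolding upper_subset_def
    proof (intro conjI ballI impI)
      fix x y assume *: "x \<in> U" "y \<in> P" "x + y \<in> P"
      then have "f x + f y = f (x + y)" using add[of x y "x + y"] U by auto
      moreover have "f (x + y) \<in> Q" using * im by blast
      ultimately have "f (x + y) \<in> f ` U" using u * im unfolding upper_subset_def by (metis image_eqI)
      then show "x + y \<in> U" using inj * U by (meson inj_on_image_mem_iff)
    qed (use U in blast)
  qed
  have cnt: "card (f ` S \<inter> f ` U) = card (S \<inter> U)" if U: "U \<subseteq> P" for U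
  proof -
    have "f ` S \<inter> f ` U = f ` (S \<inter> U)"
      using inj_on_image_Int[OF inj S U] by simp
    then show ?thesis using inj_on_subset[OF inj, of "S \<inter> U"] U by (simp add: card_image le_infI2)
  qed
  have "bij_betw (image f) {U. upper_subset P U \<and> card (S \<inter> U) = j}
      {U. upper_subset Q U \<and> card (f ` S \<inter> U) = j}"
  proof (rule bij_betw_imageI)
    show "inj_on (image f) {U. upper_subset P U \<and> card (S \<inter> U) = j}"
      using inj_on_image_Pow[OF inj] by (rule inj_on_subset) (auto simp: upper_subset_def)
    show "image f ` {U. upper_subset P U \<and> card (S \<inter> U) = j} =
        {U. upper_subset Q U \<and> card (f ` S \<inter> U) = j}" (is "?L = ?R")
    proof
      show "?L \<subseteq> ?R" using up cnt by (auto simp: upper_subset_def)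
      show "?R \<subseteq> ?L"
      proof
        fix V assume V: "V \<in> ?R"
        then obtain U where "U \<subseteq> P" "V = f ` U"
          using im by (metis (mono_tags, lifting) mem_Collect_eq subset_imageE upper_subset_def)
        then show "V \<in> ?L" using V up cnt by auto
      qed
    qed
  qed
  then show ?thesis unfolding num_upper_def by (rule bij_betw_same_card)
qed

text \<open>A model of the positive system in integer coordinates: \<open>pr v i\<close> is the pairing of \<open>v\<close> with the
  \<open>i\<close>-th simple coroot, and \<open>q i\<close> is the squared length of the simple root \<open>a i\<close> with
  respect to the standard form on the coordinates \<open>1, \<dots>, N\<close>.\<close>

locale root_model =
  fixes n N :: nat and a :: "nat \<Rightarrow> nat \<Rightarrow> int" and pr :: "(nat \<Rightarrow> int) \<Rightarrow> nat \<Rightarrow> int"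
    and q :: "nat \<Rightarrow> int" and R :: "(nat \<Rightarrow> int) set" and C :: "nat \<Rightarrow> nat \<Rightarrow> int"
  assumes pr_lin: "j \<in> {1..n} \<Longrightarrow> pr (\<lambda>k. \<Sum>i=1..n. d i * a i k) j = (\<Sum>i=1..n. d i * C i j)"
    and form: "j \<in> {1..n} \<Longrightarrow> 2 * (\<Sum>k=1..N. v k * a j k) = q j * pr v j"
    and q_pos: "j \<in> {1..n} \<Longrightarrow> q j > 0"
    and independent: "(\<And>k. k \<in> {1..N} \<Longrightarrow> (\<Sum>i=1..n. d i * a i k) = 0) \<Longrightarrow> i \<in> {1..n} \<Longrightarrow> d i = 0"
    and simple_in: "i \<in> {1..n} \<Longrightarrow> a i \<in> R"
    and refl_in: "v \<in> R \<Longrightarrow> i \<in> {1..n} \<Longrightarrow> v \<noteq> a i \<Longrightarrow> (\<lambda>k. v k - pr v i * a i k) \<in> R"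
    and R_cone: "R \<subseteq> cone (a ` {1..n})"
begin

definition lin :: "(nat \<Rightarrow> int) \<Rightarrow> nat \<Rightarrow> int" where
  "lin d = (\<lambda>k. \<Sum>i=1..n. d i * a i k)"

lemma norm_lin: "2 * (\<Sum>k=1..N. (lin d k)\<^sup>2) = (\<Sum>i=1..n. d i * (q i * pr (lin d) i))"
proof -
  have "2 * (\<Sum>k=1..N. (lin d k)\<^sup>2) = 2 * (\<Sum>k=1..N. \<Sum>i=1..n. lin d k * (d i * a i k))"
    by (simp add: power2_eq_square lin_def sum_distrib_left)
  also have "\<dots> = 2 * (\<Sum>i=1..n. \<Sum>k=1..N. lin d k * (d i * a i k))"
    by (subst sum.swap) simp
  also have "\<dots> = (\<Sum>i=1..n. d i * (2 * (\<Sum>k=1..N. lin d k * a i k)))"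
    by (simp add: sum_distrib_left mult_ac)
  also have "\<dots> = (\<Sum>i=1..n. d i * (q i * pr (lin d) i))"
    using form by (intro sum.cong) auto
  finally show ?thesis .
qed

lemma lin_zero_coords: "\<forall>k\<in>{1..N}. lin d k = 0 \<Longrightarrow> i \<in> {1..n} \<Longrightarrow> d i = 0"
  using independent[of d i] by (simp add: lin_def)

lemma pr_zero_coords:
  assumes "\<And>j. j \<in> {1..n} \<Longrightarrow> pr (lin d) j = 0" "i \<in> {1..n}"
  shows "d i = 0"
proof -
  have "(\<Sum>k=1..N. (lin d k)\<^sup>2) = 0" using norm_lin[of d] assms(1) by simp
  then have "\<forall>k\<in>{1..N}. lin d k = 0" by (simp add: sum_nonneg_eq_0_iff)
  then show ?thesis using lin_zero_coords assms(2) by blast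
qed

text \<open>Twice the squared norm of \<open>lin d\<close> is the sum of the terms
  \<open>d i * q i * pr (lin d) i\<close>; it is positive for nonzero d, so some term is. For
  nonnegative d this yields a simple reflection that lowers the height.\<close>

lemma positive_pairing:
  assumes "i \<in> {1..n}" "d i \<noteq> 0"
  shows "\<exists>i\<in>{1..n}. d i * pr (lin d) i > 0"
proof (rule ccontr)
  assume "\<not> ?thesis"
  then have "d i * (q i * pr (lin d) i) \<le> 0" if "i \<in> {1..n}" for i
    using q_pos[OF that] that by (simp add: mult.left_commute[of _ "q i"] mult_nonneg_nonpos not_less)
  then have "2 * (\<Sum>k=1..N. (lin d k)\<^sup>2) \<le> 0" unfolding norm_lin by (rule sum_nonpos)
  moreover have "(\<Sum>k=1..N. (lin d k)\<^sup>2) \<ge> 0" by (rule sum_nonneg) simp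
  ultimately have "(\<Sum>k=1..N. (lin d k)\<^sup>2) = 0" by linarith
  then have "\<forall>k\<in>{1..N}. lin d k = 0" by (simp add: sum_nonneg_eq_0_iff)
  then show False using lin_zero_coords assms by blast
qed

lemma lin_unit: "i \<in> {1..n} \<Longrightarrow> lin (\<lambda>k. of_bool (k = i)) = a i"
  by (rule ext) (simp add: lin_def of_bool_def if_distrib[of "\<lambda>x. x * _"] cong: if_cong)

lemma lin_diff: "lin (\<lambda>k. d k - e k) = (\<lambda>k. lin d k - lin e k)"
  by (rule ext) (simp add: lin_def algebra_simps sum_subtractf)

lemma lin_add: "lin (\<lambda>k. d k + e k) = (\<lambda>k. lin d k + lin e k)"
  by (rule ext) (simp add: lin_def algebra_simps sum.distrib)

lemma lin_diff_scaled: "lin (\<lambda>k. d k - c * e k) = (\<lambda>k. lin d k - c * lin e k)"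
  by (rule ext) (simp add: lin_def algebra_simps sum_subtractf sum_distrib_left)

lemma lin_refl: "i \<in> {1..n} \<Longrightarrow> lin (\<lambda>k. d k - c * of_bool (k = i)) = (\<lambda>k. lin d k - c * a i k)"
  using lin_diff_scaled[of d c "\<lambda>k. of_bool (k = i)"] by (simp add: lin_unit)

lemma R_lin:
  assumes "v \<in> R" shows "\<exists>d. v = lin d \<and> (\<forall>i. d i \<ge> 0) \<and> (\<exists>i\<in>{1..n}. d i \<noteq> 0)"
proof -
  have "\<exists>d. sum_list xs = lin d \<and> (\<forall>i. d i \<ge> 0) \<and> (xs \<noteq> [] \<longrightarrow> (\<exists>i\<in>{1..n}. d i \<noteq> 0))"
    if "set xs \<subseteq> a ` {1..n}" for xs
    using that
  proof (induction xs)
    case Nil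
    show ?case by (rule exI[of _ "\<lambda>_. 0"]) (simp add: lin_def fun_eq_iff)
  next
    case (Cons x xs)
    then obtain d where d: "sum_list xs = lin d" "\<forall>i. d i \<ge> 0" by auto
    have "x \<in> a ` {1..n}" using Cons.prems by simp
    then obtain i where i: "i \<in> {1..n}" "x = a i" by blast
    let ?e = "\<lambda>k. of_bool (k = i) + d k"
    have "sum_list (x # xs) = lin ?e"
      using d i unfolding lin_add lin_unit[OF i(1)] by (simp add: fun_eq_iff)
    moreover have "?e i \<noteq> 0" using d(2)[rule_format, of i] by simp
    ultimately show ?case using d i by (intro exI[of _ ?e]) auto
  qed
  then show ?thesis using R_cone assms unfolding cone_def by blast
qed

lemma lin_inj:
  assumes "lin d = lin e" "i \<in> {1..n}" shows "d i = e i"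
  using lin_zero_coords[of "\<lambda>k. d k - e k" i] assms by (simp add: lin_diff)

end

section \<open>Matching positive roots with the model by simple reflections\<close>

context borel_setup
begin

lemma \<Psi>_finite: "finite \<Psi>"
  using finite_roots \<Psi>_roots finite_subset by blast

text \<open>A positive root that is not simple splits into two positive roots of smaller
  \<open>depth\<close>.\<close>

lemma positive_root_in_simple_cone: "\<beta> \<in> \<Psi> \<Longrightarrow> \<beta> \<in> cone (simple_roots h b)"
proof (induction "depth \<Psi> \<beta>" arbitrary: \<beta> rule: less_induct)
  case less
  show ?case
  proof (cases "\<beta> \<in> simple_roots h b")
    case False
    then obtain \<gamma> \<delta> where *: "\<gamma> \<in> \<Psi>" "\<delta> \<in> \<Psi>" "\<beta> = \<gamma> + \<delta>"
      using less.prems by (auto simp: simple_roots_def)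
    have "depth \<Psi> \<gamma> < depth \<Psi> \<beta>" "depth \<Psi> \<delta> < depth \<Psi> \<beta>"
      using depth_add[OF \<Psi>_finite \<Psi>_zero_sum_free *(1,2)] depth_add[OF \<Psi>_finite \<Psi>_zero_sum_free *(2,1)]
      by (simp_all add: *(3) add.commute)
    then have "\<gamma> \<in> cone (simple_roots h b)" "\<delta> \<in> cone (simple_roots h b)"
      using less.hyps * by blast+
    then show ?thesis unfolding *(3) by (rule cone_add)
  qed (rule cone_base)
qed

end

locale borel_model = borel_setup scale bracket h b + root_model n N a pr q R C
  for scale :: "complex \<Rightarrow> 'g::ab_group_add \<Rightarrow> 'g" and bracket and h b
    and n N :: nat and a pr q R C +
  fixes \<alpha> :: "nat \<Rightarrow> 'g \<Rightarrow> complex"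
  assumes \<alpha>_bij: "bij_betw \<alpha> {1..n} (simple_roots h b)"
    and \<alpha>_cartan: "i \<in> {1..n} \<Longrightarrow> j \<in> {1..n} \<Longrightarrow> \<alpha> i (coroot h (\<alpha> j)) = of_int (C i j)"
begin

definition comb :: "(nat \<Rightarrow> int) \<Rightarrow> 'g \<Rightarrow> complex" where
  "comb d = (\<lambda>s. \<Sum>i=1..n. of_int (d i) * \<alpha> i s)"

lemma \<alpha>_simple: "i \<in> {1..n} \<Longrightarrow> \<alpha> i \<in> simple_roots h b"
  using \<alpha>_bij by (auto simp: bij_betw_def)

lemma \<alpha>_positive: "i \<in> {1..n} \<Longrightarrow> \<alpha> i \<in> \<Psi>"
  using \<alpha>_simple by (auto simp: simple_roots_def)

lemma \<alpha>_sl2: assumes "i \<in> {1..n}" shows "\<exists>x y. sl2 (\<alpha> i) x y (coroot h (\<alpha> i))"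
  using root_sl2[OF \<Psi>_root[OF \<alpha>_positive[OF assms]]] coroot_sl2 by metis

text \<open>The bridge between the two sides: the common Cartan matrix makes the coroot pairings in
  the Lie algebra and in the model agree.\<close>

lemma comb_coroot: "j \<in> {1..n} \<Longrightarrow> comb d (coroot h (\<alpha> j)) = of_int (pr (lin d) j)"
  unfolding comb_def lin_def by (subst pr_lin) (simp_all add: \<alpha>_cartan)

lemma comb_diff: "comb (\<lambda>k. d k - e k) = comb d - comb e"
  by (rule ext) (simp add: comb_def algebra_simps sum_subtractf)

lemma comb_add: "comb (\<lambda>k. d k + e k) = comb d + comb e"
  by (rule ext) (simp add: comb_def algebra_simps sum.distrib)

lemma comb_minus: "comb (\<lambda>k. - d k) = - comb d"
  by (rule ext) (simp add: comb_def sum_negf)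

lemma comb_unit: "i \<in> {1..n} \<Longrightarrow> comb (\<lambda>k. of_bool (k = i)) = \<alpha> i"
  by (rule ext) (simp add: comb_def of_bool_def if_distrib[of of_int] if_distrib[of "\<lambda>x. x * _"] cong: if_cong)

lemma comb_refl:
  assumes "i \<in> {1..n}"
  shows "comb (\<lambda>k. d k - c * of_bool (k = i)) = (\<lambda>s. comb d s - of_int c * \<alpha> i s)"
proof -
  have "comb (\<lambda>k. d k - c * e k) = (\<lambda>s. comb d s - of_int c * comb e s)" for e
    by (rule ext) (simp add: comb_def algebra_simps sum_subtractf sum_distrib_left)
  from this[of "\<lambda>k. of_bool (k = i)"] show ?thesis by (simp add: comb_unit[OF assms])
qed

text \<open>Linear independence of the simple roots is borrowed from the model: vanishing of all
  coroot pairings forces d = 0 there, by definiteness of the form.\<close>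

lemma comb_zero: "comb d = 0 \<Longrightarrow> i \<in> {1..n} \<Longrightarrow> d i = 0"
  using comb_coroot[of _ d] by (intro pr_zero_coords[of d]) auto

lemma comb_inj: "comb d = comb e \<Longrightarrow> i \<in> {1..n} \<Longrightarrow> d i = e i"
  using comb_zero[of "\<lambda>k. d k - e k" i] by (simp add: comb_diff)

lemma comb_cong: "(\<And>i. i \<in> {1..n} \<Longrightarrow> d i = e i) \<Longrightarrow> comb d = comb e"
  unfolding comb_def by (intro ext sum.cong) auto

lemma lin_cong: "(\<And>i. i \<in> {1..n} \<Longrightarrow> d i = e i) \<Longrightarrow> lin d = lin e"
  unfolding lin_def by (intro ext sum.cong) auto

lemma lin_eq_iff: "lin d = lin e \<longleftrightarrow> comb d = comb e"
  using lin_inj comb_inj comb_cong lin_cong by metis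

lemma positive_root_comb:
  assumes "\<beta> \<in> \<Psi>" shows "\<exists>d. \<beta> = comb d \<and> (\<forall>i. d i \<ge> 0)"
proof -
  have "\<exists>d. sum_list xs = comb d \<and> (\<forall>i. d i \<ge> 0)" if "set xs \<subseteq> simple_roots h b" for xs
    using that
  proof (induction xs)
    case Nil
    show ?case by (rule exI[of _ "\<lambda>_. 0"]) (simp add: comb_def fun_eq_iff)
  next
    case (Cons x xs)
    then obtain d where d: "sum_list xs = comb d" "\<forall>i. d i \<ge> 0" by auto
    have "x \<in> \<alpha> ` {1..n}" using Cons.prems bij_betw_imp_surj_on[OF \<alpha>_bij] by simp
    then obtain i where i: "i \<in> {1..n}" "x = \<alpha> i" by blast
    show ?case
      using d i by (intro exI[of _ "\<lambda>k. of_bool (k = i) + d k"]) (simp add: comb_add comb_unit)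
  qed
  then show ?thesis
    using positive_root_in_simple_cone[OF assms] unfolding cone_def by blast
qed

lemma positive_root_coeff:
  assumes "comb d \<in> \<Psi>" "i \<in> {1..n}" shows "d i \<ge> 0"
  using positive_root_comb[OF assms(1)] comb_inj assms(2) by metis

text \<open>The reflection changes only the i-th coefficient. Were the result negative, all other
  coefficients would be 0 and the root would be a proper multiple of
  \<open>\<alpha> i\<close>.\<close>

lemma simple_reflection_positive:
  assumes d: "comb d \<in> \<Psi>" and i: "i \<in> {1..n}" and ne: "comb d \<noteq> \<alpha> i"
  shows "comb (\<lambda>k. d k - pr (lin d) i * of_bool (k = i)) \<in> \<Psi>" (is "comb ?e \<in> \<Psi>")
proof -
  let ?t = "coroot h (\<alpha> i)"
  obtain x y where s: "sl2 (\<alpha> i) x y ?t" using \<alpha>_sl2[OF i] by blast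
  have dw: "comb d \<in> weights" using \<Psi>_root[OF d] by (simp add: roots_eq)
  have ct: "comb d ?t = of_int (pr (lin d) i)" by (rule comb_coroot[OF i])
  have eq: "comb ?e = (\<lambda>s. comb d s - comb d ?t * \<alpha> i s)"
    unfolding comb_refl[OF i] ct ..
  then have "comb ?e \<in> weights" using weight_reflection[OF s dw] by simp
  moreover have "comb ?e \<noteq> 0"
  proof
    assume z: "comb ?e = 0"
    have *: "comb d s = comb d ?t * \<alpha> i s" for s
      using fun_cong[OF z, of s] unfolding eq by simp
    have "comb d ?t = 0" using *[of ?t] sl2D(5)[OF s] by simp
    then have "comb d s = 0" for s using *[of s] by simp
    then have "comb d = 0" by (simp add: fun_eq_iff)
    then show False using \<Psi>_root[OF d] by (simp add: roots_eq)
  qed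
  ultimately have "comb ?e \<in> roots h" by (simp add: roots_eq)
  then consider "comb ?e \<in> \<Psi>" | "- comb ?e \<in> \<Psi>" using root_cases by blast
  then show ?thesis
  proof cases
    case 2
    have "comb (\<lambda>k. - ?e k) \<in> \<Psi>"
      using 2 by (simp only: comb_minus)
    then have "- ?e k \<ge> 0" if "k \<in> {1..n}" for k
      using positive_root_coeff[of "\<lambda>k. - ?e k"] that by blast
    then have z: "d k = 0" if "k \<in> {1..n}" "k \<noteq> i" for k
      using that positive_root_coeff[OF d, of k] by fastforce
    have "d i \<ge> 0" by (rule positive_root_coeff[OF d i])
    have "comb d = comb (\<lambda>k. d i * of_bool (k = i))"
      by (rule comb_cong) (use z in auto)
    also have "\<dots> = (\<lambda>s. of_int (d i) * \<alpha> i s)"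
      using comb_refl[OF i, of "\<lambda>_. 0" "- d i"] by (simp add: comb_def)
    finally have cd: "comb d = (\<lambda>s. of_int (d i) * \<alpha> i s)" .
    have "d i \<noteq> 0"
      using cd dw \<Psi>_root[OF d] by (auto simp: roots_eq fun_eq_iff)
    moreover have "d i \<noteq> 1" using cd ne by auto
    ultimately have d2: "d i \<ge> 2" using \<open>d i \<ge> 0\<close> by linarith
    \<comment> \<open>The string going down from \<open>d i\<close> times \<open>\<alpha> i\<close>,
      with \<open>d i\<close> at least 2, reaches twice \<open>\<alpha> i\<close> after
      \<open>d i - 2\<close> steps, and that is not a weight.\<close>
    have "comb d ?t = of_nat (nat (2 * d i))"
      using d2 sl2D(5)[OF s] unfolding cd by simp
    from string_interval_pos[OF s dw this, of "nat (d i - 2)"] d2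
    have "(\<lambda>s. comb d s - of_nat (nat (d i - 2)) * \<alpha> i s) \<in> weights" by simp
    also have "(\<lambda>s. comb d s - of_nat (nat (d i - 2)) * \<alpha> i s) = \<alpha> i + \<alpha> i"
      using d2 unfolding cd by (intro ext) (simp add: algebra_simps)
    finally show ?thesis using double_not_weight[OF s] by blast
  qed
qed

lemma C_diag: "i \<in> {1..n} \<Longrightarrow> C i i = 2"
  using \<alpha>_cartan[of i i] \<alpha>_sl2[of i] sl2D(5) by (metis of_int_eq_numeral_iff)

lemma pr_lin_refl:
  assumes i: "i \<in> {1..n}"
  shows "pr (lin (\<lambda>k. d k - c * of_bool (k = i))) i = pr (lin d) i - 2 * c"
proof -
  have "(of_int (pr (lin (\<lambda>k. d k - c * of_bool (k = i))) i) :: complex) = of_int (pr (lin d) i - 2 * c)"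
    using C_diag[OF i] \<alpha>_cartan[OF i i]
    unfolding comb_coroot[OF i, symmetric] comb_refl[OF i] of_int_diff by simp
  then show ?thesis by (simp only: of_int_eq_iff)
qed

text \<open>Induction on the height: a simple reflection with positive pairing lowers it within
  \<Psi>, the smaller root lies in R by induction, and reflecting back stays in R.\<close>

lemma positive_root_in_R:
  assumes "comb d \<in> \<Psi>" shows "lin d \<in> R"
  using assms
proof (induction "nat (\<Sum>i=1..n. d i)" arbitrary: d rule: less_induct)
  case less
  show ?case
  proof (cases "\<exists>i\<in>{1..n}. comb d = \<alpha> i")
    case True
    then obtain i where i: "i \<in> {1..n}" "comb d = comb (\<lambda>k. of_bool (k = i))"
      by (metis comb_unit)
    then have "lin d = a i" using lin_eq_iff lin_unit by metis
    then show ?thesis using simple_in i by simp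
  next
    case False
    have "comb d \<noteq> 0" using \<Psi>_root[OF less.prems] by (simp add: roots_eq)
    moreover have "comb (\<lambda>_. 0) = 0" by (simp add: comb_def fun_eq_iff)
    ultimately obtain k where "k \<in> {1..n}" "d k \<noteq> 0"
      using comb_cong[of d "\<lambda>_. 0"] by auto
    from positive_pairing[of k d, OF this] obtain i where i: "i \<in> {1..n}" "d i * pr (lin d) i > 0" by blast
    then have pos: "pr (lin d) i > 0"
      using positive_root_coeff[OF less.prems i(1)] by (simp add: zero_less_mult_iff)
    let ?e = "\<lambda>k. d k - pr (lin d) i * of_bool (k = i)"
    have e: "comb ?e \<in> \<Psi>"
      using simple_reflection_positive[OF less.prems i(1)] False i(1) by blast
    have "(\<Sum>k=1..n. ?e k) = (\<Sum>k=1..n. d k) - pr (lin d) i"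
      using i(1) by (simp add: sum_subtractf sum_distrib_left[symmetric] of_bool_def)
    moreover have "(\<Sum>k=1..n. ?e k) \<ge> 0"
      using positive_root_coeff[OF e] by (intro sum_nonneg) blast
    ultimately have "nat (\<Sum>k=1..n. ?e k) < nat (\<Sum>k=1..n. d k)" using pos by linarith
    from less.hyps[OF this e] have eR: "lin ?e \<in> R" .
    have pre: "pr (lin ?e) i = - pr (lin d) i" using pr_lin_refl[OF i(1)] by simp
    \<comment> \<open>The reflected vector pairs negatively with the i-th coroot, whereas
      \<open>a i\<close> pairs to 2; so \<open>refl_in\<close> applies.\<close>
    have "lin ?e \<noteq> a i"
    proof
      assume "lin ?e = a i"
      then have "lin ?e = lin (\<lambda>k. of_bool (k = i))" using lin_unit[OF i(1)] by simp
      then have "comb ?e = comb (\<lambda>k. of_bool (k = i))" by (simp only: lin_eq_iff)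
      then have "comb ?e (coroot h (\<alpha> i)) = \<alpha> i (coroot h (\<alpha> i))" using comb_unit[OF i(1)] by metis
      then have "(of_int (pr (lin ?e) i) :: complex) = of_int 2"
        using C_diag[OF i(1)] \<alpha>_cartan[OF i(1) i(1)] comb_coroot[OF i(1)] by metis
      then have "pr (lin ?e) i = 2" by (simp only: of_int_eq_iff)
      then show False using pre pos by simp
    qed
    from refl_in[OF eR i(1) this]
    have "(\<lambda>k. lin ?e k + pr (lin d) i * a i k) \<in> R" unfolding pre by simp
    then show ?thesis unfolding lin_refl[OF i(1)] by simp
  qed
qed

text \<open>The same descent with the roles of R and \<Psi> exchanged.\<close>

lemma R_positive_root:
  assumes "lin d \<in> R" "\<forall>i. d i \<ge> 0" "\<exists>i\<in>{1..n}. d i \<noteq> 0"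
  shows "comb d \<in> \<Psi>"
  using assms
proof (induction "nat (\<Sum>i=1..n. d i)" arbitrary: d rule: less_induct)
  case less
  show ?case
  proof (cases "\<exists>i\<in>{1..n}. lin d = a i")
    case True
    then obtain i where i: "i \<in> {1..n}" "lin d = lin (\<lambda>k. of_bool (k = i))"
      by (metis lin_unit)
    then have "comb d = \<alpha> i" using comb_unit[OF i(1)] by (simp only: lin_eq_iff)
    then show ?thesis using \<alpha>_positive i by simp
  next
    case False
    obtain k where "k \<in> {1..n}" "d k \<noteq> 0" using less.prems by blast
    from positive_pairing[of k d, OF this] obtain i where i: "i \<in> {1..n}" "d i * pr (lin d) i > 0" by blast
    then have pos: "pr (lin d) i > 0"
      using less.prems(2)[rule_format, of i] by (simp add: zero_less_mult_iff)
    let ?e = "\<lambda>k. d k - pr (lin d) i * of_bool (k = i)"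
    have eR: "lin ?e \<in> R"
      unfolding lin_refl[OF i(1)] using refl_in[OF less.prems(1) i(1)] False i(1) by blast
    \<comment> \<open>The i-th coefficient of \<open>?e\<close> is not known to be nonnegative.
      Membership in R supplies an expansion that is, and by \<open>lin_inj\<close> it has the same
      height.\<close>
    then obtain e where e: "lin ?e = lin e" "\<forall>i. e i \<ge> 0" "\<exists>i\<in>{1..n}. e i \<noteq> 0" using R_lin by blast
    have "(\<Sum>k=1..n. e k) = (\<Sum>k=1..n. ?e k)"
      using lin_inj[OF e(1)] by (intro sum.cong) auto
    also have "\<dots> = (\<Sum>k=1..n. d k) - pr (lin d) i"
      using i(1) by (simp add: sum_subtractf sum_distrib_left[symmetric] of_bool_def)
    finally have "(\<Sum>k=1..n. e k) = (\<Sum>k=1..n. d k) - pr (lin d) i" .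
    moreover have "(\<Sum>k=1..n. e k) \<ge> 0" using e(2) by (intro sum_nonneg) blast
    ultimately have "nat (\<Sum>k=1..n. e k) < nat (\<Sum>k=1..n. d k)" using pos by linarith
    from less.hyps[OF this] have "comb e \<in> \<Psi>" using eR e by simp
    then have e\<Psi>: "comb ?e \<in> \<Psi>" using e(1) by (simp only: lin_eq_iff)
    have pre: "pr (lin ?e) i = - pr (lin d) i" using pr_lin_refl[OF i(1)] by simp
    have "comb ?e \<noteq> \<alpha> i"
    proof
      assume "comb ?e = \<alpha> i"
      then have "(of_int (pr (lin ?e) i) :: complex) = of_int 2"
        using comb_coroot[OF i(1), of ?e] C_diag[OF i(1)] \<alpha>_cartan[OF i(1) i(1)] by simp
      then have "pr (lin ?e) i = 2" by (simp only: of_int_eq_iff)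
      then show False using pre pos by simp
    qed
    from simple_reflection_positive[OF e\<Psi> i(1) this] show ?thesis unfolding pre by simp
  qed
qed

theorem num_ideals_eq_model: "num_ideals h b j = num_upper R (a ` {1..n}) j"
proof -
  \<comment> \<open>Independent of the chosen coefficients by \<open>lin_eq_iff\<close>.\<close>
  define f where "f \<beta> = lin (SOME d. comb d = \<beta>)" for \<beta>
  have f: "f (comb d) = lin d" for d
    unfolding f_def lin_eq_iff by (rule someI[of "\<lambda>e. comb e = comb d" d]) simp
  have bij: "bij_betw f \<Psi> R"
    unfolding bij_betw_def
  proof
    show "inj_on f \<Psi>"
    proof (rule inj_onI)
      fix \<beta> \<gamma> assume *: "\<beta> \<in> \<Psi>" "\<gamma> \<in> \<Psi>" "f \<beta> = f \<gamma>"
      then obtain d e where "\<beta> = comb d" "\<gamma> = comb e" using positive_root_comb by metis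
      then show "\<beta> = \<gamma>" using *(3) by (simp add: f lin_eq_iff)
    qed
    show "f ` \<Psi> = R"
    proof
      show "f ` \<Psi> \<subseteq> R" using positive_root_comb f positive_root_in_R by (metis image_subsetI)
      show "R \<subseteq> f ` \<Psi>"
      proof
        fix v assume "v \<in> R"
        then obtain d where "v = f (comb d)" "comb d \<in> \<Psi>" using R_lin[of v] R_positive_root f by metis
        then show "v \<in> f ` \<Psi>" by blast
      qed
    qed
  qed
  have "num_upper \<Psi> (simple_roots h b) j = num_upper R (f ` simple_roots h b) j"
  proof (rule num_upper_transport[OF bij])
    show "simple_roots h b \<subseteq> \<Psi>" by (auto simp: simple_roots_def)
    fix x y z assume "x \<in> \<Psi>" "y \<in> \<Psi>" "z \<in> \<Psi>"
    then obtain c d e where "x = comb c" "y = comb d" "z = comb e" using positive_root_comb by metis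
    moreover have "lin (\<lambda>k. c k + d k) = lin c + lin d" by (rule ext) (simp add: lin_add)
    ultimately show "x + y = z \<longleftrightarrow> f x + f y = f z"
      using lin_eq_iff[of "\<lambda>k. c k + d k" e] by (simp add: f comb_add)
  qed
  moreover have "f ` simple_roots h b = a ` {1..n}"
  proof -
    have "f (\<alpha> i) = a i" if "i \<in> {1..n}" for i using f comb_unit[OF that] lin_unit[OF that] by metis
    then have "f ` \<alpha> ` {1..n} = a ` {1..n}" unfolding image_image by (rule image_cong[OF refl])
    then show ?thesis using bij_betw_imp_surj_on[OF \<alpha>_bij] by simp
  qed
  ultimately show ?thesis by (simp add: num_ideals_eq_upper_subsets num_upper_def)
qed

end

section \<open>Staircases and ballot sequences\<close>

text \<open>An upward closed set of cells with nonempty rows \<open>1, \<dots>, r\<close> is encoded by the list of its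
  row minima; the entry at position \<open>l\<close> belongs to row \<open>l + 1\<close>, so \<open>l + 2\<close> is its least
  possible value.\<close>

definition ballot :: "nat \<Rightarrow> nat \<Rightarrow> nat \<Rightarrow> nat list set" where
  "ballot r m j = {xs. length xs = r \<and> sorted xs \<and> (\<forall>l<r. l + 2 \<le> xs ! l) \<and>
    (\<forall>x\<in>set xs. x \<le> m) \<and> card {l. l < r \<and> xs ! l = l + 2} = j}"

lemma finite_ballot: "finite (ballot r m j)"
  by (rule finite_subset[OF _ finite_lists_length_eq[of "{..m}" r]]) (auto simp: ballot_def)

lemma ballot_0: "ballot 0 m j = (if j = 0 then {[]} else {})"
  by (auto simp: ballot_def)

lemma ballot_Suc_self: "ballot (Suc r) (Suc r) j = {}"
proof -
  have "\<not> (\<forall>x\<in>set xs. x \<le> Suc r)" if "length xs = Suc r" "\<forall>l<Suc r. l + 2 \<le> xs ! l" for xs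
  proof
    assume "\<forall>x\<in>set xs. x \<le> Suc r"
    then have "xs ! r \<le> Suc r" using that(1) by simp
    moreover have "r + 2 \<le> xs ! r" using that(2) by blast
    ultimately show False by simp
  qed
  then show ?thesis by (auto simp: ballot_def)
qed

lemma snoc_in_ballot_iff:
  assumes "m \<ge> r + 2"
  shows "xs @ [m] \<in> ballot (Suc r) m j \<longleftrightarrow>
    (if m = r + 2 then j > 0 \<and> xs \<in> ballot r m (j - 1) else xs \<in> ballot r m j)"
proof -
  have "{l. l < Suc r \<and> (xs @ [m]) ! l = l + 2} =
      {l. l < r \<and> xs ! l = l + 2} \<union> (if m = r + 2 then {r} else {})" if "length xs = r"
    using that by (auto simp: nth_append less_Suc_eq)
  moreover have "(\<forall>l<Suc r. l + 2 \<le> (xs @ [m]) ! l) \<longleftrightarrow> (\<forall>l<r. l + 2 \<le> xs ! l)" if "length xs = r"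
    using that assms by (auto simp: nth_append less_Suc_eq)
  ultimately show ?thesis
    by (auto simp: ballot_def sorted_append)
qed

text \<open>A sequence either avoids the largest value Suc m or, being sorted, ends in it. That last
  entry has position r and is a contact exactly when Suc m = r + 2.\<close>

lemma ballot_Suc:
  assumes "m \<ge> r + 1"
  shows "ballot (Suc r) (Suc m) j = ballot (Suc r) m j \<union>
    (\<lambda>xs. xs @ [Suc m]) ` (if m = r + 1 then (if j = 0 then {} else ballot r (Suc m) (j - 1))
      else ballot r (Suc m) j)" (is "_ = _ \<union> ?S")
proof
  show "ballot (Suc r) (Suc m) j \<subseteq> ballot (Suc r) m j \<union> ?S"
  proof
    fix ys assume ys: "ys \<in> ballot (Suc r) (Suc m) j"
    show "ys \<in> ballot (Suc r) m j \<union> ?S"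
    proof (cases "\<forall>x\<in>set ys. x \<le> m")
      case True
      then show ?thesis using ys by (auto simp: ballot_def)
    next
      case False
      have "length ys = Suc r" using ys by (simp add: ballot_def)
      then obtain xs x where xs: "ys = xs @ [x]" by (metis append_butlast_last_id length_0_conv nat.distinct(1))
      have "x = Suc m"
        using False ys unfolding xs by (auto simp: ballot_def sorted_append dest: le_antisym)
      then show ?thesis
        using ys snoc_in_ballot_iff[of r "Suc m" xs j] assms unfolding xs by (auto split: if_splits)
    qed
  qed
  have "ballot (Suc r) m j \<subseteq> ballot (Suc r) (Suc m) j"
    by (auto simp: ballot_def)
  then show "ballot (Suc r) m j \<union> ?S \<subseteq> ballot (Suc r) (Suc m) j"
    using snoc_in_ballot_iff[of r "Suc m" _ j] assms by (auto split: if_splits)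
qed

lemma card_ballot_Suc:
  assumes "m \<ge> r + 1"
  shows "card (ballot (Suc r) (Suc m) j) = card (ballot (Suc r) m j) +
    (if m = r + 1 then (if j = 0 then 0 else card (ballot r (Suc m) (j - 1)))
      else card (ballot r (Suc m) j))"
proof -
  let ?T = "if m = r + 1 then (if j = 0 then {} else ballot r (Suc m) (j - 1)) else ballot r (Suc m) j"
  have "inj_on (\<lambda>xs. xs @ [Suc m]) ?T" by (auto intro: inj_onI)
  moreover have "ballot (Suc r) m j \<inter> (\<lambda>xs. xs @ [Suc m]) ` ?T = {}"
    by (auto simp: ballot_def)
  moreover have "finite ?T" by (simp add: finite_ballot)
  ultimately have "card (ballot (Suc r) (Suc m) j) = card (ballot (Suc r) m j) + card ?T"
    unfolding ballot_Suc[OF assms] by (simp add: card_Un_disjoint finite_ballot card_image)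
  then show ?thesis by simp
qed

text \<open>The integer lower index lets Pascal's rule and the difference formula for ballot
  sequences cover the range r < j as well.\<close>

definition ibinom :: "nat \<Rightarrow> int \<Rightarrow> int" where
  "ibinom N m = (if m < 0 then 0 else int (N choose nat m))"

lemma ibinom_Suc: "ibinom (Suc N) m = ibinom N m + ibinom N (m - 1)"
proof (cases "m \<le> 0")
  case False
  then obtain k where "nat m = Suc k" by (metis Suc_pred zero_less_nat_eq not_le)
  then have "m = int (Suc k)" by simp
  then show ?thesis by (simp add: ibinom_def nat_add_distrib)
qed (auto simp: ibinom_def)

lemma ibinom_neg [simp]: "m < 0 \<Longrightarrow> ibinom N m = 0"
  by (simp add: ibinom_def)

lemma ibinom_of_nat [simp]: "ibinom N (int k) = int (N choose k)"
  by (simp add: ibinom_def)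

text \<open>The recursion on the largest value relates (r + 1, k + 1) to (r + 1, k) and (r, k + 2),
  which Pascal's rule matches. Hence an outer induction on r for all k and an inner one on
  k.\<close>

lemma card_ballot:
  assumes "k \<ge> 1" "r \<ge> 1 \<or> k \<ge> 2"
  shows "int (card (ballot r (r + k) j)) =
    ibinom (2 * r + k - 2 - j) (int r - int j) - ibinom (2 * r + k - 2 - j) (int r - int j - 1)"
  using assms
proof (induction r arbitrary: k j)
  case 0
  then show ?case by (simp add: ballot_0 ibinom_def)
next
  case (Suc r)
  note IH = Suc.IH
  from \<open>k \<ge> 1\<close> show ?case
  proof (induction k rule: dec_induct)
    \<comment> \<open>For k = 1 the last entry has a single possible value and is a contact. So
      nothing is left for j = 0, where the two binomials cancel by symmetry, and otherwise the entry
      can be removed.\<close>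
    case base
    show ?case
    proof (cases "j = 0")
      case True
      have "(2 * r + 1) choose (r + 1) = (2 * r + 1) choose r"
        by (subst binomial_symmetric) auto
      then show ?thesis
        using True card_ballot_Suc[of r "Suc r" j] ibinom_of_nat[of "2 * r + 1" "r + 1"]
        by (simp add: ballot_Suc_self)
    next
      case False
      then obtain i where j: "j = Suc i" by (cases j) auto
      have "card (ballot (Suc r) (Suc (Suc r)) j) = card (ballot r (r + 2) i)"
        using card_ballot_Suc[of r "Suc r" j] j by (simp add: ballot_Suc_self)
      then show ?thesis using IH[of 2 i] j by simp
    qed
  next
    case (step k)
    have "card (ballot (Suc r) (Suc r + Suc k) j) =
        card (ballot (Suc r) (Suc r + k) j) + card (ballot r (r + (k + 2)) j)"
      using card_ballot_Suc[of r "Suc r + k" j] step.hyps by simp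
    then have eq: "int (card (ballot (Suc r) (Suc r + Suc k) j)) =
        ibinom (2 * r + k - j) (int r + 1 - int j) - ibinom (2 * r + k - j) (int r - int j) +
        (ibinom (2 * r + k - j) (int r - int j) - ibinom (2 * r + k - j) (int r - int j - 1))"
      using step.IH IH[of "k + 2" j] by (simp add: algebra_simps)
    \<comment> \<open>Natural subtraction: the upper index grows by one only if j \<le> 2r + k.
      Beyond that all lower indices are negative and both sides vanish.\<close>
    show ?case
    proof (cases "j \<le> 2 * r + k")
      case True
      then have "2 * Suc r + Suc k - 2 - j = Suc (2 * r + k - j)" by simp
      then show ?thesis unfolding eq by (simp add: ibinom_Suc algebra_simps)
    next
      case False
      then have "int r + 1 - int j < 0" using step.hyps by linarith
      then show ?thesis unfolding eq by simp
    qed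
  qed
qed

section \<open>Upward closed sets of cells in a staircase\<close>

definition cells :: "nat \<Rightarrow> (nat \<Rightarrow> nat) \<Rightarrow> (nat \<times> nat) set" where
  "cells \<rho> B = {(i, j). 1 \<le> i \<and> i \<le> \<rho> \<and> i < j \<and> j \<le> B i}"

text \<open>Only the elementary moves, one column right or one row up. In row 1 the index i - 1 is
  0, which is no row of \<open>cells\<close>.\<close>

definition up_closed :: "(nat \<times> nat) set \<Rightarrow> (nat \<times> nat) set \<Rightarrow> bool" where
  "up_closed C V \<longleftrightarrow> V \<subseteq> C \<and> (\<forall>i j. (i, j) \<in> V \<longrightarrow>
    ((i, j + 1) \<in> C \<longrightarrow> (i, j + 1) \<in> V) \<and> ((i - 1, j) \<in> C \<longrightarrow> (i - 1, j) \<in> V))"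

definition rows :: "(nat \<times> nat) set \<Rightarrow> nat set" where
  "rows V = fst ` V"

definition corners :: "(nat \<times> nat) set \<Rightarrow> nat" where
  "corners V = card {i. (i, i + 1) \<in> V}"

locale staircase =
  fixes \<rho> :: nat and B :: "nat \<Rightarrow> nat"
  assumes antitone: "1 \<le> i \<Longrightarrow> i \<le> i' \<Longrightarrow> i' \<le> \<rho> \<Longrightarrow> B i' \<le> B i"
begin

abbreviation "C \<equiv> cells \<rho> B"

lemma up_closed_right:
  assumes V: "up_closed C V" and c: "(i, c) \<in> V" "c \<le> d" "d \<le> B i"
  shows "(i, d) \<in> V"
  using c(2,3)
proof (induction d rule: dec_induct)
  case (step d)
  then have "(i, d) \<in> V" by simp
  moreover from this have "(i, d + 1) \<in> C" using V step by (auto simp: up_closed_def cells_def)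
  ultimately show ?case using V by (auto simp: up_closed_def)
qed (rule c)

lemma up_closed_up:
  assumes V: "up_closed C V" and c: "(i, c) \<in> V" "2 \<le> i"
  shows "(i - 1, c) \<in> V"
proof -
  have "(i, c) \<in> C" using V c by (auto simp: up_closed_def)
  then have i: "i \<le> \<rho>" "i < c" "c \<le> B i" by (auto simp: cells_def)
  have "1 \<le> i - 1" using c(2) by simp
  moreover from this i have "B i \<le> B (i - 1)" by (intro antitone) auto
  ultimately have "(i - 1, c) \<in> C" using i by (auto simp: cells_def)
  then show ?thesis using V c by (auto simp: up_closed_def)
qed

lemma finite_cells: "finite C"
proof (rule finite_subset)
  show "C \<subseteq> {1..\<rho>} \<times> {..B 1}" using antitone by (force simp: cells_def)
qed simp

text \<open>Moving up never leaves the staircase, because higher rows reach at least as far to the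
  right.\<close>

lemma rows_initial:
  assumes V: "up_closed C V"
  shows "\<exists>r\<le>\<rho>. rows V = {1..r}"
proof -
  have sub: "rows V \<subseteq> {1..\<rho>}" using V by (auto simp: up_closed_def rows_def cells_def)
  have down: "i - 1 \<in> rows V" if "i \<in> rows V" "2 \<le> i" for i
    using that up_closed_up[OF V] unfolding rows_def by force
  show ?thesis
  proof (cases "rows V = {}")
    case False
    have fin: "finite (rows V)" using sub finite_subset by blast
    define M where "M = Max (rows V)"
    have M: "M \<in> rows V" "\<And>i. i \<in> rows V \<Longrightarrow> i \<le> M" using fin False by (auto simp: M_def)
    have "i \<in> rows V" if "1 \<le> i" "i \<le> M" for i
      using that(2,1)
    proof (induction i rule: inc_induct)
      case (step k)
      then show ?case using down[of "Suc k"] by simp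
    qed (rule M(1))
    then have "{1..M} \<subseteq> rows V" by auto
    moreover have "rows V \<subseteq> {1..M}" using M(2) sub by auto
    ultimately have "rows V = {1..M}" by blast
    moreover have "M \<le> \<rho>" using M(1) sub by auto
    ultimately show ?thesis by blast
  qed auto
qed

definition fillings :: "nat \<Rightarrow> nat \<Rightarrow> (nat \<times> nat) set set" where
  "fillings r j = {V. up_closed C V \<and> rows V = {1..r} \<and> corners V = j}"

definition row_min :: "(nat \<times> nat) set \<Rightarrow> nat \<Rightarrow> nat" where
  "row_min V i = Min {c. (i, c) \<in> V}"

definition fill :: "nat \<Rightarrow> nat list \<Rightarrow> (nat \<times> nat) set" where
  "fill r xs = {(i, c). 1 \<le> i \<and> i \<le> r \<and> xs ! (i - 1) \<le> c \<and> c \<le> B i}"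

lemma row_min:
  assumes V: "up_closed C V" and i: "i \<in> rows V"
  shows "(i, row_min V i) \<in> V" "(i, c) \<in> V \<longleftrightarrow> row_min V i \<le> c \<and> c \<le> B i"
proof -
  have "{c. (i, c) \<in> V} \<subseteq> {..B i}" using V by (auto simp: up_closed_def cells_def)
  then have fin: "finite {c. (i, c) \<in> V}" using finite_subset by blast
  have ne: "{c. (i, c) \<in> V} \<noteq> {}" using i by (auto simp: rows_def)
  show m: "(i, row_min V i) \<in> V" using Min_in[OF fin ne] by (simp add: row_min_def)
  show "(i, c) \<in> V \<longleftrightarrow> row_min V i \<le> c \<and> c \<le> B i"
  proof
    assume "(i, c) \<in> V"
    then show "row_min V i \<le> c \<and> c \<le> B i"
      using fin V by (auto simp: row_min_def up_closed_def cells_def)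
  next
    assume "row_min V i \<le> c \<and> c \<le> B i"
    then show "(i, c) \<in> V" using up_closed_right[OF V m] by blast
  qed
qed

lemma card_Suc_shift: "card {i. 1 \<le> i \<and> i \<le> r \<and> P i} = card {l. l < r \<and> P (Suc l)}"
proof (rule bij_betw_same_card[symmetric])
  show "bij_betw Suc {l. l < r \<and> P (Suc l)} {i. 1 \<le> i \<and> i \<le> r \<and> P i}"
  proof (rule bij_betw_imageI)
    show "Suc ` {l. l < r \<and> P (Suc l)} = {i. 1 \<le> i \<and> i \<le> r \<and> P i}"
    proof (intro equalityI subsetI)
      fix i assume "i \<in> {i. 1 \<le> i \<and> i \<le> r \<and> P i}"
      then show "i \<in> Suc ` {l. l < r \<and> P (Suc l)}" by (intro image_eqI[of _ _ "i - 1"]) auto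
    qed auto
  qed simp
qed

text \<open>Upward closure makes the row minima increase with the row index, while B decreases;
  hence the bound \<open>B r\<close> of the last nonempty row implies the bounds of all
  others.\<close>

lemma card_fillings:
  assumes r: "r \<le> \<rho>"
  shows "card (fillings r j) = card (ballot r (B r) j)"
proof (rule bij_betw_same_card, rule bij_betw_byWitness[where f' = "fill r"])
  let ?f = "\<lambda>V. map (\<lambda>l. row_min V (Suc l)) [0..<r]"
  show "\<forall>V\<in>fillings r j. fill r (?f V) = V"
  proof
    fix V assume "V \<in> fillings r j"
    then have V: "up_closed C V" "rows V = {1..r}" by (auto simp: fillings_def)
    have "(i, c) \<in> fill r (?f V) \<longleftrightarrow> (i, c) \<in> V" for i c
    proof (cases "i \<in> rows V")
      case True
      then show ?thesis using row_min(2)[OF V(1) True, of c] V(2) by (auto simp: fill_def)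
    next
      case False
      then have "(i, c) \<notin> V" by (force simp: rows_def)
      then show ?thesis using False V(2) by (auto simp: fill_def)
    qed
    then show "fill r (?f V) = V" by auto
  qed
  have bal: "i < xs ! (i - 1)" "xs ! (i - 1) \<le> B i" if xs: "xs \<in> ballot r (B r) j" and i: "1 \<le> i" "i \<le> r" for xs i
  proof -
    have l: "i - 1 < r" using i by simp
    then have "(i - 1) + 2 \<le> xs ! (i - 1)" using xs unfolding ballot_def by blast
    then show "i < xs ! (i - 1)" using i by simp
    have "xs ! (i - 1) \<in> set xs" using l xs by (simp add: ballot_def)
    then have "xs ! (i - 1) \<le> B r" using xs by (auto simp: ballot_def)
    then show "xs ! (i - 1) \<le> B i" using antitone[of i r] i r by linarith
  qed
  have min: "row_min (fill r xs) i = xs ! (i - 1)" if "xs \<in> ballot r (B r) j" "1 \<le> i" "i \<le> r" for xs i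
  proof -
    have "{c. (i, c) \<in> fill r xs} = {xs ! (i - 1)..B i}" using that by (auto simp: fill_def)
    then show ?thesis using bal(2)[OF that] unfolding row_min_def
      by (simp add: Min_eq_iff)
  qed
  show "\<forall>xs\<in>ballot r (B r) j. ?f (fill r xs) = xs"
  proof
    fix xs assume xs: "xs \<in> ballot r (B r) j"
    show "?f (fill r xs) = xs"
    proof (rule nth_equalityI)
      show "length (?f (fill r xs)) = length xs" using xs by (simp add: ballot_def)
      show "?f (fill r xs) ! l = xs ! l" if "l < length (?f (fill r xs))" for l
        using that min[OF xs, of "Suc l"] by simp
    qed
  qed
  show "?f ` fillings r j \<subseteq> ballot r (B r) j"
  proof (rule image_subsetI)
    fix V assume "V \<in> fillings r j"
    then have V: "up_closed C V" "rows V = {1..r}" "corners V = j" by (auto simp: fillings_def)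
    have m: "(i, row_min V i) \<in> V" if "1 \<le> i" "i \<le> r" for i
      using row_min(1)[OF V(1)] V(2) that by simp
    have m2: "(i, c) \<in> V \<longleftrightarrow> row_min V i \<le> c \<and> c \<le> B i" if "1 \<le> i" "i \<le> r" for i c
      using row_min(2)[OF V(1)] V(2) that by simp
    have mono: "row_min V i \<le> row_min V (Suc i)" if "1 \<le> i" "Suc i \<le> r" for i
    proof -
      have "(i, row_min V (Suc i)) \<in> V" using up_closed_up[OF V(1) m[of "Suc i"]] that by simp
      then show ?thesis using m2 that by simp
    qed
    have sorted: "sorted (?f V)"
      unfolding sorted_iff_nth_Suc using mono by auto
    have gt: "i < row_min V i" if "1 \<le> i" "i \<le> r" for i
      using m[OF that] V(1) by (auto simp: up_closed_def cells_def)
    have bound: "row_min V (Suc l) \<le> B r" if "l < r" for l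
    proof -
      have "?f V ! l \<le> ?f V ! (r - 1)" using that by (intro sorted_nth_mono[OF sorted]) auto
      then have "row_min V (Suc l) \<le> row_min V r" using that by simp
      also have "\<dots> \<le> B r" using m2[of r "row_min V r"] m[of r] that by simp
      finally show ?thesis .
    qed
    have "{i. (i, i + 1) \<in> V} = {i. 1 \<le> i \<and> i \<le> r \<and> row_min V i = i + 1}"
    proof (intro equalityI subsetI)
      fix i assume "i \<in> {i. (i, i + 1) \<in> V}"
      then have i: "(i, i + 1) \<in> V" by simp
      then have "i \<in> rows V" by (force simp: rows_def)
      then have r: "1 \<le> i" "i \<le> r" using V(2) by auto
      then show "i \<in> {i. 1 \<le> i \<and> i \<le> r \<and> row_min V i = i + 1}"
        using m2[OF r, of "i + 1"] gt[OF r] i by auto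
    next
      fix i assume "i \<in> {i. 1 \<le> i \<and> i \<le> r \<and> row_min V i = i + 1}"
      then show "i \<in> {i. (i, i + 1) \<in> V}" using m[of i] by auto
    qed
    then have "card {l. l < r \<and> row_min V (Suc l) = l + 2} = j"
      using V(3) card_Suc_shift[of r "\<lambda>i. row_min V i = i + 1"] by (simp add: corners_def)
    moreover have "{l. l < r \<and> ?f V ! l = l + 2} = {l. l < r \<and> row_min V (Suc l) = l + 2}" by auto
    ultimately have "card {l. l < r \<and> ?f V ! l = l + 2} = j" by simp
    then show "?f V \<in> ballot r (B r) j"
      unfolding ballot_def mem_Collect_eq using sorted gt bound by (force simp: Suc_le_eq)
  qed
  show "fill r ` ballot r (B r) j \<subseteq> fillings r j"
  proof (rule image_subsetI)
    fix xs assume xs: "xs \<in> ballot r (B r) j"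
    have mono: "xs ! (i - 1 - 1) \<le> xs ! (i - 1)" if "i \<le> r" "1 \<le> i" for i
      using xs that by (auto simp: ballot_def intro: sorted_nth_mono)
    have "fill r xs \<subseteq> C"
      using bal(1)[OF xs] r by (fastforce simp: fill_def cells_def)
    then have "up_closed C (fill r xs)"
      using mono unfolding up_closed_def by (fastforce simp: fill_def cells_def)
    moreover have "rows (fill r xs) = {1..r}"
    proof
      show "{1..r} \<subseteq> rows (fill r xs)"
      proof
        fix i assume "i \<in> {1..r}"
        then have "(i, xs ! (i - 1)) \<in> fill r xs" using bal(2)[OF xs] by (auto simp: fill_def)
        then show "i \<in> rows (fill r xs)" by (force simp: rows_def)
      qed
    qed (auto simp: rows_def fill_def)
    moreover have "corners (fill r xs) = j"
    proof -
      have "{i. (i, i + 1) \<in> fill r xs} = {i. 1 \<le> i \<and> i \<le> r \<and> xs ! (i - 1) = i + 1}"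
        using bal[OF xs] by (fastforce simp: fill_def)
      then show ?thesis
        using xs card_Suc_shift[of r "\<lambda>i. xs ! (i - 1) = i + 1"] by (simp add: corners_def ballot_def)
    qed
    ultimately show "fill r xs \<in> fillings r j" by (simp add: fillings_def)
  qed
qed

lemma up_closed_mono:
  assumes V: "up_closed C V" and c: "(i, j) \<in> V" "(k, l) \<in> C" "k \<le> i" "j \<le> l"
  shows "(k, l) \<in> V"
proof -
  have "1 \<le> k" "l \<le> B k" using c(2) by (auto simp: cells_def)
  have "(k', j) \<in> V" if "k \<le> k'" "k' \<le> i" for k'
    using that(2,1)
  proof (induction k' rule: inc_induct)
    case (step m)
    then show ?case using up_closed_up[OF V, of "Suc m" j] \<open>1 \<le> k\<close> by simp
  qed (rule c(1))
  from up_closed_right[OF V this[OF order_refl c(3)] c(4) \<open>l \<le> B k\<close>] show ?thesis .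
qed

text \<open>The summand \<open>s r\<close> accounts for simple roots off the diagonal whose
  membership depends only on the number of rows; type D needs it for its last simple root.\<close>

theorem card_up_closed:
  "card {V. up_closed C V \<and> (\<exists>r\<le>\<rho>. rows V = {1..r} \<and> corners V + s r = j)} =
    (\<Sum>r\<le>\<rho>. if s r \<le> j then card (ballot r (B r) (j - s r)) else 0)"
proof -
  let ?F = "\<lambda>r. if s r \<le> j then fillings r (j - s r) else {}"
  have "{V. up_closed C V \<and> (\<exists>r\<le>\<rho>. rows V = {1..r} \<and> corners V + s r = j)} =
      (\<Union>r\<in>{..\<rho>}. ?F r)"
    by (auto simp: fillings_def split: if_splits)
  also have "card \<dots> = (\<Sum>r\<le>\<rho>. card (?F r))"
  proof (rule card_UN_disjoint)
    have "?F r \<subseteq> Pow C" for r by (auto simp: fillings_def up_closed_def)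
    then show "\<forall>r\<in>{..\<rho>}. finite (?F r)"
      using finite_cells by (meson finite_Pow_iff finite_subset)
    have eq: "r = r'" if "{1..r} = {1..r'}" for r r' :: nat
      using arg_cong[OF that, of card] by simp
    have rows: "rows V = {1..r}" if "V \<in> ?F r" for V r
      using that by (auto simp: fillings_def split: if_splits)
    show "\<forall>r\<in>{..\<rho>}. \<forall>r'\<in>{..\<rho>}. r \<noteq> r' \<longrightarrow> ?F r \<inter> ?F r' = {}"
    proof (intro ballI impI, rule equals0I)
      fix r r' V assume "r \<noteq> r'" "V \<in> ?F r \<inter> ?F r'"
      then have "{1..r} = {1..r'}" using rows[of V r] rows[of V r'] by simp
      then show False using eq \<open>r \<noteq> r'\<close> by blast
    qed
  qed simp
  also have "\<dots> = (\<Sum>r\<le>\<rho>. if s r \<le> j then card (ballot r (B r) (j - s r)) else 0)"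
    using card_fillings by (intro sum.cong) auto
  finally show ?thesis .
qed

corollary card_up_closed_corners:
  "card {V. up_closed C V \<and> corners V = j} = (\<Sum>r\<le>\<rho>. card (ballot r (B r) j))"
proof -
  have "{V. up_closed C V \<and> corners V = j} =
      {V. up_closed C V \<and> (\<exists>r\<le>\<rho>. rows V = {1..r} \<and> corners V + 0 = j)}"
    using rows_initial by auto
  then show ?thesis using card_up_closed[of "\<lambda>_. 0" j] by simp
qed

end

section \<open>Summation over the number of rows\<close>

lemma sum_ballot_const:
  assumes "r + 1 \<le> m"
  shows "(\<Sum>i\<le>r. card (ballot i m j)) = card (ballot r (Suc m) j)"
  using assms
proof (induction r)
  case (Suc r)
  then show ?case using card_ballot_Suc[of r m j] by simp
qed (simp add: ballot_0)

text \<open>Row r has k = M - 2r columns, so the upper index 2r + k - 2 - j = M - 2 - j is the same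
  for all r and the differences telescope.\<close>

lemma sum_ballot_diagonal:
  assumes "2 * R + 1 \<le> M" "2 \<le> M"
  shows "int (\<Sum>r\<le>R. card (ballot r (M - r) j)) = ibinom (M - 2 - j) (int R - int j)"
proof -
  have "int (card (ballot r (M - r) j)) =
      ibinom (M - 2 - j) (int r - int j) - ibinom (M - 2 - j) (int r - int j - 1)" if "r \<le> R" for r
  proof -
    have "r + (M - 2 * r) = M - r" "2 * r + (M - 2 * r) - 2 - j = M - 2 - j" using that assms by auto
    moreover have "1 \<le> M - 2 * r" "1 \<le> r \<or> 2 \<le> M - 2 * r" using that assms by auto
    ultimately show ?thesis using card_ballot[of "M - 2 * r" r j] by simp
  qed
  then have "int (\<Sum>r\<le>R. card (ballot r (M - r) j)) =
      (\<Sum>r\<le>R. ibinom (M - 2 - j) (int r - int j) - ibinom (M - 2 - j) (int r - int j - 1))"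
    by simp
  also have "\<dots> = ibinom (M - 2 - j) (int R - int j)"
    by (induction R) (auto simp: ibinom_def)
  finally show ?thesis .
qed

lemma sum_ballot_A:
  assumes "j \<le> n"
  shows "real (\<Sum>r\<le>n. card (ballot r (n + 1) j)) = (real j + 1) / (real n + 1) * real ((2 * n - j) choose n)"
proof -
  let ?N = "2 * n - j"
  have "int (\<Sum>r\<le>n. card (ballot r (n + 1) j)) = int (card (ballot n (n + 2) j))"
    by (subst sum_ballot_const) simp_all
  also have "\<dots> = ibinom ?N (int n - int j) - ibinom ?N (int n - int j - 1)"
    using card_ballot[of 2 n j] by simp
  also have "ibinom ?N (int n - int j) = int (?N choose n)"
  proof -
    have "?N choose (n - j) = ?N choose n"
      using assms by (subst binomial_symmetric) auto
    then show ?thesis using assms by (simp add: ibinom_def nat_diff_distrib)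
  qed
  also have "ibinom ?N (int n - int j - 1) = int (?N choose (n + 1))"
  proof (cases "j = n")
    case False
    then have "?N choose (n - j - 1) = ?N choose (n + 1)"
      using assms by (subst binomial_symmetric) auto
    moreover have "nat (int n - int j - 1) = n - j - 1" by simp
    ultimately show ?thesis using False assms by (simp add: ibinom_def)
  qed simp
  finally have "real (\<Sum>r\<le>n. card (ballot r (n + 1) j)) = real (?N choose n) - real (?N choose (n + 1))"
    by linarith
  \<comment> \<open>Absorption with N - n = n - j. It turns the difference of the two binomials into
    the factor (j + 1) / (n + 1).\<close>
  moreover have "(n + 1) * (?N choose (n + 1)) = (n - j) * (?N choose n)"
    using binomial_absorption[of n ?N] binomial_absorb_comp[of ?N n] assms by simp
  then have "(real n + 1) * real (?N choose (n + 1)) = (real n - real j) * real (?N choose n)"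
    using assms by (metis of_nat_1 of_nat_add of_nat_diff of_nat_mult)
  ultimately have "(real n + 1) * real (\<Sum>r\<le>n. card (ballot r (n + 1) j)) =
      (real j + 1) * real (?N choose n)"
    by (simp only: right_diff_distrib) (simp add: algebra_simps)
  then show ?thesis by (simp add: field_simps)
qed

lemma sum_ballot_C:
  assumes "1 \<le> n" "j \<le> n"
  shows "(\<Sum>r\<le>n. card (ballot r (2 * n + 1 - r) j)) = (2 * n - j - 1) choose (n - 1)"
proof -
  have "int (\<Sum>r\<le>n. card (ballot r (2 * n + 1 - r) j)) = ibinom (2 * n - j - 1) (int n - int j)"
    using sum_ballot_diagonal[of n "2 * n + 1" j] assms by simp
  also have "\<dots> = int ((2 * n - j - 1) choose (n - j))"
    using assms by (simp add: ibinom_def nat_diff_distrib)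
  also have "(2 * n - j - 1) choose (n - j) = (2 * n - j - 1) choose (n - 1)"
    using assms by (subst binomial_symmetric) auto
  finally show ?thesis by linarith
qed

text \<open>Rows up to n - 2 telescope. A filling with all n - 1 rows contains one further simple
  root, so its diagonal contacts number j - 1; such fillings are absent for j = 0, whence the case
  distinction.\<close>

lemma sum_ballot_D:
  fixes n j :: nat
  assumes n: "4 \<le> n" and j: "j \<le> n"
  defines "T \<equiv> (\<Sum>r\<le>n - 1. if of_bool (r = n - 1) \<le> j then card (ballot r (2 * n - r) (j - of_bool (r = n - 1))) else 0)"
    and "E \<equiv> (\<Sum>r\<le>n - 1. if of_bool (r = n - 1) \<le> j then card (ballot r (2 * n - 1 - r) (j - of_bool (r = n - 1))) else 0)"
  shows "2 * T - E = (if j = 0 then ((2 * n - 2) choose (n - 2)) + ((2 * n - 3) choose (n - 3))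
    else ((2 * n - 2 - j) choose (n - 2)) + ((2 * n - 3 - j) choose (n - 2)))"
proof -
  have split: "(\<Sum>r\<le>n - 1. f r) = (\<Sum>r\<le>n - 2. f r) + f (n - 1)" for f :: "nat \<Rightarrow> nat"
  proof -
    have "n - 1 = Suc (n - 2)" using n by simp
    then show ?thesis by simp
  qed
  have T: "int T = ibinom (2 * n - 2 - j) (int n - 2 - int j) +
      (if j = 0 then 0 else int (card (ballot (n - 1) (n + 1) (j - 1))))"
  proof -
    have "(\<Sum>r\<le>n - 2. if of_bool (r = n - 1) \<le> j then card (ballot r (2 * n - r) (j - of_bool (r = n - 1))) else 0)
      = (\<Sum>r\<le>n - 2. card (ballot r (2 * n - r) j))"
      using n by (intro sum.cong) auto
    moreover have "2 * n - (n - 1) = n + 1" using n by simp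
    ultimately show ?thesis
      using sum_ballot_diagonal[of "n - 2" "2 * n" j] n unfolding T_def split by (simp add: of_nat_diff)
  qed
  have E: "int E = ibinom (2 * n - 3 - j) (int n - 2 - int j) +
      (if j = 0 then 0 else int (card (ballot (n - 1) n (j - 1))))"
  proof -
    have "(\<Sum>r\<le>n - 2. if of_bool (r = n - 1) \<le> j then card (ballot r (2 * n - 1 - r) (j - of_bool (r = n - 1))) else 0)
      = (\<Sum>r\<le>n - 2. card (ballot r (2 * n - 1 - r) j))"
      using n by (intro sum.cong) auto
    moreover have "2 * n - 1 - (n - 1) = n" "2 * n - 1 - 2 - j = 2 * n - 3 - j" using n by auto
    ultimately show ?thesis
      using sum_ballot_diagonal[of "n - 2" "2 * n - 1" j] n unfolding E_def split by (simp add: of_nat_diff)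
  qed
  show ?thesis
  proof (cases "j = 0")
    case True
    have "int T = int ((2 * n - 2) choose (n - 2))" "int E = int ((2 * n - 3) choose (n - 2))"
      using T E True n ibinom_of_nat[of _ "n - 2"] by (simp_all add: of_nat_diff)
    moreover have "(2 * n - 2) choose (n - 2) = ((2 * n - 3) choose (n - 3)) + ((2 * n - 3) choose (n - 2))"
    proof -
      have "2 * n - 2 = Suc (2 * n - 3)" "n - 2 = Suc (n - 3)" using n by auto
      then show ?thesis by (simp only: binomial_Suc_Suc)
    qed
    ultimately have "2 * T - E = ((2 * n - 2) choose (n - 2)) + ((2 * n - 3) choose (n - 3))"
      by linarith
    then show ?thesis using True by simp
  next
    case False
    define N where "N = 2 * n - 3 - j"
    have N: "2 * n - 2 - j = Suc N" "2 * n - 1 - j = Suc (Suc N)" "2 * n - 3 - j = N"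
      using n j by (auto simp: N_def)
    have "int (card (ballot (n - 1) (n + 1) (j - 1))) =
        ibinom (Suc (Suc N)) (int n - int j) - ibinom (Suc (Suc N)) (int n - int j - 1)"
    proof -
      have "n - 1 + 2 = n + 1" "2 * (n - 1) + 2 - 2 - (j - 1) = Suc (Suc N)" using n j False N by auto
      then show ?thesis using card_ballot[of 2 "n - 1" "j - 1"] n False by (simp add: of_nat_diff)
    qed
    then have T': "int T = ibinom (Suc N) (int n - int j)"
      using T False N by (simp add: ibinom_Suc algebra_simps)
    have "int (card (ballot (n - 1) n (j - 1))) =
        ibinom (Suc N) (int n - int j) - ibinom (Suc N) (int n - int j - 1)"
    proof -
      have "n - 1 + 1 = n" "2 * (n - 1) + 1 - 2 - (j - 1) = Suc N" using n j False N by auto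
      then show ?thesis using card_ballot[of 1 "n - 1" "j - 1"] n False by (simp add: of_nat_diff)
    qed
    then have E': "int E = ibinom (Suc N) (int n - int j) - ibinom N (int n - int j - 1)"
      using E False N ibinom_Suc[of N "int n - int j - 1"] by (simp add: algebra_simps)
    have "ibinom (Suc N) (int n - int j) = int (Suc N choose (n - 2))"
    proof -
      have "Suc N choose (n - j) = Suc N choose (n - 2)"
        using n j N by (subst binomial_symmetric) (auto simp: N_def)
      then show ?thesis using j by (simp add: ibinom_def nat_diff_distrib)
    qed
    moreover have "ibinom N (int n - int j - 1) = int (N choose (n - 2))"
    proof (cases "j = n")
      case True
      then show ?thesis using n by (simp add: N_def)
    next
      case False
      then have "N choose (n - j - 1) = N choose (n - 2)"
        using n j by (subst binomial_symmetric) (auto simp: N_def)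
      moreover have "nat (int n - int j - 1) = n - j - 1" by simp
      ultimately show ?thesis using False j by (simp add: ibinom_def)
    qed
    ultimately have "int (2 * T - E) = int ((Suc N choose (n - 2)) + (N choose (n - 2)))"
      using T' E' by linarith
    then show ?thesis using False N by simp
  qed
qed

section \<open>The classical root systems\<close>

text \<open>The index \<open>L + 1 - p\<close> is the mirror image of \<open>p\<close>: in the coordinates up to \<open>L / 2\<close>
  the vector \<open>ev L p\<close> is \<open>\<epsilon>\<^sub>p\<close> for \<open>p \<le> L / 2\<close>, minus \<open>\<epsilon>\<close> at the mirror index in the
  upper half, and \<open>0\<close> in the middle for odd \<open>L\<close>. The positive roots of all four types thus become
  differences with \<open>p < q\<close>: \<open>L = 2 * n + 1\<close> for \<open>B\<^sub>n\<close> and \<open>L = 2 * n\<close> for \<open>C\<^sub>n\<close> and \<open>D\<^sub>n\<close>.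
  Type \<open>A\<^sub>n\<close> uses only the lower half of \<open>L = 2 * n + 2\<close>.\<close>

definition ev :: "nat \<Rightarrow> nat \<Rightarrow> nat \<Rightarrow> int" where
  "ev L p k = of_bool (k = p) - of_bool (k + p = L + 1)"

definition rt :: "nat \<Rightarrow> nat \<Rightarrow> nat \<Rightarrow> nat \<Rightarrow> int" where
  "rt L p q = (\<lambda>k. ev L p k - ev L q k)"

text \<open>The reflection in \<epsilon>(i) - \<epsilon>(i+1), acting on indices: it exchanges i
  with i + 1 and likewise their mirror images.\<close>

definition chain_perm :: "nat \<Rightarrow> nat \<Rightarrow> nat \<Rightarrow> nat" where
  "chain_perm L i p = (if p = i then i + 1 else if p = i + 1 then i
    else if p = L + 1 - i then L - i else if p = L - i then L + 1 - i else p)"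

lemma ev_flip: "1 \<le> p \<Longrightarrow> p \<le> L \<Longrightarrow> ev L (L + 1 - p) k = - ev L p k"
  by (auto simp: ev_def)

lemma rt_flip: "1 \<le> p \<Longrightarrow> p \<le> L \<Longrightarrow> 1 \<le> q \<Longrightarrow> q \<le> L \<Longrightarrow> rt L (L + 1 - q) (L + 1 - p) = rt L p q"
  unfolding rt_def by (rule ext) (simp only: ev_flip minus_diff_minus minus_diff_eq)

lemma chain_refl_ev:
  assumes "1 \<le> i" "2 * (i + 1) \<le> L" "1 \<le> p" "p \<le> L"
  shows "ev L p k - (ev L p i - ev L p (i + 1)) * rt L i (i + 1) k = ev L (chain_perm L i p) k"
proof -
  have flip: "ev L (L + 1 - i) k = - ev L i k" "ev L (L - i) k = - ev L (i + 1) k" for k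
    using ev_flip[of i L k] ev_flip[of "i + 1" L k] assms by auto
  have own: "ev L i i = 1" "ev L i (i + 1) = 0" "ev L (i + 1) i = 0" "ev L (i + 1) (i + 1) = 1"
    using assms by (auto simp: ev_def)
  have ne: "i + 1 < L - i" using assms by (simp add: less_diff_conv)
  consider "p = i" | "p = i + 1" | "p = L + 1 - i" | "p = L - i"
    | "p \<noteq> i" "p \<noteq> i + 1" "p \<noteq> L + 1 - i" "p \<noteq> L - i"
    by blast
  then show ?thesis
  proof cases
    case 1
    then show ?thesis by (simp add: rt_def chain_perm_def own[simplified])
  next
    case 2
    then show ?thesis by (simp add: rt_def chain_perm_def own[simplified])
  next
    case 3
    moreover have "L + 1 - i \<noteq> i" "L + 1 - i \<noteq> i + 1" using assms by arith+
    ultimately have "chain_perm L i p = L - i" by (simp add: chain_perm_def)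
    then show ?thesis using 3 by (simp only: flip own rt_def) simp
  next
    case 4
    then have "chain_perm L i p = L + 1 - i" using ne by (simp add: chain_perm_def)
    then show ?thesis using 4 by (simp only: flip own rt_def) simp
  next
    case 5
    then have "chain_perm L i p = p" "ev L p i = 0" "ev L p (i + 1) = 0"
      using assms by (auto simp: chain_perm_def ev_def)
    then show ?thesis by simp
  qed
qed

lemma chain_refl_rt:
  assumes "1 \<le> i" "2 * (i + 1) \<le> L" "1 \<le> p" "p \<le> L" "1 \<le> q" "q \<le> L"
  shows "(\<lambda>k. rt L p q k - (rt L p q i - rt L p q (i + 1)) * rt L i (i + 1) k) =
    rt L (chain_perm L i p) (chain_perm L i q)"
proof
  fix k
  show "rt L p q k - (rt L p q i - rt L p q (i + 1)) * rt L i (i + 1) k =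
    rt L (chain_perm L i p) (chain_perm L i q) k"
    using chain_refl_ev[of i L p k] chain_refl_ev[of i L q k] assms
    by (simp add: rt_def[of L p q] rt_def[of L "chain_perm L i p"] algebra_simps)
qed

text \<open>Only two pairs are put out of order, (i, i + 1) and its mirror image, and both represent
  the excluded simple root. The permutation commutes with mirroring, hence the last claim.\<close>

lemma chain_perm_pair:
  assumes "1 \<le> i" "2 * (i + 1) \<le> L" "1 \<le> p" "p < q" "q \<le> L"
    and "rt L p q \<noteq> rt L i (i + 1)"
  shows "1 \<le> chain_perm L i p" "chain_perm L i p < chain_perm L i q" "chain_perm L i q \<le> L"
    "chain_perm L i p + chain_perm L i q = L + 1 \<longleftrightarrow> p + q = L + 1"
proof -
  have 1: "\<not> (p = i \<and> q = i + 1)" using assms by auto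
  have 2: "\<not> (p = L - i \<and> q = L + 1 - i)"
    using assms rt_flip[of i L "i + 1"] by auto
  define j where "j = L - i"
  have L: "L = i + j" "i + 2 \<le> j" using assms by (auto simp: j_def)
  have perm: "chain_perm L i r = (if r = i then i + 1 else if r = i + 1 then i
    else if r = j + 1 then j else if r = j then j + 1 else r)" for r
    by (simp add: chain_perm_def L(1))
  have 3: "\<not> (p = j \<and> q = j + 1)" using 2 by (simp add: L(1))
  show "1 \<le> chain_perm L i p"
    using assms(1,3) L(2) unfolding perm by auto
  show "chain_perm L i p < chain_perm L i q"
    using assms(1,3,4) 1 3 L unfolding perm by (auto split: if_splits)
  show "chain_perm L i q \<le> L"
    using assms(1,5) L unfolding perm by (auto split: if_splits)
  show "chain_perm L i p + chain_perm L i q = L + 1 \<longleftrightarrow> p + q = L + 1"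
    using assms(1,3,4) 1 3 L unfolding perm by (auto split: if_splits)
qed

lemma rt_add: "rt L i j + rt L j k = rt L i k"
  by (rule ext) (simp add: rt_def)

lemma rt_chain_cone:
  assumes "p < q" and step: "\<And>k. p \<le> k \<Longrightarrow> k < q \<Longrightarrow> rt L k (k + 1) \<in> cone S"
  shows "rt L p q \<in> cone S"
proof -
  have "p + 1 \<le> q" using assms(1) by simp
  then show ?thesis using step
  proof (induction q rule: dec_induct)
    case (step q)
    then have "rt L p q + rt L q (q + 1) \<in> cone S" by (intro cone_add) auto
    then show ?case by (simp add: rt_add)
  qed simp
qed

text \<open>A step in the upper half equals its mirror image in the lower half.\<close>

lemma rt_step_mem:
  assumes "1 \<le> k" "k < L" "k \<le> m \<or> L - k \<le> m"
  shows "rt L k (k + 1) \<in> (\<lambda>i. rt L i (i + 1)) ` {1..m}"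
proof (cases "k \<le> m")
  case False
  have "rt L k (k + 1) = rt L (L - k) (L - k + 1)"
    using rt_flip[of k L "k + 1"] assms by (simp add: Suc_diff_le)
  then show ?thesis using False assms by (intro image_eqI[of _ _ "L - k"]) auto
qed (use assms in auto)

lemma sum_ev:
  assumes "1 \<le> p" "p \<le> N" "2 * N \<le> L"
  shows "(\<Sum>k=1..N. v k * ev L p k) = v p"
proof -
  have "(\<Sum>k=1..N. v k * ev L p k) = (\<Sum>k=1..N. if k = p then v k else 0)"
    by (rule sum.cong) (use assms in \<open>auto simp: ev_def\<close>)
  then show ?thesis using assms by simp
qed

text \<open>The bound m may be smaller than n, since in type D only the first n - 2 columns are
  triangular.\<close>

lemma triangular_zero:
  fixes a :: "nat \<Rightarrow> nat \<Rightarrow> int"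
  assumes tri: "\<And>k i. 1 \<le> k \<Longrightarrow> k \<le> m \<Longrightarrow> k < i \<Longrightarrow> i \<le> n \<Longrightarrow> a i k = 0"
    and diag: "\<And>k. 1 \<le> k \<Longrightarrow> k \<le> m \<Longrightarrow> a k k \<noteq> 0"
    and zero: "\<And>k. 1 \<le> k \<Longrightarrow> k \<le> m \<Longrightarrow> (\<Sum>i=1..n. d i * a i k) = 0"
    and "m \<le> n"
  shows "1 \<le> k \<Longrightarrow> k \<le> m \<Longrightarrow> d k = 0"
proof (induction k rule: less_induct)
  case (less k)
  have "(\<Sum>i=1..n. d i * a i k) = (\<Sum>i=1..n. if i = k then d k * a k k else 0)"
  proof (rule sum.cong)
    fix i assume "i \<in> {1..n}"
    then show "d i * a i k = (if i = k then d k * a k k else 0)"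
      using less tri[of k i] by (cases i k rule: linorder_cases) auto
  qed simp
  then have "d k * a k k = 0" using zero[of k] less.prems \<open>m \<le> n\<close> by simp
  then show ?case using diag less.prems by simp
qed

section \<open>Models for the four classical types\<close>

definition roots_A :: "nat \<Rightarrow> (nat \<Rightarrow> int) set" where
  "roots_A n = {rt (2 * n + 2) p q | p q. 1 \<le> p \<and> p < q \<and> q \<le> n + 1}"

text \<open>A pair with p + q = L + 1 gives 2\<epsilon>(p): a long root for even L (type C), but no
  root for odd L (type B), where the middle index n + 1 yields the short roots \<epsilon>(p)
  instead.\<close>

definition roots_BC :: "nat \<Rightarrow> (nat \<Rightarrow> int) set" where
  "roots_BC L = {rt L p q | p q. 1 \<le> p \<and> p < q \<and> q \<le> L \<and> (odd L \<longrightarrow> p + q \<noteq> L + 1)}"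

definition roots_D :: "nat \<Rightarrow> (nat \<Rightarrow> int) set" where
  "roots_D n = {rt (2 * n) p q | p q. 1 \<le> p \<and> p < q \<and> q \<le> 2 * n \<and> p + q \<noteq> 2 * n + 1}"

text \<open>The index n + 1 mirrors n, so the last simple root is \<epsilon>(n-1) +
  \<epsilon>(n).\<close>

definition simple_D :: "nat \<Rightarrow> nat \<Rightarrow> nat \<Rightarrow> int" where
  "simple_D n i = (if i = n then rt (2 * n) (n - 1) (n + 1) else rt (2 * n) i (i + 1))"

definition pr_A :: "(nat \<Rightarrow> int) \<Rightarrow> nat \<Rightarrow> int" where
  "pr_A v i = v i - v (i + 1)"

text \<open>The last simple root is \<epsilon>(n) with coroot 2\<epsilon>(n) for odd L, and
  2\<epsilon>(n) with coroot \<epsilon>(n) for even L.\<close>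

definition pr_BC :: "nat \<Rightarrow> nat \<Rightarrow> (nat \<Rightarrow> int) \<Rightarrow> nat \<Rightarrow> int" where
  "pr_BC L n v i = (if i = n then (if odd L then 2 else 1) * v n else v i - v (i + 1))"

definition pr_D :: "nat \<Rightarrow> (nat \<Rightarrow> int) \<Rightarrow> nat \<Rightarrow> int" where
  "pr_D n v i = (if i = n then v (n - 1) + v n else v i - v (i + 1))"

lemma root_model_A:
  assumes n: "1 \<le> n"
  shows "root_model n (n + 1) (\<lambda>i. rt (2 * n + 2) i (i + 1)) pr_A (\<lambda>_. 2) (roots_A n) (cartan_matrix Type_A n)"
proof
  let ?L = "2 * n + 2" and ?a = "\<lambda>i. rt (2 * n + 2) i (i + 1)"
  show "pr_A (\<lambda>k. \<Sum>i=1..n. d i * ?a i k) j = (\<Sum>i=1..n. d i * cartan_matrix Type_A n i j)"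
    if "j \<in> {1..n}" for d j
    unfolding pr_A_def sum_subtractf[symmetric]
    by (rule sum.cong) (use that in \<open>auto simp: rt_def ev_def chain_matrix_def\<close>)
  show "2 * (\<Sum>k=1..n + 1. v k * ?a j k) = 2 * pr_A v j" if "j \<in> {1..n}" for j v
    using that sum_ev[of _ "n + 1" ?L v]
    by (simp add: rt_def pr_A_def right_diff_distrib sum_subtractf del: sum.cl_ivl_Suc)
  show "d i = 0" if z: "\<And>k. k \<in> {1..n + 1} \<Longrightarrow> (\<Sum>i=1..n. d i * ?a i k) = 0" and "i \<in> {1..n}" for d i
    by (rule triangular_zero[of n n ?a])
      (use that in \<open>auto simp: rt_def ev_def\<close>)
  show "?a i \<in> roots_A n" if "i \<in> {1..n}" for i
    unfolding roots_A_def using that by fastforce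
  show "(\<lambda>k. v k - pr_A v i * ?a i k) \<in> roots_A n"
    if v: "v \<in> roots_A n" and i: "i \<in> {1..n}" and ne: "v \<noteq> ?a i" for v i
  proof -
    obtain p q where pq: "v = rt ?L p q" "1 \<le> p" "p < q" "q \<le> n + 1" using v by (auto simp: roots_A_def)
    have "chain_perm ?L i q \<le> n + 1" using pq i by (auto simp: chain_perm_def)
    moreover have "(\<lambda>k. v k - pr_A v i * ?a i k) = rt ?L (chain_perm ?L i p) (chain_perm ?L i q)"
      unfolding pr_A_def pq(1) using pq i by (intro chain_refl_rt) auto
    ultimately show ?thesis
      using chain_perm_pair[of i ?L p q] pq i ne unfolding roots_A_def by auto
  qed
  show "roots_A n \<subseteq> cone (?a ` {1..n})"
  proof -
    have "rt ?L p q \<in> cone (?a ` {1..n})" if "1 \<le> p" "p < q" "q \<le> n + 1" for p q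
      by (rule rt_chain_cone[OF that(2)], rule cone_base) (use that in auto)
    then show ?thesis unfolding roots_A_def by blast
  qed
qed simp_all

text \<open>The reflection in the last simple root of types B and C, that is, the sign change of
  \<epsilon>(n).\<close>

definition mid_swap :: "nat \<Rightarrow> nat \<Rightarrow> nat \<Rightarrow> nat" where
  "mid_swap L n p = (if p = n then L + 1 - n else if p = L + 1 - n then n else p)"

lemma root_model_BC:
  assumes n: "2 \<le> n" and LX: "L = 2 * n + 1 \<and> X = Type_B \<or> L = 2 * n \<and> X = Type_C"
  shows "root_model n n (\<lambda>i. rt L i (i + 1)) (pr_BC L n) (\<lambda>i. if i < n then 2 else if odd L then 1 else 4)
    (roots_BC L) (cartan_matrix X n)"
proof
  let ?a = "\<lambda>i. rt L i (i + 1)"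
  let ?c = "if odd L then 1 else 2 :: int" and ?c' = "if odd L then 2 else 1 :: int"
  have L: "2 * n \<le> L" "n < L" using LX n by auto
  have a_n: "?a n k = ?c * ev L n k" for k
    using LX by (auto simp: rt_def ev_def)
  show "pr_BC L n (\<lambda>k. \<Sum>i=1..n. d i * ?a i k) j = (\<Sum>i=1..n. d i * cartan_matrix X n i j)"
    if "j \<in> {1..n}" for d j
  proof (cases "j = n")
    case True
    have "(\<Sum>i=1..n. ?c' * (d i * ?a i n)) = (\<Sum>i=1..n. d i * cartan_matrix X n i j)"
      by (rule sum.cong) (use True n LX in \<open>auto simp: rt_def ev_def chain_matrix_def\<close>)
    then show ?thesis using True by (simp add: pr_BC_def sum_distrib_left)
  next
    case False
    then have "pr_BC L n (\<lambda>k. \<Sum>i=1..n. d i * ?a i k) j = (\<Sum>i=1..n. d i * ?a i j - d i * ?a i (j + 1))"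
      by (simp add: pr_BC_def sum_subtractf)
    also have "\<dots> = (\<Sum>i=1..n. d i * cartan_matrix X n i j)"
      by (rule sum.cong) (use False that LX in \<open>auto simp: rt_def ev_def chain_matrix_def\<close>)
    finally show ?thesis .
  qed
  show "2 * (\<Sum>k=1..n. v k * ?a j k) = (if j < n then 2 else if odd L then 1 else 4) * pr_BC L n v j"
    if "j \<in> {1..n}" for j v
  proof (cases "j = n")
    case True
    have "(\<Sum>k=1..n. v k * ?a n k) = ?c * (\<Sum>k=1..n. v k * ev L n k)"
      unfolding a_n by (simp add: sum_distrib_left ac_simps)
    then show ?thesis using True n L sum_ev[of n n L v] by (simp add: pr_BC_def)
  next
    case False
    then show ?thesis using that L sum_ev[of _ n L v]
      by (simp add: rt_def pr_BC_def right_diff_distrib sum_subtractf)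
  qed
  show "d i = 0" if z: "\<And>k. k \<in> {1..n} \<Longrightarrow> (\<Sum>i=1..n. d i * ?a i k) = 0" and "i \<in> {1..n}" for d i
    by (rule triangular_zero[of n n ?a]) (use that L in \<open>auto simp: rt_def ev_def\<close>)
  have in_R: "rt L p q \<in> roots_BC L" if "1 \<le> p" "p < q" "q \<le> L" "odd L \<longrightarrow> p + q \<noteq> L + 1" for p q
    unfolding roots_BC_def using that by blast
  show "?a i \<in> roots_BC L" if "i \<in> {1..n}" for i
    using that L LX by (intro in_R) (auto, presburger)
  have chain: "(\<lambda>k. rt L p q k - pr_BC L n (rt L p q) i * ?a i k) = rt L (chain_perm L i p) (chain_perm L i q)"
    if "1 \<le> i" "i < n" "1 \<le> p" "p < q" "q \<le> L" for i p q
    using chain_refl_rt[of i L p q] that L by (simp add: pr_BC_def)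
  have mid_ev: "ev L p k - 2 * ev L p n * ev L n k = ev L (mid_swap L n p) k" if "1 \<le> p" "p \<le> L" for p k
  proof -
    have *: "ev L (L + 1 - n) k = - ev L n k" for k using ev_flip[of n L k] n L by simp
    have own: "ev L n n = 1" using L by (simp add: ev_def)
    consider "p = n" | "p = L + 1 - n" "p \<noteq> n" | "p \<noteq> n" "p \<noteq> L + 1 - n" by blast
    then show ?thesis
    proof cases
      case 1
      then have "mid_swap L n p = L + 1 - n" by (simp add: mid_swap_def)
      then show ?thesis by (simp only: 1 own *)
    next
      case 2
      then have "mid_swap L n p = n" by (simp add: mid_swap_def)
      then show ?thesis by (simp only: 2 own *)
    next
      case 3
      then have "ev L p n = 0" by (auto simp: ev_def)
      then show ?thesis using 3 by (simp add: mid_swap_def)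
    qed
  qed
  have last: "(\<lambda>k. rt L p q k - pr_BC L n (rt L p q) n * ?a n k) = rt L (mid_swap L n p) (mid_swap L n q)"
    if "1 \<le> p" "p < q" "q \<le> L" for p q
  proof
    fix k
    have "pr_BC L n (rt L p q) n * ?a n k = 2 * rt L p q n * ev L n k"
      unfolding a_n by (simp add: pr_BC_def)
    then show "rt L p q k - pr_BC L n (rt L p q) n * ?a n k = rt L (mid_swap L n p) (mid_swap L n q) k"
      using mid_ev[of p k] mid_ev[of q k] that
      by (simp add: rt_def[of _ p] rt_def[of _ "mid_swap L n p"] algebra_simps)
  qed
  show "(\<lambda>k. v k - pr_BC L n v i * ?a i k) \<in> roots_BC L"
    if v: "v \<in> roots_BC L" and i: "i \<in> {1..n}" and ne: "v \<noteq> ?a i" for v i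
  proof -
    obtain p q where pq: "v = rt L p q" "1 \<le> p" "p < q" "q \<le> L" "odd L \<longrightarrow> p + q \<noteq> L + 1"
      using v by (auto simp: roots_BC_def)
    show ?thesis
    proof (cases "i = n")
      case True
      have 1: "\<not> (p = n \<and> q = n + 1)" using ne pq True by auto
      \<comment> \<open>For odd L the last simple root has a second, mirrored representation, and
        its order would be reversed too.\<close>
      have 2: "\<not> (p = L - n \<and> q = L + 1 - n)"
      proof
        assume "p = L - n \<and> q = L + 1 - n"
        moreover have "L + 1 - (n + 1) = L - n" by simp
        moreover have "rt L (L + 1 - (n + 1)) (L + 1 - n) = ?a n"
          using n L by (intro rt_flip) auto
        ultimately have "rt L p q = ?a n" by (simp only:)
        then show False using ne pq True by simp
      qed
      from LX have "1 \<le> mid_swap L n p \<and> mid_swap L n p < mid_swap L n q \<and> mid_swap L n q \<le> L \<and>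
          (odd L \<longrightarrow> mid_swap L n p + mid_swap L n q \<noteq> L + 1)"
      proof (elim disjE conjE)
        assume L': "L = 2 * n + 1"
        then have "mid_swap L n r = (if r = n then n + 2 else if r = n + 2 then n else r)" for r
          by (simp add: mid_swap_def)
        moreover have "p + q \<noteq> 2 * n + 2" using pq(5) L' by simp
        moreover have "\<not> (p = n + 1 \<and> q = n + 2)" using 2 L' by simp
        ultimately show ?thesis using 1 pq(2-4) n L' by (auto split: if_splits)
      next
        assume L': "L = 2 * n"
        then have "mid_swap L n r = (if r = n then n + 1 else if r = n + 1 then n else r)" for r
          by (simp add: mid_swap_def)
        then show ?thesis using 1 pq(2-4) n L' by (auto split: if_splits)
      qed
      then show ?thesis
        unfolding pq(1) True last[OF pq(2-4)] by (intro in_R) auto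
    next
      case False
      then show ?thesis
        using chain_perm_pair[of i L p q] pq i ne chain[of i p q] in_R L by auto
    qed
  qed
  show "roots_BC L \<subseteq> cone (?a ` {1..n})"
  proof -
    have "rt L p q \<in> cone (?a ` {1..n})" if "1 \<le> p" "p < q" "q \<le> L" for p q
      by (rule rt_chain_cone[OF that(2)], rule cone_base, rule rt_step_mem) (use that LX in auto)
    then show ?thesis unfolding roots_BC_def by blast
  qed
qed simp_all

text \<open>The reflection in \<epsilon>(n-1) + \<epsilon>(n): it sends \<epsilon>(n-1) to
  -\<epsilon>(n), of index n + 1, and \<epsilon>(n) to -\<epsilon>(n-1), of index n + 2.\<close>

definition last_D :: "nat \<Rightarrow> nat \<Rightarrow> nat" where
  "last_D n p = (if p = n - 1 then n + 1 else if p = n + 1 then n - 1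
    else if p = n then n + 2 else if p = n + 2 then n else p)"

lemma last_refl_D:
  assumes "2 \<le> n"
  shows "(\<lambda>k. rt (2 * n) p q k - (rt (2 * n) p q (n - 1) + rt (2 * n) p q n) * rt (2 * n) (n - 1) (n + 1) k) =
    rt (2 * n) (last_D n p) (last_D n q)"
proof
  fix k
  obtain m where m: "n = Suc m" "1 \<le> m" using assms by (cases n) auto
  have flip: "ev (2 * n) (m + 2) k = - ev (2 * n) (m + 1) k" "ev (2 * n) (m + 3) k = - ev (2 * n) m k" for k
    using ev_flip[of "m + 1" "2 * n" k] ev_flip[of m "2 * n" k] m by auto
  have own: "ev (2 * n) m m = 1" "ev (2 * n) m (m + 1) = 0" "ev (2 * n) (m + 1) m = 0"
    "ev (2 * n) (m + 1) (m + 1) = 1"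
    using m by (auto simp: ev_def)
  have perm: "last_D n r = (if r = m then m + 2 else if r = m + 2 then m
    else if r = m + 1 then m + 3 else if r = m + 3 then m + 1 else r)" for r
    by (simp add: last_D_def m(1))
  have rt': "rt (2 * n) (n - 1) (n + 1) k = ev (2 * n) m k + ev (2 * n) (m + 1) k"
    using flip(1)[of k] by (simp add: rt_def m(1))
  have "ev (2 * n) p k - (ev (2 * n) p m + ev (2 * n) p (m + 1)) * (ev (2 * n) m k + ev (2 * n) (m + 1) k) =
      ev (2 * n) (last_D n p) k" for p
  proof -
    consider "p = m" | "p = m + 1" | "p = m + 2" | "p = m + 3"
      | "p \<noteq> m" "p \<noteq> m + 1" "p \<noteq> m + 2" "p \<noteq> m + 3" by blast
    then show ?thesis
    proof cases
      case 5
      then have "ev (2 * n) p m = 0" "ev (2 * n) p (m + 1) = 0" "last_D n p = p"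
        unfolding perm using m by (auto simp: ev_def)
      then show ?thesis by simp
    qed (unfold perm, simp_all only: own flip, simp_all only: own flip if_True simp_thms, simp_all add: own flip)
  qed
  then have "ev (2 * n) p k - (ev (2 * n) p (n - 1) + ev (2 * n) p n) * rt (2 * n) (n - 1) (n + 1) k =
      ev (2 * n) (last_D n p) k" for p
    unfolding rt' by (simp add: m(1))
  from this[of p] this[of q]
  show "rt (2 * n) p q k - (rt (2 * n) p q (n - 1) + rt (2 * n) p q n) * rt (2 * n) (n - 1) (n + 1) k =
    rt (2 * n) (last_D n p) (last_D n q) k"
    by (simp add: rt_def[of _ p] rt_def[of _ "last_D n p"] algebra_simps)
qed

text \<open>Exactly four pairs are put out of order: the two representations of the last simple
  root, and the two pairs with p + q = 2n + 1 among the moved indices.\<close>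

lemma last_D_pair:
  assumes "2 \<le> n" "1 \<le> p" "p < q" "q \<le> 2 * n" "p + q \<noteq> 2 * n + 1"
    and "rt (2 * n) p q \<noteq> rt (2 * n) (n - 1) (n + 1)"
  shows "1 \<le> last_D n p" "last_D n p < last_D n q" "last_D n q \<le> 2 * n"
    "last_D n p + last_D n q \<noteq> 2 * n + 1"
proof -
  obtain m where n: "n = Suc m" "1 \<le> m" using assms(1) by (cases n) auto
  have perm: "last_D n r = (if r = m then m + 2 else if r = m + 2 then m
    else if r = m + 1 then m + 3 else if r = m + 3 then m + 1 else r)" for r
    by (simp add: last_D_def n(1))
  have 1: "\<not> (p = m \<and> q = m + 2)" using assms(6) n by auto
  have 2: "\<not> (p = m + 1 \<and> q = m + 3)"
    using assms(6) rt_flip[of "n - 1" "2 * n" "n + 1"] n by auto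
  show "1 \<le> last_D n p" "last_D n q \<le> 2 * n"
    using assms(2-4) n unfolding perm by auto
  show "last_D n p < last_D n q"
    using assms(3,5) 1 2 n unfolding perm by (auto split: if_splits)
  show "last_D n p + last_D n q \<noteq> 2 * n + 1"
    using assms(3,5) 1 2 n unfolding perm by (auto split: if_splits)
qed

lemma root_model_D:
  assumes n: "4 \<le> n"
  shows "root_model n n (simple_D n) (pr_D n) (\<lambda>_. 2) (roots_D n) (cartan_matrix Type_D n)"
proof
  let ?L = "2 * n" and ?a = "simple_D n"
  show "pr_D n (\<lambda>k. \<Sum>i=1..n. d i * ?a i k) j = (\<Sum>i=1..n. d i * cartan_matrix Type_D n i j)"
    if "j \<in> {1..n}" for d j
  proof (cases "j = n")
    case True
    then have "pr_D n (\<lambda>k. \<Sum>i=1..n. d i * ?a i k) j = (\<Sum>i=1..n. d i * ?a i (n - 1) + d i * ?a i n)"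
      by (simp add: pr_D_def sum.distrib)
    also have "\<dots> = (\<Sum>i=1..n. d i * cartan_matrix Type_D n i j)"
    proof (rule sum.cong)
      fix i assume i: "i \<in> {1..n}"
      obtain m where m: "n = m + 2" "2 \<le> m" using n that[of "n - 2"] by simp
      let ?c = "if i = m + 2 then 2 else if i = m then - 1 else 0 :: int"
      have a_i: "?a i = (if i = m + 2 then rt (2 * m + 4) (m + 1) (m + 3) else rt (2 * m + 4) i (i + 1))"
      proof -
        have "2 * n = 2 * m + 4" "n - 1 = m + 1" "n + 1 = m + 3" using m(1) by auto
        then show ?thesis unfolding simple_D_def by (simp only: m(1))
      qed
      have "?a i (m + 1) + ?a i (m + 2) = ?c"
      proof (cases "i = m + 2")
        case False
        then show ?thesis using i m unfolding a_i by (auto simp: rt_def ev_def)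
      next
        case True
        then show ?thesis using m(2) unfolding a_i by (auto simp: rt_def ev_def)
      qed
      moreover have "cartan_matrix Type_D n i j = ?c"
      proof (cases "i = m + 2")
        case False
        then show ?thesis using i m True by (auto simp: chain_matrix_def doubleton_eq_iff)
      qed (use True m in \<open>auto simp: chain_matrix_def doubleton_eq_iff\<close>)
      moreover have "n - 1 = m + 1" "n = m + 2" using m by auto
      ultimately show "d i * ?a i (n - 1) + d i * ?a i n = d i * cartan_matrix Type_D n i j"
        by (metis distrib_left)
    qed simp
    finally show ?thesis .
  next
    case False
    then have "pr_D n (\<lambda>k. \<Sum>i=1..n. d i * ?a i k) j = (\<Sum>i=1..n. d i * ?a i j - d i * ?a i (j + 1))"
      by (simp add: pr_D_def sum_subtractf)
    also have "\<dots> = (\<Sum>i=1..n. d i * cartan_matrix Type_D n i j)"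
    proof (rule sum.cong)
      fix i assume i: "i \<in> {1..n}"
      have j: "1 \<le> j" "j < n" using that False by auto
      have "?a i j - ?a i (j + 1) = cartan_matrix Type_D n i j"
      proof (cases "i = n")
        case True
        let ?c = "if j = n - 2 then - 1 else 0 :: int"
        have "?a i j - ?a i (j + 1) = ?c"
          using True j n by (auto simp: simple_D_def rt_def ev_def)
        moreover have "cartan_matrix Type_D n i j = ?c"
          using True j n by (auto simp: chain_matrix_def doubleton_eq_iff)
        ultimately show ?thesis by simp
      next
        case False
        then have "cartan_matrix Type_D n i j = chain_matrix i j"
          using i j by (auto simp: doubleton_eq_iff)
        moreover have "?a i j - ?a i (j + 1) = chain_matrix i j"
          using False i j by (auto simp: simple_D_def rt_def ev_def chain_matrix_def)
        ultimately show ?thesis by simp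
      qed
      then show "d i * ?a i j - d i * ?a i (j + 1) = d i * cartan_matrix Type_D n i j"
        by (metis right_diff_distrib)
    qed simp
    finally show ?thesis .
  qed
  show "2 * (\<Sum>k=1..n. v k * ?a j k) = 2 * pr_D n v j" if "j \<in> {1..n}" for j v
  proof (cases "j = n")
    case True
    have "ev ?L (n + 1) k = - ev ?L n k" for k by (auto simp: ev_def)
    then show ?thesis using True n sum_ev[of n n ?L v] sum_ev[of "n - 1" n ?L v]
      by (simp add: simple_D_def rt_def pr_D_def distrib_left sum.distrib)
  next
    case False
    then show ?thesis using that sum_ev[of _ n ?L v]
      by (simp add: simple_D_def rt_def pr_D_def right_diff_distrib sum_subtractf)
  qed
  show "d i = 0" if z: "\<And>k. k \<in> {1..n} \<Longrightarrow> (\<Sum>i=1..n. d i * ?a i k) = 0" and i: "i \<in> {1..n}" for d i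
  proof -
    \<comment> \<open>The first n - 2 columns are triangular; the last two leave an invertible
      system for \<open>d (n - 1)\<close> and \<open>d n\<close>.\<close>
    have low: "d k = 0" if "1 \<le> k" "k \<le> n - 2" for k
      by (rule triangular_zero[of "n - 2" n ?a])
        (use that z n in \<open>auto simp: simple_D_def rt_def ev_def\<close>)
    have two: "(\<Sum>i=1..n. d i * ?a i k) = d (n - 1) * ?a (n - 1) k + d n * ?a n k" for k
    proof -
      have "(\<Sum>i=1..n. d i * ?a i k) = (\<Sum>i\<in>{n - 1, n}. d i * ?a i k)"
      proof (rule sum.mono_neutral_right)
        show "\<forall>i\<in>{1..n} - {n - 1, n}. d i * ?a i k = 0"
        proof
          fix i assume "i \<in> {1..n} - {n - 1, n}"
          then have "1 \<le> i" "i \<le> n - 2" by auto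
          then show "d i * ?a i k = 0" using low by simp
        qed
      qed (use n in auto)
      then show ?thesis using n by simp
    qed
    have "d (n - 1) + d n = 0" "d n - d (n - 1) = 0"
    proof -
      have "?a (n - 1) (n - 1) = 1" "?a (n - 1) n = - 1" "?a n (n - 1) = 1" "?a n n = 1"
        using n by (auto simp: simple_D_def rt_def ev_def)
      moreover have "n - 1 \<in> {1..n}" "n \<in> {1..n}" using n by auto
      ultimately show "d (n - 1) + d n = 0" "d n - d (n - 1) = 0"
        using z[of "n - 1"] z[of n] unfolding two by simp_all
    qed
    then have "d (n - 1) = 0" "d n = 0" by auto
    moreover have "i \<le> n - 2 \<or> i = n - 1 \<or> i = n" using i by auto
    ultimately show ?thesis using low[of i] i by auto
  qed
  have in_R: "rt ?L p q \<in> roots_D n" if "1 \<le> p" "p < q" "q \<le> ?L" "p + q \<noteq> ?L + 1" for p q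
    unfolding roots_D_def using that by fastforce
  show "?a i \<in> roots_D n" if "i \<in> {1..n}" for i
    unfolding simple_D_def using that n by (auto intro!: in_R)
  have chain: "(\<lambda>k. rt ?L p q k - pr_D n (rt ?L p q) i * ?a i k) = rt ?L (chain_perm ?L i p) (chain_perm ?L i q)"
    if "1 \<le> i" "i < n" "1 \<le> p" "p < q" "q \<le> ?L" for i p q
    using chain_refl_rt[of i ?L p q] that by (simp add: pr_D_def simple_D_def)
  have last: "(\<lambda>k. rt ?L p q k - pr_D n (rt ?L p q) n * ?a n k) = rt ?L (last_D n p) (last_D n q)" for p q
    using last_refl_D[of n p q] n by (simp add: pr_D_def simple_D_def)
  show "(\<lambda>k. v k - pr_D n v i * ?a i k) \<in> roots_D n"
    if v: "v \<in> roots_D n" and i: "i \<in> {1..n}" and ne: "v \<noteq> ?a i" for v i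
  proof -
    obtain p q where pq: "v = rt ?L p q" "1 \<le> p" "p < q" "q \<le> ?L" "p + q \<noteq> ?L + 1"
      using v by (auto simp: roots_D_def)
    show ?thesis
    proof (cases "i = n")
      case True
      have "rt ?L p q \<noteq> rt ?L (n - 1) (n + 1)" using ne pq(1) True by (simp add: simple_D_def)
      from last_D_pair[OF _ pq(2-5) this] show ?thesis
        unfolding pq(1) True last using n by (intro in_R) auto
    next
      case False
      then have "rt ?L p q \<noteq> rt ?L i (i + 1)" using ne pq(1) by (simp add: simple_D_def)
      then show ?thesis
        using False chain_perm_pair[of i ?L p q] pq i chain[of i p q] in_R by auto
    qed
  qed
  show "roots_D n \<subseteq> cone (?a ` {1..n})"
  proof -
    let ?K = "cone (?a ` {1..n})"
    have "(\<lambda>i. rt ?L i (i + 1)) ` {1..n - 1} \<subseteq> ?a ` {1..n}"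
      by (force simp: simple_D_def)
    moreover have "k \<le> n - 1 \<or> ?L - k \<le> n - 1" if "k \<noteq> n" for k
      using that by arith
    \<comment> \<open>The step from n to n + 1 is 2\<epsilon>(n), which is not a root of type D.
      Chains across the middle jump over it by \<open>middle\<close> or
      \<open>middle'\<close>.\<close>
    ultimately have step: "rt ?L k (k + 1) \<in> ?K" if "1 \<le> k" "k < ?L" "k \<noteq> n" for k
      using rt_step_mem[OF that(1,2)] that(3) by (intro cone_base) blast
    have chain: "rt ?L p q \<in> ?K" if "1 \<le> p" "p < q" "q \<le> ?L" "q \<le> n \<or> n < p" for p q
      by (rule rt_chain_cone[OF that(2)], rule step) (use that in auto)
    have middle: "rt ?L (n - 1) (n + 1) \<in> ?K"
      using n by (intro cone_base image_eqI[of _ ?a n]) (auto simp: simple_D_def)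
    have middle': "rt ?L n (n + 2) \<in> ?K"
    proof -
      have "?L + 1 - (n + 1) = n" "?L + 1 - (n - 1) = n + 2" using n by auto
      moreover have "rt ?L (?L + 1 - (n + 1)) (?L + 1 - (n - 1)) = rt ?L (n - 1) (n + 1)"
        using n by (intro rt_flip) auto
      ultimately show ?thesis using middle by (simp only:)
    qed
    have far: "rt ?L n q \<in> ?K" if "n + 2 \<le> q" "q \<le> ?L" for q
    proof (cases "q = n + 2")
      case False
      then have "rt ?L (n + 2) q \<in> ?K" using that by (intro chain) auto
      with middle' have "rt ?L n (n + 2) + rt ?L (n + 2) q \<in> ?K" by (rule cone_add)
      then show ?thesis by (simp only: rt_add)
    qed (use middle' in simp)
    have "rt ?L p q \<in> ?K" if pq: "1 \<le> p" "p < q" "q \<le> ?L" "p + q \<noteq> ?L + 1" for p q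
    proof -
      consider "q \<le> n \<or> n < p" | "p = n" "n + 2 \<le> q" | "p < n" "q = n + 1" | "p < n" "n + 2 \<le> q"
        using pq by linarith
      then show ?thesis
      proof cases
        case 1
        then show ?thesis using pq by (intro chain) auto
      next
        case 2
        then show ?thesis using far pq by simp
      next
        case 3
        show ?thesis
        proof (cases "p = n - 1")
          case False
          then have "rt ?L p (n - 1) \<in> ?K" using pq 3 by (intro chain) auto
          then have "rt ?L p (n - 1) + rt ?L (n - 1) (n + 1) \<in> ?K" using middle by (rule cone_add)
          then show ?thesis using 3 by (simp only: rt_add)
        qed (use 3 middle in simp)
      next
        case 4
        have "rt ?L p n \<in> ?K" using pq 4 by (intro chain) auto
        then have "rt ?L p n + rt ?L n q \<in> ?K" using far[OF 4(2) pq(3)] by (rule cone_add)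
        then show ?thesis by (simp only: rt_add)
      qed
    qed
    then show ?thesis unfolding roots_D_def by auto
  qed
qed simp_all

section \<open>Counting upper sets of positive roots\<close>

text \<open>Partial sums of coordinates are nonnegative on positive roots, so adding a positive root can
  only increase them; on the cells of a staircase they detect the order of rows and columns.\<close>

definition psum :: "(nat \<Rightarrow> int) \<Rightarrow> nat \<Rightarrow> int" where
  "psum v m = (\<Sum>l=1..m. v l)"

lemma psum_rt:
  assumes "1 \<le> p" "p \<le> L" "1 \<le> q" "q \<le> L"
  shows "psum (rt L p q) m =
    of_bool (p \<le> m) - of_bool (L + 1 - p \<le> m) - of_bool (q \<le> m) + of_bool (L + 1 - q \<le> m)"
proof -
  have "(\<Sum>l=1..m. ev L p l) = of_bool (p \<le> m) - of_bool (L + 1 - p \<le> m)" if "1 \<le> p" "p \<le> L" for p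
  proof -
    have "(\<Sum>l=1..m. ev L p l) = (\<Sum>l=1..m. (if l = p then 1 else 0) - (if l = L + 1 - p then 1 else 0))"
      by (rule sum.cong) (use that in \<open>auto simp: ev_def\<close>)
    also have "\<dots> = of_bool (p \<le> m) - of_bool (L + 1 - p \<le> m)"
      using that by (simp add: sum_subtractf)
    finally show ?thesis .
  qed
  then show ?thesis using assms by (simp add: psum_def rt_def sum_subtractf)
qed

lemma psum_rt_nonneg:
  assumes "1 \<le> p" "p < q" "q \<le> L"
  shows "0 \<le> psum (rt L p q) m"
  using assms by (auto simp: psum_rt of_bool_def)

lemma psum_add: "psum (v + w) m = psum v m + psum w m"
  by (simp add: psum_def sum.distrib)

text \<open>Up to N the partial sums of a cell (i, j) are 0 before i and then 1, until they drop to
  0 at j, if j \<le> N, or rise to 2 at the mirror index L + 1 - j, if that is \<le> N. Comparing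
  two such step functions orders both indices.\<close>

lemma cell_order:
  assumes L: "2 * N \<le> L" "L \<le> 2 * N + 1"
    and ij: "1 \<le> i" "i < j" "i + j \<le> L + 1" and kl: "1 \<le> k" "k < l" "k + l \<le> L + 1"
    and le: "\<And>m. m \<in> {1..N} \<Longrightarrow> psum (rt L i j) m \<le> psum (rt L k l) m"
  shows "k \<le> i" "j \<le> l"
proof -
  have iN: "i \<le> N" using ij L by linarith
  have ps1: "psum (rt L i j) m =
      of_bool (i \<le> m) - of_bool (L + 1 - i \<le> m) - of_bool (j \<le> m) + of_bool (L + 1 - j \<le> m)" for m
    using ij by (intro psum_rt) auto
  have ps2: "psum (rt L k l) m =
      of_bool (k \<le> m) - of_bool (L + 1 - k \<le> m) - of_bool (l \<le> m) + of_bool (L + 1 - l \<le> m)" for m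
    using kl by (intro psum_rt) auto
  show ki: "k \<le> i"
  proof (rule ccontr)
    assume "\<not> k \<le> i"
    then have 1: "\<not> k \<le> i" "\<not> L + 1 - k \<le> i" "\<not> L + 1 - l \<le> i" "\<not> L + 1 - i \<le> i" "\<not> j \<le> i"
      using ij kl by auto
    have "psum (rt L i j) i \<le> psum (rt L k l) i" using le[of i] ij iN by auto
    then show False using 1 unfolding ps1 ps2 by (simp add: of_bool_def split: if_splits)
  qed
  show "j \<le> l"
  proof (rule ccontr)
    assume "\<not> j \<le> l"
    then have lj: "l < j" by simp
    \<comment> \<open>The test points: where the sum of (k, l) has already dropped to 0; where the
      mirror of j adds the second unit; and N itself for the middle column of odd L.\<close>
    consider "j \<le> N" | "N < j" "L + 1 - j \<le> N" | "N < j" "N < L + 1 - j" by linarith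
    then show False
    proof cases
      case 1
      let ?m = "max i l"
      have "\<not> L + 1 - i \<le> ?m" "\<not> j \<le> ?m" "l \<le> ?m" "i \<le> ?m" "k \<le> ?m" "\<not> L + 1 - l \<le> ?m" "\<not> L + 1 - k \<le> ?m"
        using 1 lj ij kl iN L ki by auto
      moreover have "psum (rt L i j) ?m \<le> psum (rt L k l) ?m" using le[of ?m] ij iN 1 lj by auto
      ultimately show False unfolding ps1 ps2 by (simp add: of_bool_def split: if_splits)
    next
      case 2
      let ?m = "L + 1 - j"
      have "\<not> L + 1 - i \<le> ?m" "\<not> j \<le> ?m" "i \<le> ?m" "\<not> L + 1 - l \<le> ?m"
        using 2 lj ij kl by auto
      moreover have "psum (rt L i j) ?m \<le> psum (rt L k l) ?m" using le[of ?m] ij 2 by auto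
      ultimately show False unfolding ps1 ps2 by (simp split: if_splits add: of_bool_def)
    next
      case 3
      have "\<not> L + 1 - i \<le> N" "\<not> j \<le> N" "l \<le> N" "i \<le> N" "k \<le> N" "\<not> L + 1 - l \<le> N" "\<not> L + 1 - k \<le> N"
        using 3 lj ij kl iN L ki by auto
      moreover have "psum (rt L i j) N \<le> psum (rt L k l) N" using le[of N] ij iN by auto
      ultimately show False unfolding ps1 ps2 by (simp add: of_bool_def split: if_splits)
    qed
  qed
qed

lemma rt_add': "rt L j k + rt L i j = rt L i k"
  by (rule ext) (simp add: rt_def)

locale cell_model = staircase \<rho> B for \<rho> B +
  fixes L N :: nat and R :: "(nat \<Rightarrow> int) set"
  assumes L: "2 * N \<le> L" "L \<le> 2 * N + 1"
    and cells_L: "(i, j) \<in> cells \<rho> B \<Longrightarrow> i + j \<le> L + 1"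
    and R_cells: "R = (\<lambda>(i, j). rt L i j) ` cells \<rho> B"
begin

abbreviation f :: "nat \<times> nat \<Rightarrow> nat \<Rightarrow> int" where "f \<equiv> \<lambda>(i, j). rt L i j"

lemma f_mem: "(i, j) \<in> C \<Longrightarrow> rt L i j \<in> R"
  unfolding R_cells by force

text \<open>The added y is a positive root, so no partial sum decreases from (i, j) to (k,
  l).\<close>

lemma order:
  assumes c: "(i, j) \<in> C" "(k, l) \<in> C" and y: "y \<in> R" "rt L i j + y = rt L k l"
  shows "k \<le> i" "j \<le> l"
proof -
  have bd: "1 \<le> i" "i < j" "1 \<le> k" "k < l" using c by (auto simp: cells_def)
  obtain p q where pq: "(p, q) \<in> C" "y = rt L p q" using y(1) R_cells by auto
  have "1 \<le> p" "p < q" "q \<le> L" using pq(1) cells_L[OF pq(1)] by (auto simp: cells_def)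
  then have "psum (rt L i j) m \<le> psum (rt L k l) m" for m
    unfolding y(2)[symmetric] psum_add pq(2) using psum_rt_nonneg by simp
  then show "k \<le> i" "j \<le> l"
    using cell_order[OF L bd(1,2) cells_L[OF c(1)] bd(3,4) cells_L[OF c(2)]] by blast+
qed

lemma inj_f: "inj_on f C"
proof (rule inj_onI)
  fix c d assume cd: "c \<in> C" "d \<in> C" "f c = f d"
  obtain i j k l where ij: "c = (i, j)" and kl: "d = (k, l)" by (cases c, cases d) auto
  have bd: "1 \<le> i" "i < j" "1 \<le> k" "k < l" using cd ij kl by (auto simp: cells_def)
  have L': "i + j \<le> L + 1" "k + l \<le> L + 1" using cd ij kl cells_L by auto
  have eq: "rt L i j = rt L k l" using cd ij kl by simp
  show "c = d"
    using cell_order[OF L bd(1,2) L'(1) bd(3,4) L'(2)] cell_order[OF L bd(3,4) L'(2) bd(1,2) L'(1)]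
    unfolding eq ij kl by auto
qed

lemma f_image_iff: "V \<subseteq> C \<Longrightarrow> (i, j) \<in> C \<Longrightarrow> rt L i j \<in> f ` V \<longleftrightarrow> (i, j) \<in> V"
  using inj_on_image_mem_iff[OF inj_f, of "(i, j)" V] by simp

lemma upper_image:
  assumes V: "up_closed C V"
  shows "upper_subset R (f ` V)"
  unfolding upper_subset_def
proof (intro conjI ballI impI)
  have VC: "V \<subseteq> C" using V by (simp add: up_closed_def)
  then show "f ` V \<subseteq> R" unfolding R_cells by blast
  fix x y assume x: "x \<in> f ` V" and y: "y \<in> R" and xy: "x + y \<in> R"
  obtain i j where ij: "(i, j) \<in> V" "x = rt L i j" using x by auto
  obtain k l where kl: "(k, l) \<in> C" "x + y = rt L k l" using xy R_cells by auto
  have "(k, l) \<in> V"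
    using order[OF _ kl(1) y] ij kl VC by (intro up_closed_mono[OF V ij(1) kl(1)]) auto
  then show "x + y \<in> f ` V" unfolding kl(2) by force
qed

definition cells_of :: "(nat \<Rightarrow> int) set \<Rightarrow> (nat \<times> nat) set" where
  "cells_of U = {(i, j). (i, j) \<in> C \<and> rt L i j \<in> U}"

lemma image_cells_of: "U \<subseteq> R \<Longrightarrow> f ` cells_of U = U"
  unfolding cells_of_def R_cells by force

lemma cells_of_image:
  assumes V: "V \<subseteq> C" shows "cells_of (f ` V) = V"
proof -
  have "(i, j) \<in> cells_of (f ` V) \<longleftrightarrow> (i, j) \<in> V" for i j
    using f_image_iff[OF V, of i j] V unfolding cells_of_def by (cases "(i, j) \<in> C") (simp_all, blast)
  then show ?thesis by auto
qed

text \<open>The second alternative in \<open>right\<close> serves type D, where the step from column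
  n to n + 1 is not a root.\<close>

lemma up_closed_cells_of:
  assumes U: "upper_subset R U"
    and right: "\<And>i j. (i, j) \<in> C \<Longrightarrow> (i, j + 1) \<in> C \<Longrightarrow> rt L i j \<in> U \<Longrightarrow> rt L j (j + 1) \<in> R \<or> rt L i (j + 1) \<in> U"
    and up: "\<And>i. 2 \<le> i \<Longrightarrow> i \<le> \<rho> \<Longrightarrow> rt L (i - 1) i \<in> R"
  shows "up_closed C (cells_of U)"
  unfolding up_closed_def
proof (intro conjI allI impI)
  show "cells_of U \<subseteq> C" by (auto simp: cells_of_def)
  fix i j assume ij: "(i, j) \<in> cells_of U"
  then have c: "(i, j) \<in> C" "rt L i j \<in> U" by (auto simp: cells_of_def)
  show "(i, j + 1) \<in> cells_of U" if "(i, j + 1) \<in> C"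
  proof -
    have "rt L i (j + 1) \<in> U"
    proof (cases "rt L j (j + 1) \<in> R")
      case True
      then show ?thesis
        using U c(2) f_mem[OF that] rt_add[of L i j "j + 1"] unfolding upper_subset_def by metis
    qed (use right[OF c(1) that c(2)] in simp)
    then show ?thesis using that by (simp add: cells_of_def)
  qed
  show "(i - 1, j) \<in> cells_of U" if cc: "(i - 1, j) \<in> C"
  proof -
    have "2 \<le> i" "i \<le> \<rho>" using cc c(1) by (auto simp: cells_def)
    then have "rt L (i - 1) i \<in> R" by (rule up)
    then have "rt L (i - 1) j \<in> U"
      using U c(2) f_mem[OF cc] rt_add'[of L i j "i - 1"] unfolding upper_subset_def by metis
    then show ?thesis using cc by (simp add: cells_of_def)
  qed
qed

lemma corners_image:
  assumes V: "V \<subseteq> C" and S: "\<And>i. (i, i + 1) \<in> C \<Longrightarrow> i \<in> I" "\<And>i. i \<in> I \<Longrightarrow> (i, i + 1) \<in> C"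
  shows "card ((\<lambda>i. rt L i (i + 1)) ` I \<inter> f ` V) = corners V"
proof -
  have inj: "inj_on (\<lambda>i. rt L i (i + 1)) {i. (i, i + 1) \<in> V}"
  proof (rule inj_onI)
    fix i k assume "i \<in> {i. (i, i + 1) \<in> V}" "k \<in> {i. (i, i + 1) \<in> V}" "rt L i (i + 1) = rt L k (k + 1)"
    then have "(i, i + 1) = (k, k + 1)" using inj_onD[OF inj_f, of "(i, i + 1)" "(k, k + 1)"] V by auto
    then show "i = k" by simp
  qed
  have "(\<lambda>i. rt L i (i + 1)) ` I \<inter> f ` V = (\<lambda>i. rt L i (i + 1)) ` {i. (i, i + 1) \<in> V}"
  proof (intro equalityI subsetI)
    fix x assume "x \<in> (\<lambda>i. rt L i (i + 1)) ` I \<inter> f ` V"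
    then obtain i where i: "i \<in> I" "x = rt L i (i + 1)" "rt L i (i + 1) \<in> f ` V" by blast
    then have "(i, i + 1) \<in> V" using f_image_iff[OF V S(2)] by blast
    then show "x \<in> (\<lambda>i. rt L i (i + 1)) ` {i. (i, i + 1) \<in> V}" using i(2) by blast
  next
    fix x assume "x \<in> (\<lambda>i. rt L i (i + 1)) ` {i. (i, i + 1) \<in> V}"
    then obtain i where i: "(i, i + 1) \<in> V" "x = rt L i (i + 1)" by blast
    then have "i \<in> I" "x \<in> f ` V" using S(1) V by (auto intro!: image_eqI[of _ f "(i, i + 1)"])
    then show "x \<in> (\<lambda>i. rt L i (i + 1)) ` I \<inter> f ` V" using i(2) by blast
  qed
  then show ?thesis by (simp add: corners_def card_image[OF inj, simplified])
qed

lemma num_upper_eq: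
  assumes right: "\<And>i j. (i, j) \<in> C \<Longrightarrow> (i, j + 1) \<in> C \<Longrightarrow> rt L j (j + 1) \<in> R"
    and up: "\<And>i. 2 \<le> i \<Longrightarrow> i \<le> \<rho> \<Longrightarrow> rt L (i - 1) i \<in> R"
    and S: "\<And>i. i \<in> {1..\<rho>} \<Longrightarrow> (i, i + 1) \<in> C"
  shows "num_upper R ((\<lambda>i. rt L i (i + 1)) ` {1..\<rho>}) j = (\<Sum>r\<le>\<rho>. card (ballot r (B r) j))"
proof -
  let ?S = "(\<lambda>i. rt L i (i + 1)) ` {1..\<rho>}"
  have S': "i \<in> {1..\<rho>}" if "(i, i + 1) \<in> C" for i using that by (auto simp: cells_def)
  have "card {V. up_closed C V \<and> corners V = j} = card {U. upper_subset R U \<and> card (?S \<inter> U) = j}"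
  proof (rule bij_betw_same_card, rule bij_betw_byWitness[where f' = cells_of])
    show "\<forall>V\<in>{V. up_closed C V \<and> corners V = j}. cells_of (f ` V) = V"
      using cells_of_image by (auto simp: up_closed_def)
    show "\<forall>U\<in>{U. upper_subset R U \<and> card (?S \<inter> U) = j}. f ` cells_of U = U"
      using image_cells_of by (auto simp: upper_subset_def)
    show "image f ` {V. up_closed C V \<and> corners V = j} \<subseteq> {U. upper_subset R U \<and> card (?S \<inter> U) = j}"
      using upper_image corners_image[OF _ S' S] by (auto simp: up_closed_def)
    show "cells_of ` {U. upper_subset R U \<and> card (?S \<inter> U) = j} \<subseteq> {V. up_closed C V \<and> corners V = j}"
    proof (rule image_subsetI)
      fix U assume "U \<in> {U. upper_subset R U \<and> card (?S \<inter> U) = j}"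
      then have U: "upper_subset R U" "card (?S \<inter> U) = j" by auto
      have "up_closed C (cells_of U)" using up_closed_cells_of[OF U(1)] right up by blast
      moreover have "f ` cells_of U = U" using U image_cells_of by (simp add: upper_subset_def)
      moreover have "cells_of U \<subseteq> C" by (auto simp: cells_of_def)
      ultimately show "cells_of U \<in> {V. up_closed C V \<and> corners V = j}"
        using corners_image[OF _ S' S, of "cells_of U"] U(2) by simp
    qed
  qed
  then show ?thesis by (simp add: num_upper_def card_up_closed_corners)
qed

end

text \<open>Every difference has a mirrored representation; the cell is the one with p + q \<le> L +
  1.\<close>

lemma rt_image_flip:
  assumes "\<And>p q. 1 \<le> p \<Longrightarrow> p < q \<Longrightarrow> q \<le> L \<Longrightarrow> P p q \<Longrightarrow> p + q \<le> L + 1 \<Longrightarrow> (p, q) \<in> S"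
    and "\<And>p q. (p, q) \<in> S \<Longrightarrow> 1 \<le> p \<and> p < q \<and> q \<le> L \<and> P p q"
    and "\<And>p q. 1 \<le> p \<Longrightarrow> p < q \<Longrightarrow> q \<le> L \<Longrightarrow> P p q \<Longrightarrow> P (L + 1 - q) (L + 1 - p)"
  shows "{rt L p q | p q. 1 \<le> p \<and> p < q \<and> q \<le> L \<and> P p q} = (\<lambda>(i, j). rt L i j) ` S"
proof
  show "{rt L p q | p q. 1 \<le> p \<and> p < q \<and> q \<le> L \<and> P p q} \<subseteq> (\<lambda>(i, j). rt L i j) ` S"
  proof clarify
    fix p q assume pq: "1 \<le> p" "p < q" "q \<le> L" "P p q"
    show "rt L p q \<in> (\<lambda>(i, j). rt L i j) ` S"
    proof (cases "p + q \<le> L + 1")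
      case True
      then show ?thesis using assms(1)[OF pq] by force
    next
      case False
      then have "(L + 1 - q, L + 1 - p) \<in> S"
        using pq assms(3)[OF pq] by (intro assms(1)) auto
      moreover have "rt L (L + 1 - q) (L + 1 - p) = rt L p q" using pq by (intro rt_flip) auto
      ultimately show ?thesis by force
    qed
  qed
  show "(\<lambda>(i, j). rt L i j) ` S \<subseteq> {rt L p q | p q. 1 \<le> p \<and> p < q \<and> q \<le> L \<and> P p q}"
  proof clarify
    fix p q assume "(p, q) \<in> S"
    then show "\<exists>p' q'. rt L p q = rt L p' q' \<and> 1 \<le> p' \<and> p' < q' \<and> q' \<le> L \<and> P p' q'"
      using assms(2)[of p q] by blast
  qed
qed

lemma cell_model_A: "1 \<le> n \<Longrightarrow> cell_model n (\<lambda>_. n + 1) (2 * n + 2) (n + 1) (roots_A n)"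
proof
  assume "1 \<le> n"
  show "roots_A n = (\<lambda>(i, j). rt (2 * n + 2) i j) ` cells n (\<lambda>_. n + 1)"
    unfolding roots_A_def cells_def by force
qed (auto simp: cells_def)

text \<open>For even L the bound i + j \<le> 2n + 1 is the choice of a representative; for odd L it
  comes from i + j \<le> 2n + 2 and the excluded sum. So both types have the same staircase.\<close>

lemma cell_model_BC:
  assumes "1 \<le> n" and L: "L = 2 * n + 1 \<or> L = 2 * n"
  shows "cell_model n (\<lambda>i. 2 * n + 1 - i) L n (roots_BC L)"
proof
  show "roots_BC L = (\<lambda>(i, j). rt L i j) ` cells n (\<lambda>i. 2 * n + 1 - i)"
    unfolding roots_BC_def by (rule rt_image_flip) (use L in \<open>auto simp: cells_def\<close>)
qed (use L in \<open>auto simp: cells_def\<close>)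

text \<open>Compared with type C, the excluded sum removes the last cell of each row, which empties
  row n.\<close>

lemma cell_model_D: "2 \<le> n \<Longrightarrow> cell_model (n - 1) (\<lambda>i. 2 * n - i) (2 * n) n (roots_D n)"
proof
  assume "2 \<le> n"
  then show "roots_D n = (\<lambda>(i, j). rt (2 * n) i j) ` cells (n - 1) (\<lambda>i. 2 * n - i)"
    unfolding roots_D_def by (intro rt_image_flip) (auto simp: cells_def)
qed (auto simp: cells_def)

lemma num_upper_A:
  assumes "1 \<le> n"
  shows "num_upper (roots_A n) ((\<lambda>i. rt (2 * n + 2) i (i + 1)) ` {1..n}) j = (\<Sum>r\<le>n. card (ballot r (n + 1) j))"
  by (rule cell_model.num_upper_eq[OF cell_model_A[OF assms]])
    (auto simp: cells_def roots_A_def intro!: exI)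

lemma num_upper_BC:
  assumes "1 \<le> n" and L: "L = 2 * n + 1 \<or> L = 2 * n"
  shows "num_upper (roots_BC L) ((\<lambda>i. rt L i (i + 1)) ` {1..n}) j = (\<Sum>r\<le>n. card (ballot r (2 * n + 1 - r) j))"
proof (rule cell_model.num_upper_eq[OF cell_model_BC[OF assms]])
  have in_R: "rt L i (i + 1) \<in> roots_BC L" if "1 \<le> i" "i < L" for i
  proof -
    have "odd L \<longrightarrow> i + (i + 1) \<noteq> L + 1" by presburger
    then show ?thesis unfolding roots_BC_def using that by fastforce
  qed
  show "rt L c (c + 1) \<in> roots_BC L" if "(i, c + 1) \<in> cells n (\<lambda>i. 2 * n + 1 - i)"
    "(i, c) \<in> cells n (\<lambda>i. 2 * n + 1 - i)" for i c
    using that L by (intro in_R) (auto simp: cells_def)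
  show "rt L (i - 1) i \<in> roots_BC L" if "2 \<le> i" "i \<le> n" for i
    using in_R[of "i - 1"] that L by auto
qed (auto simp: cells_def)

text \<open>The diagram symmetry, the sign change of \<epsilon>(n): the vectors
  \<open>ev (2 * n) p\<close> take opposite values at n and its mirror n + 1. On roots it exchanges
  the columns n and n + 1.\<close>

definition swp :: "nat \<Rightarrow> (nat \<Rightarrow> int) \<Rightarrow> nat \<Rightarrow> int" where
  "swp n v = (\<lambda>k. v (if k = n then n + 1 else if k = n + 1 then n else k))"

lemma swp_swp: "swp n (swp n v) = v"
  by (rule ext) (simp add: swp_def)

lemma swp_add: "swp n (v + w) = swp n v + swp n w"
  by (rule ext) (simp add: swp_def)

lemma inj_swp: "inj (swp n)"
  by (rule inj_on_inverseI[where g = "swp n"]) (simp add: swp_swp)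

lemma mem_swp_image: "x \<in> swp n ` U \<longleftrightarrow> swp n x \<in> U"
  by (metis image_eqI inj_image_mem_iff inj_swp swp_swp)

lemma swp_rt:
  "swp n (rt (2 * n) p q) = rt (2 * n) (if p = n then n + 1 else if p = n + 1 then n else p)
    (if q = n then n + 1 else if q = n + 1 then n else q)"
proof -
  have "ev (2 * n) p (if k = n then n + 1 else if k = n + 1 then n else k) =
      ev (2 * n) (if p = n then n + 1 else if p = n + 1 then n else p) k" for p k
    by (auto simp: ev_def)
  then show ?thesis by (simp only: swp_def rt_def)
qed

lemma swp_roots_D: assumes "v \<in> roots_D n" shows "swp n v \<in> roots_D n"
proof -
  obtain p q where pq: "v = rt (2 * n) p q" "1 \<le> p" "p < q" "q \<le> 2 * n" "p + q \<noteq> 2 * n + 1"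
    using assms by (auto simp: roots_D_def)
  let ?t = "\<lambda>p. if p = n then n + 1 else if p = n + 1 then n else p"
  have "1 \<le> ?t p" "?t p < ?t q" "?t q \<le> 2 * n" "?t p + ?t q \<noteq> 2 * n + 1"
    using pq by auto
  then show ?thesis unfolding pq(1) swp_rt roots_D_def by blast
qed

lemma simple_D_image:
  assumes "2 \<le> n"
  shows "simple_D n ` {1..n} = insert (rt (2 * n) (n - 1) (n + 1)) ((\<lambda>i. rt (2 * n) i (i + 1)) ` {1..n - 1})"
proof -
  have "{1..n} = insert n {1..n - 1}" using assms by auto
  moreover have "simple_D n ` {1..n - 1} = (\<lambda>i. rt (2 * n) i (i + 1)) ` {1..n - 1}"
    by (rule image_cong) (auto simp: simple_D_def)
  moreover have "simple_D n n = rt (2 * n) (n - 1) (n + 1)"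
    by (simp add: simple_D_def)
  ultimately show ?thesis by (simp only: image_insert)
qed

lemma swp_simple_D:
  assumes n: "2 \<le> n" and v: "v \<in> simple_D n ` {1..n}"
  shows "swp n v \<in> simple_D n ` {1..n}"
proof -
  consider "v = rt (2 * n) (n - 1) (n + 1)" | "v = rt (2 * n) (n - 1) n"
    | i where "1 \<le> i" "i \<le> n - 2" "v = rt (2 * n) i (i + 1)"
  proof -
    from v consider "v = rt (2 * n) (n - 1) (n + 1)" | i where "i \<in> {1..n - 1}" "v = rt (2 * n) i (i + 1)"
      unfolding simple_D_image[OF n] by blast
    then show thesis
    proof cases
      case (2 i)
      show thesis
      proof (cases "i = n - 1")
        case True
        then have "i + 1 = n" using n by simp
        then show thesis using that(2) 2 True by simp
      next
        case False
        then have "1 \<le> i" "i \<le> n - 2" using 2 by auto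
        then show thesis using that(3) 2 by blast
      qed
    qed (use that in blast)
  qed
  then show ?thesis
  proof cases
    case 1
    moreover have "n - 1 \<noteq> n" "n - 1 \<noteq> n + 1" "n - 1 + 1 = n" using n by auto
    ultimately have "swp n v = rt (2 * n) (n - 1) ((n - 1) + 1)" by (simp only: swp_rt) simp
    moreover have "n - 1 \<in> {1..n - 1}" using n by simp
    ultimately show ?thesis unfolding simple_D_image[OF n] by blast
  next
    case 2
    moreover have "n - 1 \<noteq> n" "n - 1 \<noteq> n + 1" using n by auto
    ultimately have "swp n v = rt (2 * n) (n - 1) (n + 1)" by (simp only: swp_rt) simp
    then show ?thesis unfolding simple_D_image[OF n] by blast
  next
    case (3 i)
    then have "swp n v = rt (2 * n) i (i + 1)" by (auto simp: swp_rt)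
    moreover have "i \<in> {1..n - 1}" using 3 by simp
    ultimately show ?thesis unfolding simple_D_image[OF n] by blast
  qed
qed

text \<open>In type \<open>D\<^sub>n\<close> each row has two incomparable roots \<open>\<epsilon>\<^sub>i - \<epsilon>\<^sub>n\<close> and
  \<open>\<epsilon>\<^sub>i + \<epsilon>\<^sub>n\<close>, but the two columns that they form are comparable in every upper set. The sets in
  which the second column contains the first are counted as fillings of a staircase, those with the
  reverse inclusion are their images under \<open>swp\<close>, and those with equal columns are fillings of a
  staircase with one column less.\<close>

lemma num_upper_D:
  assumes n: "4 \<le> n" and j: "j \<le> n"
  shows "num_upper (roots_D n) (simple_D n ` {1..n}) j =
    (if j = 0 then ((2 * n - 2) choose (n - 2)) + ((2 * n - 3) choose (n - 3))
      else ((2 * n - 2 - j) choose (n - 2)) + ((2 * n - 3 - j) choose (n - 2)))"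
proof -
  have n2: "2 \<le> n" using n by simp
  let ?L = "2 * n" and ?R = "roots_D n" and ?S = "simple_D n ` {1..n}"
  let ?B = "\<lambda>i. 2 * n - i" and ?B' = "\<lambda>i. 2 * n - 1 - i"
  interpret D: cell_model "n - 1" ?B ?L n ?R by (rule cell_model_D[OF n2])
  interpret E: staircase "n - 1" ?B' by unfold_locales auto
  define C where "C = cells (n - 1) ?B"
  define C' where "C' = cells (n - 1) ?B'"
  have Ci: "(i, c) \<in> C \<longleftrightarrow> 1 \<le> i \<and> i \<le> n - 1 \<and> i < c \<and> c \<le> 2 * n - i" for i c
    by (simp add: C_def cells_def)
  have C'i: "(i, c) \<in> C' \<longleftrightarrow> 1 \<le> i \<and> i \<le> n - 1 \<and> i < c \<and> c \<le> 2 * n - 1 - i" for i c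
    by (simp add: C'_def cells_def)
  let ?f = "\<lambda>(i, c). rt ?L i c"
  let ?s = "\<lambda>r. of_bool (r = n - 1) :: nat"
  define X where "X = {U. upper_subset ?R U \<and> card (?S \<inter> U) = j}"
  define X1 where "X1 = {U \<in> X. \<forall>i\<in>{1..n - 1}. rt ?L i n \<in> U \<longrightarrow> rt ?L i (n + 1) \<in> U}"
  define X2 where "X2 = {U \<in> X. \<forall>i\<in>{1..n - 1}. rt ?L i (n + 1) \<in> U \<longrightarrow> rt ?L i n \<in> U}"
  define VV where "VV = {V. up_closed C V \<and> (\<exists>r\<le>n - 1. rows V = {1..r} \<and> corners V + ?s r = j)}"
  define VV' where "VV' = {V. up_closed C' V \<and> (\<exists>r\<le>n - 1. rows V = {1..r} \<and> corners V + ?s r = j)}"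
  define T where "T = (\<Sum>r\<le>n - 1. if ?s r \<le> j then card (ballot r (2 * n - r) (j - ?s r)) else 0)"
  define E where "E = (\<Sum>r\<le>n - 1. if ?s r \<le> j then card (ballot r (2 * n - 1 - r) (j - ?s r)) else 0)"
  have cardVV: "card VV = T"
    unfolding VV_def C_def T_def by (rule D.card_up_closed)
  have cardVV': "card VV' = E"
    unfolding VV'_def C'_def E_def by (rule E.card_up_closed)
  \<comment> \<open>The simple roots are the n - 1 corners and the extra cell (n - 1, n +
    1).\<close>
  have stat: "card (?S \<inter> ?f ` V) = corners V + of_bool ((n - 1, n + 1) \<in> V)" if V: "V \<subseteq> C" for V
  proof -
    let ?I = "(\<lambda>i. rt ?L i (i + 1)) ` {1..n - 1}"
    have c: "(n - 1, n + 1) \<in> C" using n unfolding Ci by arith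
    have "rt ?L (n - 1) (n + 1) \<noteq> rt ?L i (i + 1)" if "i \<in> {1..n - 1}" for i
    proof
      assume eq: "rt ?L (n - 1) (n + 1) = rt ?L i (i + 1)"
      have c': "(i, i + 1) \<in> C" using that n unfolding Ci by auto
      have "(n - 1, n + 1) = (i, i + 1)"
        by (rule inj_onD[OF D.inj_f _ c[unfolded C_def] c'[unfolded C_def]]) (use eq in simp)
      then have "n - 1 = i" "n = i" by auto
      then show False using n by arith
    qed
    then have notin: "rt ?L (n - 1) (n + 1) \<notin> ?I" by blast
    have mem: "rt ?L (n - 1) (n + 1) \<in> ?f ` V \<longleftrightarrow> (n - 1, n + 1) \<in> V"
      by (rule D.f_image_iff[OF V[unfolded C_def] c[unfolded C_def]])
    have cor: "card (?I \<inter> ?f ` V) = corners V"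
      by (rule D.corners_image) (use V in \<open>auto simp: C_def cells_def\<close>)
    have fin: "finite (?I \<inter> ?f ` V)" by simp
    show ?thesis
    proof (cases "(n - 1, n + 1) \<in> V")
      case True
      then have "?S \<inter> ?f ` V = insert (rt ?L (n - 1) (n + 1)) (?I \<inter> ?f ` V)"
        using mem unfolding simple_D_image[OF n2] by blast
      then show ?thesis using notin cor True fin by simp
    next
      case False
      then have "?S \<inter> ?f ` V = ?I \<inter> ?f ` V"
        using mem unfolding simple_D_image[OF n2] by blast
      then show ?thesis using cor False by simp
    qed
  qed
  \<comment> \<open>Row n - 1 has only the columns n and n + 1, so upward closure puts the extra
    cell into V as soon as this row is nonempty.\<close>
  have last_row: "(n - 1, n + 1) \<in> V \<longleftrightarrow> r = n - 1"
    if V: "up_closed C V" and r: "r \<le> n - 1" "rows V = {1..r}" for V r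
  proof
    assume "(n - 1, n + 1) \<in> V"
    then have "n - 1 \<in> rows V" by (force simp: rows_def)
    then show "r = n - 1" using r by simp
  next
    assume "r = n - 1"
    then have "n - 1 \<in> rows V" using r n by simp
    then obtain c where c: "(n - 1, c) \<in> V" by (auto simp: rows_def)
    then have "c \<le> n + 1" using V n by (auto simp: up_closed_def Ci)
    then show "(n - 1, n + 1) \<in> V"
      using D.up_closed_right[OF V[unfolded C_def] c] n by simp
  qed
  have stat': "card (?S \<inter> ?f ` V) = j \<longleftrightarrow> (\<exists>r\<le>n - 1. rows V = {1..r} \<and> corners V + ?s r = j)"
    if V: "up_closed C V" for V
  proof -
    have VC: "V \<subseteq> C" using V by (simp add: up_closed_def)
    obtain r where r: "r \<le> n - 1" "rows V = {1..r}" using D.rows_initial V unfolding C_def by blast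
    have uniq: "r' = r" if "rows V = {1..r'}" for r'
    proof -
      have "card {1..r'} = card {1..r}" unfolding that[symmetric] r(2)[symmetric] ..
      then show ?thesis by simp
    qed
    have "(\<exists>r'\<le>n - 1. rows V = {1..r'} \<and> corners V + ?s r' = j) \<longleftrightarrow> corners V + ?s r = j"
    proof
      assume "\<exists>r'\<le>n - 1. rows V = {1..r'} \<and> corners V + ?s r' = j"
      then obtain r' where r': "rows V = {1..r'}" "corners V + ?s r' = j" by blast
      show "corners V + ?s r = j" using r'(2) unfolding uniq[OF r'(1)] .
    qed (use r in blast)
    then show ?thesis
      unfolding stat[OF VC] last_row[OF V r] by (rule sym)
  qed
  \<comment> \<open>The move from column n to n + 1, which no root provides, is exactly the
    condition that defines \<open>X1\<close>.\<close>
  have bij1: "bij_betw (image ?f) VV X1"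
  proof (rule bij_betw_byWitness[where f' = D.cells_of])
    show "\<forall>V\<in>VV. D.cells_of (?f ` V) = V"
      using D.cells_of_image by (auto simp: VV_def up_closed_def C_def)
    show "\<forall>U\<in>X1. ?f ` D.cells_of U = U"
      using D.image_cells_of by (auto simp: X1_def X_def upper_subset_def)
    show "image ?f ` VV \<subseteq> X1"
    proof (rule image_subsetI)
      fix V assume "V \<in> VV"
      then have V: "up_closed C V" "card (?S \<inter> ?f ` V) = j" using stat' by (auto simp: VV_def)
      then have VC: "V \<subseteq> cells (n - 1) ?B" by (simp add: up_closed_def C_def)
      have "?f ` V \<in> X" using V D.upper_image unfolding X_def C_def by blast
      moreover have "rt ?L i (n + 1) \<in> ?f ` V" if i: "i \<in> {1..n - 1}" "rt ?L i n \<in> ?f ` V" for i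
      proof -
        have c: "(i, n) \<in> cells (n - 1) ?B" "(i, n + 1) \<in> cells (n - 1) ?B" using i(1) by (auto simp: cells_def)
        then have "(i, n) \<in> V" using i(2) D.f_image_iff[OF VC] by blast
        then have "(i, n + 1) \<in> V" using V(1) c(2) unfolding C_def up_closed_def by blast
        then show ?thesis using D.f_image_iff[OF VC c(2)] by blast
      qed
      ultimately show "?f ` V \<in> X1" unfolding X1_def by blast
    qed
    show "D.cells_of ` X1 \<subseteq> VV"
    proof (rule image_subsetI)
      fix U assume "U \<in> X1"
      then have U: "upper_subset ?R U" "card (?S \<inter> U) = j"
        and eq: "\<And>i. i \<in> {1..n - 1} \<Longrightarrow> rt ?L i n \<in> U \<Longrightarrow> rt ?L i (n + 1) \<in> U"
        by (auto simp: X1_def X_def)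
      have "up_closed C (D.cells_of U)"
        unfolding C_def
      proof (rule D.up_closed_cells_of[OF U(1)])
        fix i c assume c: "(i, c) \<in> cells (n - 1) ?B" "(i, c + 1) \<in> cells (n - 1) ?B" "rt ?L i c \<in> U"
        show "rt ?L c (c + 1) \<in> ?R \<or> rt ?L i (c + 1) \<in> U"
        proof (cases "c = n")
          case True
          then show ?thesis using eq c by (simp add: cells_def)
        next
          case False
          have "c + (c + 1) \<noteq> 2 * n + 1" using False by simp
          then have "rt ?L c (c + 1) \<in> ?R" using c unfolding roots_D_def cells_def by fastforce
          then show ?thesis ..
        qed
      next
        fix i assume i: "2 \<le> i" "i \<le> n - 1"
        then show "rt ?L (i - 1) i \<in> ?R" unfolding roots_D_def by (auto intro!: exI)
      qed
      moreover have "?f ` D.cells_of U = U" using U D.image_cells_of by (simp add: upper_subset_def)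
      ultimately show "D.cells_of U \<in> VV" using U(2) stat'[of "D.cells_of U"] by (simp add: VV_def)
    qed
  qed
  have swap: "swp n ` U \<in> X" if U: "U \<in> X" for U
  proof -
    have up: "upper_subset ?R U" "card (?S \<inter> U) = j" using U by (auto simp: X_def)
    have "upper_subset ?R (swp n ` U)"
      unfolding upper_subset_def
    proof (intro conjI ballI impI)
      show "swp n ` U \<subseteq> ?R" using up(1) swp_roots_D by (auto simp: upper_subset_def)
      fix x y assume x: "x \<in> swp n ` U" and y: "y \<in> ?R" and xy: "x + y \<in> ?R"
      have "swp n x \<in> U" "swp n y \<in> ?R" "swp n x + swp n y \<in> ?R"
        using x y xy swp_roots_D[of "x + y" n] swp_roots_D by (auto simp: mem_swp_image swp_add swp_swp)
      then have "swp n x + swp n y \<in> U" using up(1) unfolding upper_subset_def by blast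
      then show "x + y \<in> swp n ` U" by (simp add: mem_swp_image swp_add)
    qed
    moreover have "?S \<inter> swp n ` U = swp n ` (?S \<inter> U)"
      using swp_simple_D[OF n2] unfolding set_eq_iff Int_iff mem_swp_image by (metis swp_swp)
    then have "card (?S \<inter> swp n ` U) = j"
      using up(2) card_image[OF inj_on_subset[OF inj_swp subset_UNIV], of n "?S \<inter> U"] by simp
    ultimately show ?thesis by (simp add: X_def)
  qed
  have swp_n: "swp n (rt ?L i n) = rt ?L i (n + 1)" "swp n (rt ?L i (n + 1)) = rt ?L i n"
    if "i \<in> {1..n - 1}" for i
    using that n by (auto simp: swp_rt)
  have "bij_betw (image (swp n)) X1 X2"
  proof (rule bij_betw_byWitness[where f' = "image (swp n)"])
    show "\<forall>U\<in>X1. swp n ` swp n ` U = U" "\<forall>U\<in>X2. swp n ` swp n ` U = U"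
      by (simp_all add: image_image swp_swp)
    have m: "rt ?L i n \<in> swp n ` U \<longleftrightarrow> rt ?L i (n + 1) \<in> U"
      "rt ?L i (n + 1) \<in> swp n ` U \<longleftrightarrow> rt ?L i n \<in> U" if "i \<in> {1..n - 1}" for i U
      unfolding mem_swp_image swp_n[OF that] by (rule refl)+
    show "image (swp n) ` X1 \<subseteq> X2"
    proof (rule image_subsetI)
      fix U assume "U \<in> X1"
      then show "swp n ` U \<in> X2"
        using swap[of U] m unfolding X1_def X2_def mem_Collect_eq by blast
    qed
    show "image (swp n) ` X2 \<subseteq> X1"
    proof (rule image_subsetI)
      fix U assume "U \<in> X2"
      then show "swp n ` U \<in> X1"
        using swap[of U] m unfolding X1_def X2_def mem_Collect_eq by blast
    qed
  qed
  then have X12: "card X1 = card X2" by (rule bij_betw_same_card)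
  have in_R: "rt ?L p q \<in> ?R" if "1 \<le> p" "p < q" "q \<le> ?L" "p + q \<noteq> ?L + 1" for p q
    unfolding roots_D_def using that by blast
  have cover: "X = X1 \<union> X2"
  proof
    show "X \<subseteq> X1 \<union> X2"
    proof
      fix U assume U: "U \<in> X"
      then have up: "upper_subset ?R U" by (simp add: X_def)
      \<comment> \<open>Both middle columns are closed under moving up, by adding the difference of
        two indices below n. They are thus initial segments of the rows and comparable.\<close>
      have mono: "rt ?L k c \<in> U" if "rt ?L i c \<in> U" "1 \<le> k" "k \<le> i" "i \<le> n - 1" "c = n \<or> c = n + 1" for i k c
      proof (cases "k = i")
        case False
        then have "rt ?L k i \<in> ?R" "rt ?L k c \<in> ?R"
          using that False n by (auto intro!: in_R)
        then show ?thesis using up that(1) rt_add'[of ?L i c k] unfolding upper_subset_def by metis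
      qed (use that in simp)
      show "U \<in> X1 \<union> X2"
      proof (rule ccontr)
        assume "U \<notin> X1 \<union> X2"
        then obtain i k where i: "i \<in> {1..n - 1}" "rt ?L i n \<in> U" "rt ?L i (n + 1) \<notin> U"
          and k: "k \<in> {1..n - 1}" "rt ?L k (n + 1) \<in> U" "rt ?L k n \<notin> U"
          using U by (auto simp: X1_def X2_def)
        show False
          using mono[of i n k] mono[of k "n + 1" i] i k by (cases "k \<le> i") auto
      qed
    qed
  qed (auto simp: X1_def X2_def)
  \<comment> \<open>Members of \<open>VV\<close> satisfy the opposite inclusion already, so here the
    two middle columns are equal.\<close>
  define WW where "WW = {V \<in> VV. \<forall>i. (i, n + 1) \<in> V \<longrightarrow> (i, n) \<in> V}"
  have inter: "X1 \<inter> X2 = image ?f ` WW"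
  proof -
    have "?f ` V \<in> X2 \<longleftrightarrow> (\<forall>i. (i, n + 1) \<in> V \<longrightarrow> (i, n) \<in> V)" if "V \<in> VV" for V
    proof -
      have VC: "V \<subseteq> cells (n - 1) ?B" using that by (simp add: VV_def up_closed_def C_def)
      have X: "?f ` V \<in> X" using that bij1 by (auto simp: bij_betw_def X1_def)
      have "rt ?L i n \<in> ?f ` V \<longleftrightarrow> (i, n) \<in> V" "rt ?L i (n + 1) \<in> ?f ` V \<longleftrightarrow> (i, n + 1) \<in> V"
        if "i \<in> {1..n - 1}" for i
        using that by (auto intro!: D.f_image_iff[OF VC] simp: cells_def simp del: image_iff)
      moreover have "i \<in> {1..n - 1}" if "(i, n + 1) \<in> V" for i
        using that VC by (auto simp: cells_def)
      ultimately show ?thesis using X unfolding X2_def by blast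
    qed
    then show ?thesis using bij_betw_imp_surj_on[OF bij1] unfolding WW_def by blast
  qed
  have "card (X1 \<inter> X2) = card WW"
    unfolding inter using bij1 by (intro card_image inj_on_subset[OF bij_betw_imp_inj_on]) (auto simp: WW_def)
  also have "card WW = card VV'"
  proof -
    \<comment> \<open>\<phi> skips column n + 1 and \<psi> merges it into column n. Both are
      monotone, and the corners lie in columns up to n, which neither map moves.\<close>
    define \<phi> where "\<phi> c = (if c \<le> n then c else c + 1)" for c
    define \<psi> where "\<psi> c = (if c \<le> n then c else c - 1)" for c
    have \<phi>C: "(i, \<phi> c) \<in> C" if "(i, c) \<in> C'" for i c
      using that unfolding Ci C'i \<phi>_def by auto
    have \<psi>C: "(i, \<psi> c) \<in> C'" if "(i, c) \<in> C" for i c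
      using that unfolding Ci C'i \<psi>_def by auto
    have \<psi>\<phi>: "\<psi> (\<phi> c) = c" for c by (simp add: \<phi>_def \<psi>_def)
    have \<phi>\<psi>: "\<phi> (\<psi> c) = (if c = n + 1 then n else c)" for c by (auto simp: \<phi>_def \<psi>_def)
    have \<phi>mono: "c \<le> d \<Longrightarrow> \<phi> c \<le> \<phi> d" for c d by (auto simp: \<phi>_def)
    have \<psi>mono: "c \<le> d \<Longrightarrow> \<psi> c \<le> \<psi> d" for c d by (auto simp: \<psi>_def)
    define F where "F V = {(i, c). (i, c) \<in> C' \<and> (i, \<phi> c) \<in> V}" for V :: "(nat \<times> nat) set"
    define G where "G V = {(i, c). (i, c) \<in> C \<and> (i, \<psi> c) \<in> V}" for V :: "(nat \<times> nat) set"
    have GF: "G (F V) = V" if V: "V \<in> WW" for V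
    proof -
      have VC: "V \<subseteq> C" and sat: "\<And>i. (i, n + 1) \<in> V \<Longrightarrow> (i, n) \<in> V" and up: "up_closed C V"
        using V by (auto simp: WW_def VV_def up_closed_def)
      have "(i, c) \<in> G (F V) \<longleftrightarrow> (i, c) \<in> V" for i c
      proof (cases "(i, c) \<in> C")
        case True
        have "(i, n + 1) \<in> V" if "(i, n) \<in> V" "c = n + 1"
          using up that True unfolding up_closed_def by blast
        then show ?thesis
          using True \<psi>C[OF True] sat by (auto simp: G_def F_def \<phi>\<psi>)
      qed (use VC in \<open>auto simp: G_def\<close>)
      then show ?thesis by auto
    qed
    have FG: "F (G V) = V" if V: "V \<subseteq> C'" for V
      using V \<phi>C by (auto simp: F_def G_def \<psi>\<phi>)
    have upF: "up_closed C' (F V)" if up: "up_closed C V" for V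
      unfolding up_closed_def
    proof (intro conjI allI impI)
      fix i c assume ic: "(i, c) \<in> F V"
      then have c: "(i, c) \<in> C'" "(i, \<phi> c) \<in> V" by (auto simp: F_def)
      show "(i, c + 1) \<in> F V" if "(i, c + 1) \<in> C'"
        using D.up_closed_mono[OF up[unfolded C_def] c(2) \<phi>C[OF that, unfolded C_def] order_refl \<phi>mono] that
        by (simp add: F_def)
      show "(i - 1, c) \<in> F V" if "(i - 1, c) \<in> C'"
        using D.up_closed_mono[OF up[unfolded C_def] c(2) \<phi>C[OF that, unfolded C_def]] that
        by (simp add: F_def)
    qed (auto simp: F_def)
    have upG: "up_closed C (G V)" if up: "up_closed C' V" for V
      unfolding up_closed_def
    proof (intro conjI allI impI)
      fix i c assume ic: "(i, c) \<in> G V"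
      then have c: "(i, c) \<in> C" "(i, \<psi> c) \<in> V" by (auto simp: G_def)
      show "(i, c + 1) \<in> G V" if "(i, c + 1) \<in> C"
        using E.up_closed_mono[OF up[unfolded C'_def] c(2) \<psi>C[OF that, unfolded C'_def] order_refl \<psi>mono] that
        by (simp add: G_def)
      show "(i - 1, c) \<in> G V" if "(i - 1, c) \<in> C"
        using E.up_closed_mono[OF up[unfolded C'_def] c(2) \<psi>C[OF that, unfolded C'_def]] that
        by (simp add: G_def)
    qed (auto simp: G_def)
    have inv: "rows (G V) = rows V" "corners (G V) = corners V" if V: "V \<subseteq> C'" for V
    proof -
      have "\<exists>c. (i, c) \<in> G V" if "(i, c) \<in> V" for i c
        using that V \<phi>C[of i c] by (auto simp: G_def \<psi>\<phi> intro!: exI[of _ "\<phi> c"])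
      then have "rows V \<subseteq> rows (G V)" by (force simp: rows_def)
      moreover have "rows (G V) \<subseteq> rows V" by (force simp: rows_def G_def)
      ultimately show "rows (G V) = rows V" by blast
      have "(i, i + 1) \<in> G V \<longleftrightarrow> (i, i + 1) \<in> V" for i
      proof (cases "(i, i + 1) \<in> C")
        case True
        then have "\<psi> (i + 1) = i + 1" using n by (auto simp: Ci \<psi>_def)
        then show ?thesis using True by (simp add: G_def)
      next
        case False
        then have "(i, i + 1) \<notin> C'" using n by (auto simp: Ci C'i)
        then show ?thesis using False V by (auto simp: G_def)
      qed
      then show "corners (G V) = corners V" by (simp add: corners_def)
    qed
    show ?thesis
    proof (rule bij_betw_same_card[of F], rule bij_betw_byWitness[where f' = G])
      show "\<forall>V\<in>WW. G (F V) = V" using GF by blast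
      show "\<forall>V\<in>VV'. F (G V) = V" using FG by (auto simp: VV'_def up_closed_def)
      show "F ` WW \<subseteq> VV'"
      proof (rule image_subsetI)
        fix V assume V: "V \<in> WW"
        then have up: "up_closed C' (F V)" using upF by (auto simp: WW_def VV_def)
        then have "F V \<subseteq> C'" by (simp add: up_closed_def)
        from inv[OF this] show "F V \<in> VV'" using V up GF[OF V] by (auto simp: WW_def VV_def VV'_def)
      qed
      show "G ` VV' \<subseteq> WW"
      proof (rule image_subsetI)
        fix V assume V: "V \<in> VV'"
        then have up: "up_closed C' V" and VC: "V \<subseteq> C'" by (auto simp: VV'_def up_closed_def)
        have "(i, n) \<in> G V" if "(i, n + 1) \<in> G V" for i
          using that by (auto simp: G_def \<psi>_def Ci)
        then show "G V \<in> WW" using V upG[OF up] inv[OF VC] by (auto simp: WW_def VV_def VV'_def)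
      qed
    qed
  qed
  finally have "card (X1 \<inter> X2) = E" using cardVV' by simp
  moreover have "card X1 = T" using bij_betw_same_card[OF bij1] cardVV by simp
  moreover have "finite X"
  proof (rule finite_subset)
    show "X \<subseteq> Pow ?R" by (auto simp: X_def upper_subset_def)
    show "finite (Pow ?R)" unfolding D.R_cells using D.finite_cells by simp
  qed
  then have "finite X1" "finite X2" by (auto simp: X1_def X2_def)
  then have "card X + card (X1 \<inter> X2) = card X1 + card X2"
    unfolding cover by (rule card_Un_Int[symmetric])
  ultimately have "card X = 2 * T - E" using X12 by linarith
  moreover have "num_upper ?R ?S j = card X" by (simp add: num_upper_def X_def)
  ultimately show ?thesis
    unfolding T_def E_def by (simp only: sum_ballot_D[OF n j])
qed

theorem theorem1p1:
  fixes scale :: "complex \<Rightarrow> 'g::ab_group_add \<Rightarrow> 'g"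
    and bracket :: "'g \<Rightarrow> 'g \<Rightarrow> 'g"
    and h b :: "'g set"
    and n j :: nat
  assumes "simple_complex_lie_algebra scale bracket"
    and "complex_lie_algebra.borel_subalgebra scale bracket b"
    and "complex_lie_algebra.cartan_subalgebra scale bracket h"
    and "h \<subseteq> b"
    and "j \<le> n"
  shows "let P = complex_lie_algebra.num_ideals scale bracket h b;
             of_type = complex_lie_algebra.has_type scale bracket h b
         in (of_type Type_A n \<longrightarrow>
               real (P j) = (real j + 1) / (real n + 1) * real ((2 * n - j) choose n)) \<and>
            (of_type Type_B n \<longrightarrow> P j = (2 * n - j - 1) choose (n - 1)) \<and>
            (of_type Type_C n \<longrightarrow> P j = (2 * n - j - 1) choose (n - 1)) \<and>
            (of_type Type_D n \<longrightarrow>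
               P j = (if j = 0 then ((2 * n - 2) choose (n - 2)) + ((2 * n - 3) choose (n - 3))
                      else ((2 * n - 2 - j) choose (n - 2)) + ((2 * n - 3 - j) choose (n - 2))))"
proof -
  interpret simple_complex_lie_algebra scale bracket by fact
  interpret borel_setup scale bracket h b
    by unfold_locales (use assms in auto)
  \<comment> \<open>One statement for all types, because the type enters only through the Cartan
    matrix.\<close>
  have model: "num_ideals h b j = num_upper R (a ` {1..n}) j"
    if type: "has_type h b X n" and model: "root_model n N a pr q R (cartan_matrix X n)" for X N a pr q R
  proof -
    obtain \<alpha> where "bij_betw \<alpha> {1..n} (simple_roots h b)"
      "\<And>i j. i \<in> {1..n} \<Longrightarrow> j \<in> {1..n} \<Longrightarrow> \<alpha> i (coroot h (\<alpha> j)) = of_int (cartan_matrix X n i j)"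
      using type unfolding has_type_def by blast
    then interpret borel_model scale bracket h b n N a pr q R "cartan_matrix X n" \<alpha>
      using model by (intro borel_model.intro borel_setup_axioms borel_model_axioms.intro)
    show ?thesis by (rule num_ideals_eq_model)
  qed
  have rank: "standard_rank X n" if "has_type h b X n" for X
    using that by (simp add: has_type_def)
  have A: "real (num_ideals h b j) = (real j + 1) / (real n + 1) * real ((2 * n - j) choose n)"
    if t: "has_type h b Type_A n"
    using model[OF t root_model_A] num_upper_A[of n j] sum_ballot_A[OF assms(5)] rank[OF t] by simp
  have B: "num_ideals h b j = (2 * n - j - 1) choose (n - 1)" if t: "has_type h b Type_B n"
    using model[OF t root_model_BC[where L = "2 * n + 1"]] num_upper_BC[of n "2 * n + 1" j] sum_ballot_C[OF _ assms(5)] rank[OF t] by simp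
  have C: "num_ideals h b j = (2 * n - j - 1) choose (n - 1)" if t: "has_type h b Type_C n"
    using model[OF t root_model_BC[where L = "2 * n"]] num_upper_BC[of n "2 * n" j] sum_ballot_C[OF _ assms(5)] rank[OF t] by simp
  have D: "num_ideals h b j = (if j = 0 then ((2 * n - 2) choose (n - 2)) + ((2 * n - 3) choose (n - 3))
      else ((2 * n - 2 - j) choose (n - 2)) + ((2 * n - 3 - j) choose (n - 2)))"
    if t: "has_type h b Type_D n"
    using model[OF t root_model_D] num_upper_D[OF _ assms(5)] rank[OF t] by simp
  show ?thesis unfolding Let_def using A B C D by blast
qed

end
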